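(* Let $\alpha>0$, let $f\in\mathcal{G}^\alpha[1]$ with $$\lim_{z\to1,\,z\in\Delta}\frac{f(z)}{(1-z)^{1+\alpha}}=a\ne0,\infty,$$ and let $S=\{F_t\}_{t\ge0}$ be the semigroup generated by $f$. Assume that for a point $z\in\Delta$, the trajectory $\{F_t(z)\}_{t\ge0}$ can be extended to the whole real axis and $$\lim_{t\to-\infty}F_t(z)=1.$$ Then $\alpha\in[1,2]$ and (i) $|\arg(-a)|=\frac{\pi}{2}(2-\alpha)$; (ii) the trajectory $\{F_t(z)\}_{t<0}$ converges tangentially to the point $1$ as $t$ tends to $-\infty$; moreover, if $\arg(-a)\ne0$, then $$\lim_{t\to-\infty}\arg(1-F_t(z))=\operatorname{sgn}(\arg(-a))\,\frac{\pi}{2};$$ (iii) there is a backward flow invariant domain $\Omega\subset\Delta$ of $p$-type for $S$ which has a corner of opening $\pi\gamma$ at the point $z=1$ with $\gamma=\dfrac1\alpha$.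
   Context: $\Delta$ is the open unit disk in $\mathbb{C}$. A one-parameter continuous semigroup on $\Delta$ is a family $\{F_t\}_{t\ge0}$ of holomorphic self-mappings of $\Delta$ with $F_0=\mathrm{id}$, $F_{t+s}=F_t\circ F_s$, $\lim_{t\to0^+}F_t(z)=z$. Its generator is $f(z)=\lim_{t\to0^+}\frac{z-F_t(z)}{t}$, and $u(t,z)=F_t(z)$ solves $\partial_tu+f(u)=0$, $u(0,z)=z$. The trajectory of $z$ extends to the whole real axis if this solution exists with values in $\Delta$ for all $t\in\mathbb{R}$; its value at $t<0$ is denoted $F_t(z)$. $\mathcal{G}[1]$ is the class of all generators of semigroups with Denjoy-Wolff point $1$, i.e. $\lim_{t\to\infty}F_t(z)=1$ for all $z\in\Delta$. For $\alpha>0$, $\mathcal{G}^\alpha[1]$ is the class of $f\in\mathcal{G}[1]$ for which the unrestricted limit $\lim_{z\to1,\,z\in\Delta}f(z)/(1-z)^{1+\alpha}$ exists, is finite and nonzero. Powers of $1-z$ and $\arg$ are principal values. Tangential convergence to $1$ as $t\to-\infty$ means $F_t(z)\to 1$ and $\frac{1-|F_t(z)|}{|1-F_t(z)|}\to0$. A nonempty simply connected domain $\Omega\subset\Delta$ is a backward flow invariant domain (BFID) for $S$ if $S$ extends to a group on $\Omega$ (each $F_t|_\Omega$ is an automorphism of $\Omega$). If $\varphi:\Delta\to\Omega$ is a Riemann map, then $G_t=\varphi^{-1}\circ F_t\circ\varphi$, $t\in\mathbb{R}$, is a group of automorphisms of $\Delta$, and $\Omega$ is of $p$-type if this group is parabolic.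 $\Omega$ has a corner of opening $\pi\gamma$ at the point $1\in\partial\Omega$ if, for a conformal map $\varphi$ of $\Delta$ onto $\Omega$ extending continuously to $\overline\Delta$ with $\varphi(e^{i\theta_0})=1$, there is a real $\beta$ such that, for suitable continuous determinations, $\arg(\varphi(e^{i\theta})-1)\to\beta$ as $\theta\to\theta_0^+$ and $\arg(\varphi(e^{i\theta})-1)\to\beta+\pi\gamma$ as $\theta\to\theta_0^-$. *)

theory Defs
  imports "HOL-Complex_Analysis.Complex_Analysis"
begin

abbreviation unit_disc :: "complex set" where
  "unit_disc \<equiv> ball 0 1"

text \<open>The inverse of a holomorphic bijection between open sets is holomorphic, so it is not
  mentioned. With \<open>S = T\<close> these are the automorphisms of \<open>S\<close>.\<close>

definition conformal_onto :: "(complex \<Rightarrow> complex) \<Rightarrow> complex set \<Rightarrow> complex set \<Rightarrow> bool" where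
  "conformal_onto g S T \<longleftrightarrow> g holomorphic_on S \<and> bij_betw g S T"

text \<open>Only the values \<open>F t z\<close> with \<open>t \<ge> 0\<close> and \<open>z\<close> in the disc are relevant.\<close>

definition cont_semigroup :: "(real \<Rightarrow> complex \<Rightarrow> complex) \<Rightarrow> bool" where
  "cont_semigroup F \<longleftrightarrow>
     (\<forall>t\<ge>0. F t holomorphic_on unit_disc \<and> F t ` unit_disc \<subseteq> unit_disc) \<and>
     (\<forall>z\<in>unit_disc. F 0 z = z) \<and>
     (\<forall>t\<ge>0. \<forall>s\<ge>0. \<forall>z\<in>unit_disc. F (t + s) z = F t (F s z)) \<and>
     (\<forall>z\<in>unit_disc. ((\<lambda>t. F t z) \<longlongrightarrow> z) (at_right 0))"

definition generates :: "(complex \<Rightarrow> complex) \<Rightarrow> (real \<Rightarrow> complex \<Rightarrow> complex) \<Rightarrow> bool" where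
  "generates f F \<longleftrightarrow> cont_semigroup F \<and>
     (\<forall>z\<in>unit_disc. ((\<lambda>t. (z - F t z) / of_real t) \<longlongrightarrow> f z) (at_right 0))"

definition generators_DW1 :: "(complex \<Rightarrow> complex) set" where
  "generators_DW1 =
     {f. \<exists>F. generates f F \<and> (\<forall>z\<in>unit_disc. ((\<lambda>t. F t z) \<longlongrightarrow> 1) at_top)}"

definition generators_DW1_order :: "real \<Rightarrow> (complex \<Rightarrow> complex) set" where
  "generators_DW1_order \<alpha> =
     {f \<in> generators_DW1. \<exists>a. a \<noteq> 0 \<and>
        ((\<lambda>z. f z / (1 - z) powr of_real (1 + \<alpha>)) \<longlongrightarrow> a) (at 1 within unit_disc)}"

text \<open>\<open>u\<close> is the trajectory of \<open>z\<close>, extended to the whole real axis: \<open>u t\<close> is \<open>F\<^sub>t(z)\<close>, also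
  for \<open>t < 0\<close>. As \<open>f\<close> is holomorphic, there is at most one such \<open>u\<close>.\<close>

definition full_trajectory :: "(complex \<Rightarrow> complex) \<Rightarrow> complex \<Rightarrow> (real \<Rightarrow> complex) \<Rightarrow> bool" where
  "full_trajectory f z u \<longleftrightarrow> u 0 = z \<and>
     (\<forall>t. u t \<in> unit_disc \<and> (u has_vector_derivative - f (u t)) (at t))"

definition converges_tangentially_1_at_bot :: "(real \<Rightarrow> complex) \<Rightarrow> bool" where
  "converges_tangentially_1_at_bot u \<longleftrightarrow>
     (u \<longlongrightarrow> 1) at_bot \<and> ((\<lambda>t. (1 - norm (u t)) / norm (1 - u t)) \<longlongrightarrow> 0) at_bot"

text \<open>The extension to negative times of a semigroup whose elements are bijections of \<open>\<Omega>\<close>.\<close>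

definition group_extension ::
    "(real \<Rightarrow> complex \<Rightarrow> complex) \<Rightarrow> complex set \<Rightarrow> real \<Rightarrow> complex \<Rightarrow> complex" where
  "group_extension F \<Omega> t = (if t \<ge> 0 then F t else inv_into \<Omega> (F (- t)))"

text \<open>The group law on \<open>\<Omega>\<close> follows from the semigroup law.\<close>

definition BFID :: "(real \<Rightarrow> complex \<Rightarrow> complex) \<Rightarrow> complex set \<Rightarrow> bool" where
  "BFID F \<Omega> \<longleftrightarrow> open \<Omega> \<and> connected \<Omega> \<and> simply_connected \<Omega> \<and> \<Omega> \<noteq> {} \<and> \<Omega> \<subseteq> unit_disc \<and>
     (\<forall>t. conformal_onto (group_extension F \<Omega> t) \<Omega> \<Omega>)"

text \<open>A parabolic automorphism of the disc: its continuous extension \<open>h\<close> to the closed disc has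
  exactly one fixed point, which lies on the unit circle.\<close>

definition parabolic_automorphism :: "(complex \<Rightarrow> complex) \<Rightarrow> bool" where
  "parabolic_automorphism g \<longleftrightarrow> conformal_onto g unit_disc unit_disc \<and>
     (\<exists>h \<tau>. continuous_on (cball 0 1) h \<and> (\<forall>z\<in>unit_disc. h z = g z) \<and>
        norm \<tau> = 1 \<and> {z \<in> cball 0 1. h z = z} = {\<tau>})"

definition parabolic_group :: "(real \<Rightarrow> complex \<Rightarrow> complex) \<Rightarrow> bool" where
  "parabolic_group G \<longleftrightarrow>
     (\<forall>t. conformal_onto (G t) unit_disc unit_disc) \<and>
     (\<forall>z\<in>unit_disc. G 0 z = z) \<and>
     (\<forall>t s. \<forall>z\<in>unit_disc. G (t + s) z = G t (G s z)) \<and>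
     (\<forall>t. t \<noteq> 0 \<longrightarrow> parabolic_automorphism (G t))"

text \<open>Different Riemann maps give groups conjugate by an automorphism of the disc, so the choice
  of \<open>\<phi>\<close> is immaterial.\<close>

definition p_type :: "(real \<Rightarrow> complex \<Rightarrow> complex) \<Rightarrow> complex set \<Rightarrow> bool" where
  "p_type F \<Omega> \<longleftrightarrow>
     (\<exists>\<phi>. conformal_onto \<phi> unit_disc \<Omega> \<and>
        parabolic_group (\<lambda>t. inv_into unit_disc \<phi> \<circ> group_extension F \<Omega> t \<circ> \<phi>))"

text \<open>\<open>A\<close> is defined on a punctured interval around \<open>\<theta>\<^sub>0\<close>, so it consists of two continuous
  determinations of the argument, one on each side of \<open>\<theta>\<^sub>0\<close>.\<close>

definition has_corner :: "complex set \<Rightarrow> complex \<Rightarrow> real \<Rightarrow> bool" where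
  "has_corner \<Omega> p \<gamma> \<longleftrightarrow> p \<in> frontier \<Omega> \<and>
     (\<exists>\<phi> \<theta>\<^sub>0 \<beta> A \<delta>.
        conformal_onto \<phi> unit_disc \<Omega> \<and> continuous_on (cball 0 1) \<phi> \<and> \<phi> (cis \<theta>\<^sub>0) = p \<and>
        \<delta> > 0 \<and> continuous_on ({\<theta>\<^sub>0 - \<delta><..<\<theta>\<^sub>0 + \<delta>} - {\<theta>\<^sub>0}) A \<and>
        (\<forall>\<theta>\<in>{\<theta>\<^sub>0 - \<delta><..<\<theta>\<^sub>0 + \<delta>} - {\<theta>\<^sub>0}.
           \<phi> (cis \<theta>) \<noteq> p \<and> is_Arg (\<phi> (cis \<theta>) - p) (A \<theta>)) \<and>
        (A \<longlongrightarrow> \<beta>) (at_right \<theta>\<^sub>0) \<and> (A \<longlongrightarrow> \<beta> + pi * \<gamma>) (at_left \<theta>\<^sub>0))"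

end

theory Submission
  imports Defs "HOL-Real_Asymp.Real_Asymp"
begin

text \<open>In the coordinate \<open>q = 1 / (1 - z)\<close> the disc becomes the half-plane \<open>Re q > 1/2\<close>, the point \<open>1\<close>
  becomes \<open>\<infinity>\<close>, and the flow becomes \<open>q' = P q\<close> with \<open>Re P \<ge> 0\<close> (Wolff's lemma) and
  \<open>P q \<sim> b q\<^bsup>1-\<alpha>\<^esup>\<close>, \<open>b = - a\<close>. The sign of \<open>Re P\<close> along all rays gives
  \<open>\<bar>Arg b\<bar> + \<bar>1 - \<alpha>\<bar> \<pi>/2 \<le> \<pi>/2\<close>. Along a trajectory \<open>\<gamma>\<close>, l'Hopital's rule gives
  \<open>\<gamma>(t)\<^bsup>\<alpha>\<^esup> \<sim> \<alpha> b t\<close>, so \<open>\<alpha> \<bar>Arg (\<gamma> t)\<bar>\<close> tends to \<open>\<pi> - \<bar>Arg b\<bar>\<close> as \<open>t \<rightarrow> -\<infinity>\<close>; as this is at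
  most \<open>\<alpha> \<pi>/2\<close>, all the inequalities are equalities, which is (i) and (ii).

  A primitive \<open>H\<close> of \<open>1 / P\<close> linearizes the flow and is univalent (Noshiro--Warschawski). Along
  \<open>\<gamma>\<close> the real part strictly increases (unless \<open>P\<close> is constant), so \<open>\<gamma>\<close> is a graph over the real
  axis, and the part of the half-plane beyond it stays away from the boundary line. Hence \<open>H\<close> maps
  it properly, and therefore onto, a half-plane bounded by the real axis \<open>H \<circ> \<gamma>\<close>. Pulling back the
  translations gives the parabolic group; its domain is bounded by \<open>\<gamma>\<close>, and the corner at \<open>1\<close>
  is read off from the limits of \<open>Arg (\<gamma> t)\<close> at both ends.\<close>

section \<open>The Schwarz--Pick inequality and Wolff's lemma\<close>

text \<open>The limit of \<open>f\<close> is unrestricted, so the asymptotics of \<open>P\<close>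
  also hold along curves tangent to the boundary, as backward trajectories turn out to be. The
  definitions present a generator only as a pointwise right derivative at time 0. Holomorphy of
  \<open>P\<close> therefore comes from a normal family, and the translation law of \<open>H\<close>
  from a lemma on right derivatives. The sign \<sigma> = 1 or -1 records the side of the trajectory:
  \<open>Arg (\<gamma> t)\<close> tends to -\<sigma> pi/2 at -infinity. It is read off from the
  trajectory because for \<alpha> = 2 the number b is positive and its argument carries no sign. The
  forward limit angle is Arg b / \<alpha> = \<sigma> (pi/\<alpha> - pi/2), so the angles at the two
  ends differ by pi/\<alpha>. The main obstacle is surjectivity: nothing controls \<open>H\<close>
  near the line Re q = 1/2, so a set closed in the plane and contained in \<open>hp\<close> is
  needed before properness can be used. The affine modification \<open>E\<close> of \<open>H\<close>
  turns the half-plane reached into \<open>hp\<close> itself; the group on the disc is then explicit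
  and fixes 1.\<close>

lemma norm_sq_moebius:
  fixes a z :: complex
  shows "(cmod (1 - cnj a * z))\<^sup>2 - (cmod (z - a))\<^sup>2 = (1 - (cmod a)\<^sup>2) * (1 - (cmod z)\<^sup>2)"
  unfolding cmod_power2 by (simp add: power2_eq_square algebra_simps)

lemma moebius_denom_nonzero:
  fixes a z :: complex
  assumes "cmod a < 1" "cmod z < 1"
  shows "1 - cnj a * z \<noteq> 0"
proof
  assume "1 - cnj a * z = 0"
  then have "cmod a * cmod z = 1"
    by (metis complex_mod_cnj eq_iff_diff_eq_0 norm_mult norm_one)
  with assms show False
    by (metis less_irrefl mult_less_cancel_left2 mult_strict_mono' norm_ge_zero mult_1)
qed

lemma norm_moebius_less_1:
  fixes a z :: complex
  assumes "cmod a < 1" "cmod z < 1"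
  shows "cmod ((z - a) / (1 - cnj a * z)) < 1"
proof -
  have "(1 - (cmod a)\<^sup>2) * (1 - (cmod z)\<^sup>2) > 0"
    using assms by (intro mult_pos_pos) (simp_all add: power_less_one_iff)
  then have "(cmod (z - a))\<^sup>2 < (cmod (1 - cnj a * z))\<^sup>2"
    using norm_sq_moebius[of a z] by simp
  then have "cmod (z - a) < cmod (1 - cnj a * z)"
    by (simp add: power2_less_imp_less)
  then show ?thesis
    by (simp add: norm_divide divide_less_eq)
qed

text \<open>Disc automorphisms before and after \<open>F\<close> move \<open>w\<close> and
  \<open>F w\<close> to 0, where the Schwarz lemma applies. The denominators are cleared so that the
  inequality survives limits at the boundary.\<close>

lemma Schwarz_Pick:
  assumes holF: "F holomorphic_on unit_disc" and F: "F ` unit_disc \<subseteq> unit_disc"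
    and w: "w \<in> unit_disc" and z: "z \<in> unit_disc"
  shows "cmod (F z - F w) * cmod (1 - cnj w * z) \<le> cmod (z - w) * cmod (1 - cnj (F w) * F z)"
proof -
  define g where "g = (\<lambda>\<zeta>. (F ((\<zeta> + w) / (1 + cnj w * \<zeta>)) - F w)
                       / (1 - cnj (F w) * F ((\<zeta> + w) / (1 + cnj w * \<zeta>))))"
  have w1: "cmod w < 1" and z1: "cmod z < 1" using w z by auto
  have F1: "cmod (F x) < 1" if "cmod x < 1" for x using F that by force
  have T1: "cmod ((\<zeta> + w) / (1 + cnj w * \<zeta>)) < 1" if "cmod \<zeta> < 1" for \<zeta>
    using norm_moebius_less_1[of "-w" \<zeta>] w1 that by simp
  have T0: "1 + cnj w * \<zeta> \<noteq> 0" if "cmod \<zeta> < 1" for \<zeta>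
    using moebius_denom_nonzero[of "-w" \<zeta>] w1 that by simp
  have holT: "(\<lambda>\<zeta>. (\<zeta> + w) / (1 + cnj w * \<zeta>)) holomorphic_on unit_disc"
    using T0 by (intro holomorphic_intros) auto
  have "(F \<circ> (\<lambda>\<zeta>. (\<zeta> + w) / (1 + cnj w * \<zeta>))) holomorphic_on unit_disc"
    by (rule holomorphic_on_compose_gen[OF holT holF]) (use T1 in auto)
  then have holFT: "(\<lambda>\<zeta>. F ((\<zeta> + w) / (1 + cnj w * \<zeta>))) holomorphic_on unit_disc"
    by (simp add: o_def)
  have holg: "g holomorphic_on unit_disc"
    unfolding g_def using F1[OF w1] F1[OF T1] moebius_denom_nonzero
    by (intro holomorphic_intros holFT) auto
  have g1: "cmod (g \<zeta>) < 1" if "cmod \<zeta> < 1" for \<zeta>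
    unfolding g_def by (rule norm_moebius_less_1[OF F1[OF w1] F1[OF T1[OF that]]])
  define \<zeta> where "\<zeta> = (z - w) / (1 - cnj w * z)"
  have \<zeta>1: "cmod \<zeta> < 1" unfolding \<zeta>_def by (rule norm_moebius_less_1[OF w1 z1])
  have "cmod (g \<zeta>) \<le> cmod \<zeta>"
    by (rule Schwarz_Lemma(1)[OF holg _ g1 \<zeta>1]) (simp add: g_def)
  moreover have "(\<zeta> + w) / (1 + cnj w * \<zeta>) = z"
  proof -
    have d: "1 - cnj w * z \<noteq> 0" by (rule moebius_denom_nonzero[OF w1 z1])
    have d2: "1 - cnj w * w \<noteq> 0" by (rule moebius_denom_nonzero[OF w1 w1])
    have "\<zeta> + w = z * (1 - cnj w * w) / (1 - cnj w * z)"
      unfolding \<zeta>_def using d by (simp add: field_simps)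
    moreover have "1 + cnj w * \<zeta> = (1 - cnj w * w) / (1 - cnj w * z)"
      unfolding \<zeta>_def using d by (simp add: field_simps)
    ultimately show ?thesis using d d2 by simp
  qed
  ultimately have "cmod ((F z - F w) / (1 - cnj (F w) * F z)) \<le> cmod ((z - w) / (1 - cnj w * z))"
    by (simp add: g_def \<zeta>_def)
  then show ?thesis
    using moebius_denom_nonzero[OF w1 z1] moebius_denom_nonzero[OF F1[OF w1] F1[OF z1]]
    by (simp add: norm_divide field_simps)
qed

text \<open>Squaring and \<open>norm_sq_moebius\<close> trade the differences for the factors 1 -
  |w|^2 and 1 - |F w|^2. Both vanish as w tends to 1, and only their ratio matters for Wolff's
  lemma.\<close>

lemma Schwarz_Pick_kernel:
  assumes holF: "F holomorphic_on unit_disc" and F: "F ` unit_disc \<subseteq> unit_disc"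
    and w: "w \<in> unit_disc" and z: "z \<in> unit_disc"
  shows "(1 - (cmod w)\<^sup>2) * (1 - (cmod z)\<^sup>2) * (cmod (1 - cnj (F w) * F z))\<^sup>2
    \<le> (1 - (cmod (F w))\<^sup>2) * (1 - (cmod (F z))\<^sup>2) * (cmod (1 - cnj w * z))\<^sup>2"
proof -
  have "(cmod (F z - F w) * cmod (1 - cnj w * z))\<^sup>2 \<le> (cmod (z - w) * cmod (1 - cnj (F w) * F z))\<^sup>2"
    using Schwarz_Pick[OF assms] by (intro power_mono) auto
  then show ?thesis
    unfolding norm_sq_moebius[symmetric] by (simp add: power_mult_distrib algebra_simps)
qed

text \<open>The right-hand side is the Poisson kernel with pole 1, whose superlevel sets are the
  horodiscs at 1. Wolff's lemma thus becomes monotonicity of the real part of 1 / (1 - z).\<close>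

lemma Re_inverse_one_minus:
  fixes z :: complex
  assumes "z \<noteq> 1"
  shows "2 * Re (1 / (1 - z)) - 1 = (1 - (cmod z)\<^sup>2) / (cmod (1 - z))\<^sup>2"
proof -
  have "Re (1 / (1 - z)) = Re (1 - z) / (cmod (1 - z))\<^sup>2"
    by (simp add: Re_divide cmod_power2)
  moreover have "(cmod (1 - z))\<^sup>2 \<noteq> 0" using assms by simp
  moreover have "2 * Re (1 - z) - (cmod (1 - z))\<^sup>2 = 1 - (cmod z)\<^sup>2"
    unfolding cmod_power2 by (simp add: power2_eq_square algebra_simps)
  ultimately show ?thesis by (simp add: field_simps)
qed

text \<open>Along infinitely many steps of an orbit converging to \<open>1\<close> the modulus increases; there the
  Schwarz--Pick inequality between \<open>z\<close> and the orbit passes to the limit without a factor.\<close>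

lemma Wolff_half_plane:
  assumes holF: "F holomorphic_on unit_disc" and F: "F ` unit_disc \<subseteq> unit_disc"
    and W: "\<And>n. W n \<in> unit_disc" "\<And>n. W (Suc n) = F (W n)" "W \<longlonglongrightarrow> 1"
    and z: "z \<in> unit_disc"
  shows "Re (1 / (1 - z)) \<le> Re (1 / (1 - F z))"
proof -
  have freq: "\<exists>n\<ge>N. cmod (W n) \<le> cmod (W (Suc n))" for N
  proof (rule ccontr)
    assume "\<not> ?thesis"
    then have dec: "cmod (W (Suc n)) < cmod (W n)" if "n \<ge> N" for n using that by force
    have "cmod (W n) \<le> cmod (W N)" if "n \<ge> N" for n
      using that by (induction n rule: dec_induct) (auto dest: dec)
    then have "1 \<le> cmod (W N)"
      using W(3) by (intro LIMSEQ_le_const2[of "\<lambda>n. cmod (W n)" 1]) (auto intro: tendsto_eq_intros)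
    with W(1)[of N] show False by simp
  qed
  then obtain r where r: "\<And>n. r n \<ge> n" "\<And>n. cmod (W (r n)) \<le> cmod (W (Suc (r n)))" by metis
  have r_top: "filterlim r at_top sequentially"
    using r(1) by (intro filterlim_at_top_mono[OF filterlim_ident]) auto
  have Wr: "(\<lambda>n. W (r n)) \<longlonglongrightarrow> 1" using W(3) r_top by (rule filterlim_compose)
  have WSr: "(\<lambda>n. W (Suc (r n))) \<longlonglongrightarrow> 1"
    using LIMSEQ_Suc[OF W(3)] r_top by (rule filterlim_compose)
  have Fz: "F z \<in> unit_disc" using F z by blast
  have "(1 - (cmod z)\<^sup>2) * (cmod (1 - cnj 1 * F z))\<^sup>2 \<le> (1 - (cmod (F z))\<^sup>2) * (cmod (1 - cnj 1 * z))\<^sup>2"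
  proof (rule LIMSEQ_le)
    show "(\<lambda>n. (1 - (cmod z)\<^sup>2) * (cmod (1 - cnj (W (Suc (r n))) * F z))\<^sup>2)
            \<longlonglongrightarrow> (1 - (cmod z)\<^sup>2) * (cmod (1 - cnj 1 * F z))\<^sup>2"
      by (intro tendsto_intros WSr)
    show "(\<lambda>n. (1 - (cmod (F z))\<^sup>2) * (cmod (1 - cnj (W (r n)) * z))\<^sup>2)
            \<longlonglongrightarrow> (1 - (cmod (F z))\<^sup>2) * (cmod (1 - cnj 1 * z))\<^sup>2"
      by (intro tendsto_intros Wr)
    show "\<exists>N. \<forall>n\<ge>N. (1 - (cmod z)\<^sup>2) * (cmod (1 - cnj (W (Suc (r n))) * F z))\<^sup>2
            \<le> (1 - (cmod (F z))\<^sup>2) * (cmod (1 - cnj (W (r n)) * z))\<^sup>2"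
    proof (intro exI allI impI)
      fix n :: nat
      let ?w = "W (r n)"
      have w: "cmod ?w < 1" using W(1)[of "r n"] by simp
      have pos: "1 - (cmod ?w)\<^sup>2 > 0" using w by (simp add: power_less_one_iff)
      \<comment> \<open>The choice of \<open>r\<close> makes the modulus grow in this step, so the
        factor with \<open>F ?w\<close> may be replaced by the one with \<open>?w\<close>, which
        then cancels.\<close>
      have "1 - (cmod (F ?w))\<^sup>2 \<le> 1 - (cmod ?w)\<^sup>2"
        using r(2)[of n] W(2) by (simp add: power_mono)
      moreover have "0 \<le> (1 - (cmod (F z))\<^sup>2) * (cmod (1 - cnj ?w * z))\<^sup>2"
        using Fz by (intro mult_nonneg_nonneg) (auto simp: power_le_one)
      ultimately have "(1 - (cmod (F ?w))\<^sup>2) * ((1 - (cmod (F z))\<^sup>2) * (cmod (1 - cnj ?w * z))\<^sup>2)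
          \<le> (1 - (cmod ?w)\<^sup>2) * ((1 - (cmod (F z))\<^sup>2) * (cmod (1 - cnj ?w * z))\<^sup>2)"
        by (rule mult_right_mono)
      with Schwarz_Pick_kernel[OF holF F W(1)[of "r n"] z]
      have "(1 - (cmod ?w)\<^sup>2) * ((1 - (cmod z)\<^sup>2) * (cmod (1 - cnj (F ?w) * F z))\<^sup>2)
          \<le> (1 - (cmod ?w)\<^sup>2) * ((1 - (cmod (F z))\<^sup>2) * (cmod (1 - cnj ?w * z))\<^sup>2)"
        by (simp add: mult.assoc)
      with pos show "(1 - (cmod z)\<^sup>2) * (cmod (1 - cnj (W (Suc (r n))) * F z))\<^sup>2
            \<le> (1 - (cmod (F z))\<^sup>2) * (cmod (1 - cnj ?w * z))\<^sup>2"
        by (simp add: W(2))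
    qed
  qed
  moreover have "z \<noteq> 1" "F z \<noteq> 1" using z Fz by auto
  ultimately have "(1 - (cmod z)\<^sup>2) / (cmod (1 - z))\<^sup>2 \<le> (1 - (cmod (F z))\<^sup>2) / (cmod (1 - F z))\<^sup>2"
    by (simp add: divide_le_eq pos_le_divide_eq field_simps)
  then show ?thesis
    using Re_inverse_one_minus[OF \<open>z \<noteq> 1\<close>] Re_inverse_one_minus[OF \<open>F z \<noteq> 1\<close>] by simp
qed

section \<open>The semigroup in the half-plane\<close>

abbreviation hp :: "complex set" where
  "hp \<equiv> {q. Re q > 1/2}"

lemma hp_nonzero: "q \<in> hp \<Longrightarrow> q \<noteq> 0"
  by auto

lemma open_hp: "open hp"
  by (rule open_halfspace_Re_gt)

lemma convex_hp: "convex hp"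
  by (rule convex_halfspace_Re_gt)

lemma disc_to_hp:
  assumes "z \<in> unit_disc"
  shows "1 / (1 - z) \<in> hp"
proof -
  have "z \<noteq> 1" "(1 - (cmod z)\<^sup>2) / (cmod (1 - z))\<^sup>2 > 0"
    using assms by (auto intro!: divide_pos_pos simp: power_less_one_iff)
  then show ?thesis using Re_inverse_one_minus[of z] by simp
qed

lemma hp_to_disc:
  assumes "q \<in> hp"
  shows "1 - 1 / q \<in> unit_disc"
proof -
  have q: "q \<noteq> 0" using hp_nonzero[OF assms] .
  have "2 * Re (1 / (1 - (1 - 1/q))) - 1 > 0" using assms by simp
  then have "(1 - (cmod (1 - 1/q))\<^sup>2) / (cmod (1 - (1 - 1/q)))\<^sup>2 > 0"
    using Re_inverse_one_minus[of "1 - 1/q"] q by simp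
  then have "1 - (cmod (1 - 1/q))\<^sup>2 > 0" by (simp add: zero_less_divide_iff)
  then have "(cmod (1 - 1/q))\<^sup>2 < 1" by simp
  then have "cmod (1 - 1/q) < 1" by (simp add: power_less_one_iff)
  then show ?thesis by simp
qed

lemma generates_props:
  "generates f F \<Longrightarrow> t \<ge> 0 \<Longrightarrow> F t holomorphic_on unit_disc"
  "generates f F \<Longrightarrow> t \<ge> 0 \<Longrightarrow> F t ` unit_disc \<subseteq> unit_disc"
  "generates f F \<Longrightarrow> t \<ge> 0 \<Longrightarrow> z \<in> unit_disc \<Longrightarrow> F t z \<in> unit_disc"
  "generates f F \<Longrightarrow> z \<in> unit_disc \<Longrightarrow> F 0 z = z"
  "generates f F \<Longrightarrow> s \<ge> 0 \<Longrightarrow> t \<ge> 0 \<Longrightarrow> z \<in> unit_disc \<Longrightarrow> F (s + t) z = F s (F t z)"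
  "generates f F \<Longrightarrow> z \<in> unit_disc \<Longrightarrow> ((\<lambda>t. F t z) \<longlongrightarrow> z) (at_right 0)"
  "generates f F \<Longrightarrow> z \<in> unit_disc \<Longrightarrow> ((\<lambda>t. (z - F t z) / of_real t) \<longlongrightarrow> f z) (at_right 0)"
  unfolding generates_def cont_semigroup_def by (blast+)

lemma generator_half_plane_limit:
  assumes gen: "generates f F" and z: "z \<in> unit_disc"
  shows "((\<lambda>t. (1 / (1 - F t z) - 1 / (1 - z)) / of_real t) \<longlongrightarrow> - f z / (1 - z)\<^sup>2) (at_right 0)"
proof -
  have z1: "1 - z \<noteq> 0" using z by auto
  have "((\<lambda>t. - ((z - F t z) / of_real t) / ((1 - F t z) * (1 - z))) \<longlongrightarrow> - f z / ((1 - z) * (1 - z))) (at_right 0)"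
    using z1 by (intro tendsto_intros generates_props(6,7)[OF gen z]) auto
  moreover have "\<forall>\<^sub>F t in at_right 0. - ((z - F t z) / of_real t) / ((1 - F t z) * (1 - z))
      = (1 / (1 - F t z) - 1 / (1 - z)) / of_real t"
    unfolding eventually_at_right_field
  proof (intro exI conjI allI impI)
    fix t :: real assume "0 < t"
    then have "1 - F t z \<noteq> 0" using generates_props(3)[OF gen _ z, of t] by force
    then show "- ((z - F t z) / of_real t) / ((1 - F t z) * (1 - z))
      = (1 / (1 - F t z) - 1 / (1 - z)) / of_real t"
      using z1 \<open>0 < t\<close> by (simp add: divide_simps)
  qed (rule zero_less_one)
  ultimately show ?thesis by (simp add: tendsto_cong power2_eq_square)
qed

text \<open>The push-forward of the vector field -f under q = 1 / (1 - z): the derivative of this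
  coordinate is q^2.\<close>

definition hp_field :: "(complex \<Rightarrow> complex) \<Rightarrow> complex \<Rightarrow> complex" where
  "hp_field f q = - q\<^sup>2 * f (1 - 1 / q)"

lemma hp_field_disc:
  assumes "z \<in> unit_disc"
  shows "hp_field f (1 / (1 - z)) = - f z / (1 - z)\<^sup>2"
  using assms by (auto simp: hp_field_def power_divide)

text \<open>Wolff's lemma for the single map \<open>F t\<close>; the orbit tending to 1 is that of
  0, sampled at the multiples of t.\<close>

lemma semigroup_increases_Re:
  assumes gen: "generates f F" and DW: "\<And>z. z \<in> unit_disc \<Longrightarrow> ((\<lambda>t. F t z) \<longlongrightarrow> 1) at_top"
    and t: "t > 0" and z: "z \<in> unit_disc"
  shows "Re (1 / (1 - z)) \<le> Re (1 / (1 - F t z))"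
proof (rule Wolff_half_plane[where F = "F t" and W = "\<lambda>n. F (of_nat n * t) 0"])
  show "F (real (Suc n) * t) 0 = F t (F (real n * t) 0)" for n
    using generates_props(5)[OF gen, of t "real n * t" 0] t by (simp add: algebra_simps)
  have "filterlim (\<lambda>n. real n * t) at_top sequentially"
    using t by real_asymp
  then show "(\<lambda>n. F (real n * t) 0) \<longlonglongrightarrow> 1"
    using DW[of 0] by (auto intro: filterlim_compose)
qed (use t z generates_props[OF gen] in auto)

text \<open>The difference quotients have nonnegative real part, so composing them with
  \<open>\<lambda>w. 1 / (1 + w)\<close> gives a bounded, hence normal, family.\<close>

lemma hp_field_holomorphic:
  assumes gen: "generates f F" and DW: "\<And>z. z \<in> unit_disc \<Longrightarrow> ((\<lambda>t. F t z) \<longlongrightarrow> 1) at_top"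
  shows "hp_field f holomorphic_on hp" and "\<And>q. q \<in> hp \<Longrightarrow> Re (hp_field f q) \<ge> 0"
proof -
  define D where "D = (\<lambda>t q. (1 / (1 - F t (1 - 1/q)) - q) / complex_of_real t)"
  have D_lim: "((\<lambda>t. D t q) \<longlongrightarrow> hp_field f q) (at_right 0)" if "q \<in> hp" for q
    using generator_half_plane_limit[OF gen hp_to_disc[OF that]] hp_nonzero[OF that]
    by (simp add: D_def hp_field_def power_divide mult.commute)
  have D_Re: "Re (D t q) \<ge> 0" if "q \<in> hp" "t > 0" for t q
    using semigroup_increases_Re[OF gen DW \<open>t > 0\<close> hp_to_disc[OF that(1)]] that hp_nonzero[OF that(1)]
    by (simp add: D_def)
  show P_Re: "Re (hp_field f q) \<ge> 0" if "q \<in> hp" for q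
  proof (rule tendsto_lowerbound)
    show "((\<lambda>t. Re (D t q)) \<longlongrightarrow> Re (hp_field f q)) (at_right 0)"
      by (intro tendsto_intros D_lim that)
    show "\<forall>\<^sub>F t in at_right 0. 0 \<le> Re (D t q)"
      using D_Re[OF that] by (auto simp: eventually_at_right_field intro!: exI[of _ 1])
  qed simp
  define b where "b = (\<lambda>n::nat. \<lambda>q. 1 / (1 + D (inverse (real (Suc n))) q))"
  have one_plus: "1 + w \<noteq> 0 \<and> cmod (1 / (1 + w)) \<le> 1" if "Re w \<ge> 0" for w
  proof -
    have "1 \<le> Re (1 + w)" using that by simp
    also have "\<dots> \<le> cmod (1 + w)" by (rule complex_Re_le_cmod)
    finally show ?thesis by (auto simp: norm_divide divide_le_eq)
  qed
  have holD: "D t holomorphic_on hp" if "t > 0" for t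
  proof -
    have "(F t \<circ> (\<lambda>q. 1 - 1/q)) holomorphic_on hp"
      by (rule holomorphic_on_compose_gen[OF _ generates_props(1)[OF gen]])
        (use that hp_to_disc hp_nonzero in \<open>auto intro!: holomorphic_intros\<close>)
    then have "(\<lambda>q. F t (1 - 1/q)) holomorphic_on hp" by (simp add: o_def)
    moreover have "1 - F t (1 - 1/q) \<noteq> 0" if "q \<in> hp" for q
      using generates_props(3)[OF gen _ hp_to_disc[OF that], of t] \<open>t > 0\<close> by auto
    ultimately show ?thesis
      unfolding D_def using that by (intro holomorphic_intros) auto
  qed
  have tn: "inverse (real (Suc n)) > 0" for n by simp
  have holb: "b n holomorphic_on hp" for n
    unfolding b_def using one_plus[OF D_Re[OF _ tn]] holD[OF tn]
    by (intro holomorphic_intros) blast+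
  have tn_lim: "filterlim (\<lambda>n. inverse (real (Suc n))) (at_right 0) sequentially"
    unfolding filterlim_at using LIMSEQ_inverse_real_of_nat by (auto simp: eventually_sequentially)
  have b_lim: "(\<lambda>n. b n q) \<longlonglongrightarrow> 1 / (1 + hp_field f q)" if "q \<in> hp" for q
    unfolding b_def using one_plus[OF P_Re[OF that]]
    by (intro tendsto_intros filterlim_compose[OF D_lim[OF that] tn_lim]) auto
  obtain g r where g: "g holomorphic_on hp" and "strict_mono (r :: nat \<Rightarrow> nat)"
    and lim: "\<And>x. x \<in> hp \<Longrightarrow> (\<lambda>n. b (r n) x) \<longlonglongrightarrow> g x"
  proof (rule Montel[OF open_hp, of "range b" b])
    show "\<exists>B. \<forall>h\<in>range b. \<forall>z\<in>K. cmod (h z) \<le> B" if "K \<subseteq> hp" for K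
      using one_plus[OF D_Re[OF _ tn]] that by (intro exI[of _ 1]) (auto simp: b_def)
  qed (use holb in auto)
  \<comment> \<open>The pointwise limit of the whole sequence is already known, so the Montel
    subsequence only carries holomorphy over to it. The formula also shows that \<open>g\<close> has
    no zeros.\<close>
  have g_eq: "g q = 1 / (1 + hp_field f q)" if "q \<in> hp" for q
    using LIMSEQ_unique[OF lim[OF that] LIMSEQ_subseq_LIMSEQ[OF b_lim[OF that] \<open>strict_mono r\<close>, unfolded o_def]] .
  have "(\<lambda>q. 1 / g q - 1) holomorphic_on hp"
    using g g_eq one_plus[OF P_Re] by (intro holomorphic_intros) auto
  then show "hp_field f holomorphic_on hp"
    by (rule holomorphic_transform) (use g_eq one_plus[OF P_Re] in auto)
qed

section \<open>One-sided derivatives and the translation law of the linearizing map\<close>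

lemma has_vector_derivative_complex_iff:
  fixes g :: "real \<Rightarrow> complex"
  shows "(g has_vector_derivative v) (at x within S) \<longleftrightarrow>
    ((\<lambda>y. (g y - g x) / of_real (y - x)) \<longlongrightarrow> v) (at x within S)"
proof -
  have "cmod (g y - g x - (y - x) *\<^sub>R v) / \<bar>y - x\<bar> = cmod ((g y - g x) / of_real (y - x) - v)" if "y \<noteq> x" for y
  proof -
    have "(g y - g x) / of_real (y - x) - v = (g y - g x - (y - x) *\<^sub>R v) / of_real (y - x)"
      using that by (simp add: scaleR_conv_of_real field_simps)
    then show ?thesis by (simp only: norm_divide norm_of_real)
  qed
  then have "((\<lambda>y. cmod (g y - g x - (y - x) *\<^sub>R v) / \<bar>y - x\<bar>) \<longlongrightarrow> 0) (at x within S) \<longleftrightarrow>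
     ((\<lambda>y. cmod ((g y - g x) / of_real (y - x) - v)) \<longlongrightarrow> 0) (at x within S)"
    by (intro tendsto_cong) (simp add: eventually_at_filter)
  then show ?thesis
    unfolding has_vector_derivative_def has_derivative_iff_norm tendsto_norm_zero_iff
    by (simp add: bounded_linear_scaleR_left Lim_null[symmetric] flip: Lim_null)
qed

text \<open>With right derivatives only, the mean value theorem is replaced by a last-point
  argument: for the deviation k from the affine function and any slope e > 0, take the largest s in
  {0..t} with |k s| <= e s. The vanishing right derivative of k at s pushes the estimate beyond s,
  unless s = t.\<close>

lemma right_derivative_constant:
  fixes g :: "real \<Rightarrow> 'a::real_normed_vector"
  assumes cont: "continuous_on {0..} g"
    and deriv: "\<And>t. t \<ge> 0 \<Longrightarrow> (g has_vector_derivative c) (at t within {t..})"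
    and "t \<ge> 0"
  shows "g t = g 0 + t *\<^sub>R c"
proof -
  define k where "k = (\<lambda>t. g t - g 0 - t *\<^sub>R c)"
  have contk: "continuous_on {0..} k"
    unfolding k_def by (intro continuous_intros cont)
  have le: "norm (k t) \<le> e * t" if "e > 0" for e
  proof (rule ccontr)
    assume neg: "\<not> ?thesis"
    define S where "S = {s \<in> {0..t}. norm (k s) \<le> e * s}"
    have "compact S"
    proof -
      have "closed S" unfolding S_def
        by (intro continuous_on_closed_Collect_le continuous_intros continuous_on_subset[OF contk]) auto
      moreover have "bounded S"
        by (rule bounded_subset[of "{0..t}"]) (auto simp: S_def)
      ultimately show ?thesis by (simp add: compact_eq_bounded_closed)
    qed
    moreover have "0 \<in> S" using \<open>t \<ge> 0\<close> by (simp add: S_def k_def)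
    ultimately obtain s where s: "s \<in> S" "\<And>x. x \<in> S \<Longrightarrow> x \<le> s"
      using compact_attains_sup[of S] by auto
    have "s \<noteq> t" using s(1) neg by (auto simp: S_def)
    then have st: "0 \<le> s" "s < t" "norm (k s) \<le> e * s" using s(1) by (auto simp: S_def)
    have "(k has_vector_derivative (c - 0 - 1 *\<^sub>R c)) (at s within {s..})"
      unfolding k_def by (auto intro!: derivative_eq_intros deriv[OF st(1)])
    then have "(k has_derivative (\<lambda>x. 0)) (at s within {s..})"
      by (simp add: has_vector_derivative_def)
    then obtain d where d: "d > 0" "\<And>y. y \<in> {s..} \<Longrightarrow> norm (y - s) < d \<Longrightarrow> norm (k y - k s - 0) \<le> e * norm (y - s)"
      unfolding has_derivative_within_alt using \<open>e > 0\<close> by blast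
    define y where "y = min t (s + d/2)"
    have y: "s < y" "y \<le> t" "y - s < d" using st d(1) by (auto simp: y_def)
    have "norm (k y) \<le> norm (k s) + norm (k y - k s)" by (rule norm_triangle_sub)
    also have "\<dots> \<le> e * s + e * (y - s)"
      using d(2)[of y] y st by simp
    finally have "y \<in> S" using y st by (simp add: S_def algebra_simps)
    with s(2)[of y] y show False by simp
  qed
  have "norm (k t) \<le> 0"
  proof (rule field_le_epsilon)
    fix e :: real assume "e > 0"
    have "norm (k t) \<le> e / (t + 1) * t" using \<open>t \<ge> 0\<close> \<open>e > 0\<close> by (intro le) auto
    also have "\<dots> \<le> e" using \<open>t \<ge> 0\<close> \<open>e > 0\<close> by (simp add: field_simps)
    finally show "norm (k t) \<le> 0 + e" by simp
  qed
  then show ?thesis by (simp add: k_def algebra_simps)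
qed

text \<open>Right continuity at time 0 spreads to all times, from both sides: \<open>F t z\<close>
  is \<open>F s\<close> applied to \<open>F (t - s) z\<close>, and Schwarz--Pick bounds the distance
  to \<open>F s z\<close> with the constant 2 / (1 - |z|), which does not depend on s.\<close>

lemma semigroup_continuous_on:
  assumes gen: "generates f F" and z: "z \<in> unit_disc"
  shows "continuous_on {0..} (\<lambda>t. F t z)"
proof -
  define L where "L = 2 / (1 - cmod z)"
  have z1: "cmod z < 1" using z by simp
  have le: "cmod (F t z - F s z) \<le> L * cmod (F (t - s) z - z)" if "0 \<le> s" "s \<le> t" for s t
  proof -
    let ?x = "F (t - s) z"
    have x: "?x \<in> unit_disc" using generates_props(3)[OF gen _ z] that by simp
    have fx: "F s ?x \<in> unit_disc" "F s z \<in> unit_disc"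
      using generates_props(3)[OF gen] x z that by auto
    have "F t z = F s ?x" using generates_props(5)[OF gen, of s "t - s" z] that z by simp
    moreover have "cmod (F s ?x - F s z) * cmod (1 - cnj z * ?x) \<le> cmod (?x - z) * cmod (1 - cnj (F s z) * F s ?x)"
      using Schwarz_Pick[OF generates_props(1,2)[OF gen that(1)] z x]
        generates_props(1,2)[OF gen that(1)] by blast
    moreover have "cmod (1 - cnj (F s z) * F s ?x) \<le> 2"
    proof -
      have "cmod (cnj (F s z) * F s ?x) \<le> 1"
        unfolding norm_mult using fx by (intro mult_le_one) auto
      then show ?thesis using norm_triangle_ineq4[of 1 "cnj (F s z) * F s ?x"] by simp
    qed
    moreover have "1 - cmod z \<le> cmod (1 - cnj z * ?x)"
    proof -
      have "cmod (cnj z * ?x) \<le> cmod z * 1"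
        unfolding norm_mult using x by (intro mult_mono) auto
      then show ?thesis using norm_triangle_ineq2[of 1 "cnj z * ?x"] by simp
    qed
    ultimately have "cmod (F t z - F s z) * (1 - cmod z) \<le> cmod (?x - z) * 2"
      using mult_left_mono[of "1 - cmod z" "cmod (1 - cnj z * ?x)" "cmod (F t z - F s z)"]
        mult_left_mono[of "cmod (1 - cnj (F s z) * F s ?x)" 2 "cmod (?x - z)"] by simp
    then show ?thesis using z1 by (simp add: L_def field_simps)
  qed
  have F0: "((\<lambda>h. L * cmod (F h z - z)) \<longlongrightarrow> 0) (at_right 0)"
    by (rule tendsto_eq_intros refl generates_props(6)[OF gen z] | simp)+
  have dist_le: "dist (F t z) (F s z) \<le> L * cmod (F \<bar>t - s\<bar> z - z)" if "0 \<le> s" "0 \<le> t" for s t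
    using le[of s t] le[of t s] that by (cases "s \<le> t") (auto simp: dist_norm norm_minus_commute)
  show ?thesis
    unfolding continuous_on_def
  proof (intro ballI)
    fix s :: real assume s: "s \<in> {0..}"
    have "filterlim (\<lambda>t. \<bar>t - s\<bar>) (at_right 0) (at s within {0..})"
      unfolding filterlim_at
      by (auto intro!: tendsto_eq_intros simp: eventually_at_filter)
    note lim = filterlim_compose[OF F0 this]
    have "((\<lambda>t. dist (F t z) (F s z)) \<longlongrightarrow> 0) (at s within {0..})"
    proof (rule tendsto_sandwich[OF _ _ tendsto_const lim])
      show "\<forall>\<^sub>F t in at s within {0..}. dist (F t z) (F s z) \<le> L * cmod (F \<bar>t - s\<bar> z - z)"
        unfolding eventually_at_filter using s by (intro always_eventually allI impI dist_le) auto
    qed simp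
    then show "((\<lambda>t. F t z) \<longlongrightarrow> F s z) (at s within {0..})"
      by (rule tendsto_dist_iff[THEN iffD2])
  qed
qed

text \<open>Along an orbit, H has right derivative P * (1 / P) = 1. Any semigroup generated by f is
  covered; this serves both the given semigroup and the one witnessing the Denjoy--Wolff
  point.\<close>

lemma semigroup_translation:
  assumes gen: "generates f F" and z: "z \<in> unit_disc" and t: "t \<ge> 0"
    and nz: "\<And>q. q \<in> hp \<Longrightarrow> hp_field f q \<noteq> 0"
    and H: "\<And>q. q \<in> hp \<Longrightarrow> (H has_field_derivative 1 / hp_field f q) (at q)"
  shows "H (1 / (1 - F t z)) = H (1 / (1 - z)) + of_real t"
proof -
  have F1: "F s z \<noteq> 1" if "s \<ge> 0" for s
    using generates_props(3)[OF gen that z] by auto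
  have Fq: "1 / (1 - F s z) \<in> hp" if "s \<ge> 0" for s
    using disc_to_hp[OF generates_props(3)[OF gen that z]] .
  have contH: "continuous_on hp H"
    using H by (meson DERIV_continuous_on has_field_derivative_at_within)
  have "continuous_on {0..} (\<lambda>s. H (1 / (1 - F s z)))"
    by (rule continuous_on_compose2[OF contH])
      (use F1 Fq in \<open>auto intro!: continuous_intros semigroup_continuous_on[OF gen z]\<close>)
  moreover have "((\<lambda>s. H (1 / (1 - F s z))) has_vector_derivative 1) (at s within {s..})" if s: "s \<ge> 0" for s
  proof -
    let ?\<zeta> = "F s z"
    have \<zeta>: "?\<zeta> \<in> unit_disc" using generates_props(3)[OF gen s z] .
    \<comment> \<open>The semigroup law reduces the quotient at time s to the one at time 0 for the
      point \<open>F s z\<close>.\<close>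
    have "((\<lambda>h. (1 / (1 - F (h + s) z) - 1 / (1 - F s z)) / of_real (h + s - s)) \<longlongrightarrow> hp_field f (1 / (1 - ?\<zeta>))) (at_right 0)"
      using generator_half_plane_limit[OF gen \<zeta>] unfolding hp_field_disc[OF \<zeta>]
      by (rule Lim_transform_eventually)
        (use generates_props(5)[OF gen _ s z] in \<open>auto simp: eventually_at_right_field intro!: exI[of _ 1]\<close>)
    then have "((\<lambda>t. 1 / (1 - F t z)) has_vector_derivative hp_field f (1 / (1 - ?\<zeta>))) (at s within {s..})"
      by (simp add: has_vector_derivative_complex_iff at_within_Ici_at_right filterlim_at_right_to_0[of _ _ s])
    from field_vector_diff_chain_within[OF this, of H "1 / hp_field f (1 / (1 - ?\<zeta>))"]
    show ?thesis
      using H[OF Fq[OF s]] nz[OF Fq[OF s]] by (simp add: o_def has_field_derivative_at_within)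
  qed
  ultimately have "H (1 / (1 - F t z)) = H (1 / (1 - F 0 z)) + t *\<^sub>R 1"
    using t by (rule right_derivative_constant)
  then show ?thesis using generates_props(4)[OF gen z] by (simp add: scaleR_conv_of_real)
qed

section \<open>Growth of trajectories\<close>

text \<open>The counterpart of unrestricted approach to 1 in the disc; no sector is imposed.\<close>

abbreviation at_hp_infinity :: "complex filter" where
  "at_hp_infinity \<equiv> inf at_infinity (principal hp)"

lemma filterlim_at_hp_infinity:
  "filterlim g at_hp_infinity F \<longleftrightarrow> filterlim g at_infinity F \<and> eventually (\<lambda>x. g x \<in> hp) F"
  by (simp add: filterlim_inf filterlim_principal)

lemma eventually_at_hp_infinity:
  "eventually Q at_hp_infinity \<longleftrightarrow> (\<exists>M. \<forall>q\<in>hp. M \<le> cmod q \<longrightarrow> Q q)"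
  by (auto simp: eventually_inf_principal eventually_at_infinity)

lemma powr_of_real_polar:
  assumes "q \<noteq> 0"
  shows "q powr of_real c = of_real (cmod q powr c) * cis (c * Arg q)"
  using assms by (simp add: powr_def Ln_Arg exp_add algebra_simps cis_conv_exp flip: exp_of_real)

lemma Arg_in_hp:
  assumes "q \<in> hp"
  shows "\<bar>Arg q\<bar> < pi/2"
  using assms Arg_Re_pos[of q] by auto

lemma filterlim_hp_to_disc:
  "filterlim (\<lambda>q. 1 - 1 / q) (at 1 within unit_disc) at_hp_infinity"
  unfolding filterlim_at
proof
  have "((\<lambda>q::complex. 1 - 1 / q) \<longlongrightarrow> 1 - 0) at_infinity"
    by (intro tendsto_intros tendsto_divide_0[OF tendsto_const] filterlim_ident)
  then show "((\<lambda>q::complex. 1 - 1 / q) \<longlongrightarrow> 1) at_hp_infinity"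
    by (auto intro: tendsto_mono[rotated])
  show "\<forall>\<^sub>F q in at_hp_infinity. 1 - 1 / q \<in> unit_disc \<and> 1 - 1 / q \<noteq> 1"
    unfolding eventually_at_hp_infinity using hp_to_disc hp_nonzero by (intro exI[of _ 0]) auto
qed

text \<open>The factor q^2 of \<open>hp_field\<close> meets (1 - z)^(1+\<alpha>) = q^(-1-\<alpha>).
  The principal powers combine because q avoids the branch cut.\<close>

lemma hp_field_asymptotics:
  assumes "((\<lambda>z. f z / (1 - z) powr of_real (1 + \<alpha>)) \<longlongrightarrow> a) (at 1 within unit_disc)"
  shows "((\<lambda>q. hp_field f q / q powr of_real (1 - \<alpha>)) \<longlongrightarrow> - a) at_hp_infinity"
proof -
  have main: "((\<lambda>q. - (f (1 - 1/q) / (1 - (1 - 1/q)) powr of_real (1 + \<alpha>))) \<longlongrightarrow> - a) at_hp_infinity"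
    by (intro tendsto_minus filterlim_compose[OF assms filterlim_hp_to_disc])
  have "- (f (1 - 1/q) / (1 - (1 - 1/q)) powr of_real (1 + \<alpha>)) = hp_field f q / q powr of_real (1 - \<alpha>)"
    if "q \<in> hp" for q
  proof -
    have q: "q \<noteq> 0" "q \<notin> \<real>\<^sub>\<le>\<^sub>0" using that by (auto simp: complex_nonpos_Reals_iff)
    have inv: "(1 / q) powr of_real (1 + \<alpha>) = inverse (q powr of_real (1 + \<alpha>))"
      using q Ln_inverse[of q] by (simp add: powr_def inverse_eq_divide[symmetric] exp_minus[symmetric])
    have prod: "q\<^sup>2 = q powr of_real (1 + \<alpha>) * q powr of_real (1 - \<alpha>)"
      using q by (simp flip: powr_add)
    have "q powr of_real (1 - \<alpha>) \<noteq> 0" using q by simp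
    moreover have one: "1 - (1 - 1 / q) = 1 / q" by simp
    ultimately show ?thesis unfolding hp_field_def one inv prod by (simp add: divide_inverse mult_ac)
  qed
  then have "\<forall>\<^sub>F q in at_hp_infinity. - (f (1 - 1/q) / (1 - (1 - 1/q)) powr of_real (1 + \<alpha>))
      = hp_field f q / q powr of_real (1 - \<alpha>)"
    unfolding eventually_at_hp_infinity by blast
  with main show ?thesis by (rule Lim_transform_eventually)
qed

text \<open>An interval on which the cosine is nonnegative lies in one of the intervals of length pi
  around multiples of 2 pi; the bound on \<psi> singles out the one around 0.\<close>

lemma cos_nonneg_interval_bound:
  assumes "\<bar>\<psi>\<bar> \<le> pi" "m \<ge> 0" and cos: "\<And>s. \<bar>s\<bar> \<le> m \<Longrightarrow> cos (\<psi> + s) \<ge> 0"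
  shows "\<bar>\<psi>\<bar> + m \<le> pi / 2"
proof (rule ccontr)
  assume neg: "\<not> ?thesis"
  \<comment> \<open>The shift is capped so that |\<psi>| + s lands in the interval from pi/2
    (excluded) to pi, where the cosine is negative.\<close>
  define s where "s = max 0 (min m (pi - \<bar>\<psi>\<bar>))"
  have "cos (\<bar>\<psi>\<bar> + s) < 0"
  proof -
    have "pi / 2 < \<bar>\<psi>\<bar> + s" "\<bar>\<psi>\<bar> + s \<le> pi" using neg assms(1,2) pi_gt_zero by (auto simp: s_def min_def)
    then show ?thesis using cos_monotone_0_pi[of "pi/2" "\<bar>\<psi>\<bar> + s"] pi_gt_zero by simp
  qed
  moreover have "cos (\<bar>\<psi>\<bar> + s) = (if \<psi> \<ge> 0 then cos (\<psi> + s) else cos (\<psi> + - s))"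
    using cos_minus[of "\<psi> - s"] by simp
  moreover have "cos (\<psi> + s) \<ge> 0" "cos (\<psi> + - s) \<ge> 0"
    using assms(2) by (intro cos; simp add: s_def)+
  ultimately show False by (auto split: if_splits)
qed

text \<open>On the ray of angle \<theta>, P q divided by |q|^(1-\<alpha>) tends to b * cis ((1 -
  \<alpha>) \<theta>), so this limit has nonnegative real part. As \<theta> varies, the angles Arg b
  + (1 - \<alpha>) \<theta> fill an interval of half-length |1 - \<alpha>| pi/2.\<close>

lemma Arg_leading_coeff_bound:
  assumes lim: "((\<lambda>q. P q / q powr of_real (1 - \<alpha>)) \<longlongrightarrow> b) at_hp_infinity" and "b \<noteq> 0"
    and Re: "\<And>q. q \<in> hp \<Longrightarrow> Re (P q) \<ge> 0"
  shows "\<bar>Arg b\<bar> + \<bar>1 - \<alpha>\<bar> * (pi / 2) \<le> pi / 2"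
proof (rule cos_nonneg_interval_bound)
  have open_case: "Re (b * cis ((1 - \<alpha>) * \<theta>)) \<ge> 0" if \<theta>: "\<bar>\<theta>\<bar> < pi / 2" for \<theta>
  proof -
    have c: "cos \<theta> > 0" using \<theta> by (intro cos_gt_zero_pi) auto
    have Arg: "Arg (of_real r * cis \<theta>) = \<theta>" if "r > 0" for r
      using that \<theta> pi_gt_zero by (subst rcis_def[symmetric], intro Arg_rcis) auto
    have ray: "filterlim (\<lambda>r. of_real r * cis \<theta>) at_hp_infinity at_top"
      unfolding filterlim_at_hp_infinity
    proof
      show "filterlim (\<lambda>r. of_real r * cis \<theta>) at_infinity at_top"
        unfolding filterlim_at_infinity_conv_norm_at_top by (simp add: norm_mult filterlim_abs_real)
      show "\<forall>\<^sub>F r in at_top. of_real r * cis \<theta> \<in> hp"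
        using eventually_gt_at_top[of "1 / (2 * cos \<theta>)"] by eventually_elim (use c in \<open>simp add: field_simps\<close>)
    qed
    \<comment> \<open>The factor \<open>cis ((1 - \<alpha>) * \<theta>)\<close> cancels the phase of
      the power, leaving a division by a positive real.\<close>
    have "((\<lambda>r. P (of_real r * cis \<theta>) / (of_real r * cis \<theta>) powr of_real (1 - \<alpha>) * cis ((1 - \<alpha>) * \<theta>))
       \<longlongrightarrow> b * cis ((1 - \<alpha>) * \<theta>)) at_top"
      by (intro tendsto_intros filterlim_compose[OF lim ray])
    then have "((\<lambda>r. Re (P (of_real r * cis \<theta>) / (of_real r * cis \<theta>) powr of_real (1 - \<alpha>) * cis ((1 - \<alpha>) * \<theta>)))
       \<longlongrightarrow> Re (b * cis ((1 - \<alpha>) * \<theta>))) at_top"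
      by (rule tendsto_Re)
    moreover have "\<forall>\<^sub>F r in at_top. 0 \<le> Re (P (of_real r * cis \<theta>) / (of_real r * cis \<theta>) powr of_real (1 - \<alpha>) * cis ((1 - \<alpha>) * \<theta>))"
      using eventually_gt_at_top[of 0] ray[unfolded filterlim_at_hp_infinity, THEN conjunct2]
    proof eventually_elim
      case (elim r)
      have eq: "(of_real r * cis \<theta>) powr of_real (1 - \<alpha>) = of_real (r powr (1 - \<alpha>)) * cis ((1 - \<alpha>) * \<theta>)"
        using elim Arg[of r] powr_of_real_polar[of "of_real r * cis \<theta>" "1 - \<alpha>"] by (simp add: norm_mult)
      have "P (of_real r * cis \<theta>) / (of_real r * cis \<theta>) powr of_real (1 - \<alpha>) * cis ((1 - \<alpha>) * \<theta>)
        = P (of_real r * cis \<theta>) / of_real (r powr (1 - \<alpha>))"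
        unfolding eq by simp
      then show ?case using Re[OF elim(2)] by simp
    qed
    ultimately show ?thesis by (rule tendsto_lowerbound) simp
  qed
  \<comment> \<open>Vertical rays need not lie in \<open>hp\<close>; the extreme angles are reached
    by continuity of the limit in \<theta>.\<close>
  have closed_case: "Re (b * cis ((1 - \<alpha>) * \<theta>)) \<ge> 0" if \<theta>: "\<bar>\<theta>\<bar> \<le> pi / 2" for \<theta>
  proof (rule continuous_ge_on_closure[of "{-(pi/2)<..<pi/2}" "\<lambda>\<theta>. Re (b * cis ((1 - \<alpha>) * \<theta>))" \<theta>])
    show "continuous_on (closure {- (pi / 2)<..<pi / 2}) (\<lambda>\<theta>. Re (b * cis ((1 - \<alpha>) * \<theta>)))"
      by (intro continuous_intros)
  qed (use \<theta> open_case in auto)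
  show "0 \<le> cos (Arg b + s)" if s: "\<bar>s\<bar> \<le> \<bar>1 - \<alpha>\<bar> * (pi / 2)" for s
  proof -
    obtain \<theta> where \<theta>: "\<bar>\<theta>\<bar> \<le> pi / 2" "(1 - \<alpha>) * \<theta> = s"
    proof (cases "\<alpha> = 1")
      case True with s that[of 0] show ?thesis by simp
    next
      case False
      then have "\<bar>s / (1 - \<alpha>)\<bar> \<le> pi / 2" using s by (simp add: field_simps)
      with that[of "s / (1 - \<alpha>)"] False show ?thesis by simp
    qed
    have "b * cis s = of_real (cmod b) * cis (Arg b + s)"
      by (metis rcis_cmod_Arg rcis_def cis_mult mult.assoc)
    then have "Re (b * cis s) = cmod b * cos (Arg b + s)" by simp
    then show ?thesis using closed_case[OF \<theta>(1)] \<theta>(2) \<open>b \<noteq> 0\<close> by (simp add: zero_le_mult_iff)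
  qed
  show "\<bar>Arg b\<bar> \<le> pi" using Arg_bounded[of b] by auto
qed simp

text \<open>The real l'Hopital rule, in the form where only the denominator is required to tend to
  infinity, applied to the real and imaginary parts.\<close>

lemma linear_growth_at_top:
  fixes g :: "real \<Rightarrow> complex"
  assumes deriv: "\<And>t. (g has_vector_derivative g' t) (at t)" and lim: "(g' \<longlongrightarrow> L) at_top"
  shows "((\<lambda>t. g t / of_real t) \<longlongrightarrow> L) at_top"
proof -
  have "((\<lambda>t. Re (g t) / t) \<longlongrightarrow> Re L) at_top"
    by (rule lhospital_at_top_at_top[where g' = "\<lambda>_. 1" and f' = "\<lambda>t. Re (g' t)"])
      (use tendsto_Re[OF lim] in
        \<open>auto intro!: always_eventually derivative_eq_intros has_field_derivative_Re deriv filterlim_ident\<close>)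
  moreover have "((\<lambda>t. Im (g t) / t) \<longlongrightarrow> Im L) at_top"
    by (rule lhospital_at_top_at_top[where g' = "\<lambda>_. 1" and f' = "\<lambda>t. Im (g' t)"])
      (use tendsto_Im[OF lim] in
        \<open>auto intro!: always_eventually derivative_eq_intros has_field_derivative_Im deriv filterlim_ident\<close>)
  ultimately show ?thesis by (simp add: tendsto_complex_iff)
qed

lemma linear_growth_at_bot:
  fixes g :: "real \<Rightarrow> complex"
  assumes deriv: "\<And>t. (g has_vector_derivative g' t) (at t)" and lim: "(g' \<longlongrightarrow> L) at_bot"
  shows "((\<lambda>t. g t / of_real t) \<longlongrightarrow> L) at_bot"
proof -
  have "((\<lambda>t. g (- t)) has_vector_derivative - g' (- t)) (at t)" for t
    using vector_diff_chain_at[of uminus "-1" t g "g' (- t)"] deriv[of "- t"]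
    by (auto simp: o_def has_vector_derivative_minus[OF has_vector_derivative_id])
  moreover have "((\<lambda>t. - g' (- t)) \<longlongrightarrow> - L) at_top"
    using lim by (auto simp: filterlim_at_bot_mirror intro: tendsto_minus)
  ultimately have "((\<lambda>t. g (- t) / of_real t) \<longlongrightarrow> - L) at_top"
    by (rule linear_growth_at_top)
  from tendsto_minus[OF this] show ?thesis by (simp add: filterlim_at_bot_mirror)
qed

text \<open>The derivative of \<gamma>^\<alpha> is \<alpha> P(\<gamma>) / \<gamma>^(1-\<alpha>),
  which tends to \<alpha> b at either end.\<close>

lemma trajectory_growth:
  fixes \<gamma> :: "real \<Rightarrow> complex"
  assumes lim: "((\<lambda>q. P q / q powr of_real (1 - \<alpha>)) \<longlongrightarrow> b) at_hp_infinity"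
    and \<gamma>: "\<And>t. \<gamma> t \<in> hp" "\<And>t. (\<gamma> has_vector_derivative P (\<gamma> t)) (at t)"
    and F: "filterlim \<gamma> at_infinity F" "F = at_top \<or> F = at_bot"
  shows "((\<lambda>t. \<gamma> t powr of_real \<alpha> / of_real t) \<longlongrightarrow> of_real \<alpha> * b) F"
proof -
  have nz: "\<gamma> t \<noteq> 0" "\<gamma> t \<notin> \<real>\<^sub>\<le>\<^sub>0" for t
    using \<gamma>(1)[of t] by (auto simp: complex_nonpos_Reals_iff)
  have "((\<lambda>t. \<gamma> t powr of_real \<alpha>) has_vector_derivative of_real \<alpha> * (P (\<gamma> t) / \<gamma> t powr of_real (1 - \<alpha>))) (at t)" for t
  proof -
    have "inverse (\<gamma> t powr of_real (1 - \<alpha>)) = \<gamma> t powr of_real (\<alpha> - 1)"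
      using powr_minus[of "\<gamma> t" "of_real (1 - \<alpha>)"] by simp
    then have "of_real \<alpha> * (P (\<gamma> t) / \<gamma> t powr of_real (1 - \<alpha>)) = P (\<gamma> t) * (of_real \<alpha> * \<gamma> t powr (of_real \<alpha> - 1))"
      by (simp add: divide_inverse mult_ac)
    then show ?thesis
      using field_vector_diff_chain_at[OF \<gamma>(2)[of t] has_field_derivative_powr[OF nz(2)[of t], of "of_real \<alpha>"]]
      by (simp add: o_def)
  qed
  moreover have "((\<lambda>t. of_real \<alpha> * (P (\<gamma> t) / \<gamma> t powr of_real (1 - \<alpha>))) \<longlongrightarrow> of_real \<alpha> * b) F"
    using \<gamma>(1) F(1)
    by (intro tendsto_intros filterlim_compose[OF lim] filterlim_at_hp_infinity[THEN iffD2]) auto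
  ultimately show ?thesis
    using F(2) by (auto intro!: linear_growth_at_top linear_growth_at_bot)
qed

text \<open>Taking \<open>sgn\<close> discards the modulus. Dividing by a negative t reverses the
  direction; the factor \<open>s t\<close> undoes this, so one lemma serves both ends, with s0 = 1
  or s0 = -1.\<close>

lemma cis_Arg_limit:
  assumes lim: "((\<lambda>t. \<gamma> t powr of_real \<alpha> / of_real t) \<longlongrightarrow> of_real \<alpha> * b) F"
    and "\<alpha> > 0" "b \<noteq> 0" and nz: "\<And>t. \<gamma> t \<noteq> 0"
    and s: "\<And>t. s t = sgn t" "eventually (\<lambda>t. t \<noteq> 0) F" "((\<lambda>t. s t) \<longlongrightarrow> s0) F"
  shows "((\<lambda>t. cis (\<alpha> * Arg (\<gamma> t))) \<longlongrightarrow> of_real s0 * sgn b) F"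
proof -
  have "((\<lambda>t. of_real (s t) * sgn (\<gamma> t powr of_real \<alpha> / of_real t)) \<longlongrightarrow> of_real s0 * sgn (of_real \<alpha> * b)) F"
    using assms by (intro tendsto_intros lim s(3)) auto
  moreover have "\<forall>\<^sub>F t in F. of_real (s t) * sgn (\<gamma> t powr of_real \<alpha> / of_real t) = cis (\<alpha> * Arg (\<gamma> t))"
    using s(2)
  proof eventually_elim
    case (elim t)
    have "sgn (\<gamma> t powr of_real \<alpha>) = cis (\<alpha> * Arg (\<gamma> t))"
      using nz[of t] by (simp add: powr_of_real_polar sgn_mult sgn_of_real sgn_cis)
    moreover have "sgn (\<gamma> t powr of_real \<alpha> / of_real t) = sgn (\<gamma> t powr of_real \<alpha>) * inverse (of_real (sgn t))"
      by (simp only: divide_inverse sgn_mult sgn_of_real sgn_inverse)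
    moreover have "complex_of_real (sgn t) \<noteq> 0"
      using elim by (simp add: sgn_if)
    ultimately show ?case by (simp add: s(1))
  qed
  ultimately have "((\<lambda>t. cis (\<alpha> * Arg (\<gamma> t))) \<longlongrightarrow> of_real s0 * sgn (of_real \<alpha> * b)) F"
    by (rule Lim_transform_eventually)
  then show ?thesis using \<open>\<alpha> > 0\<close> by (simp add: sgn_mult sgn_of_real)
qed

section \<open>Limit angles\<close>

text \<open>A limit of \<open>cis\<close> fixes an angle only modulo 2 pi. Since \<alpha> <= 2 is
  available first, \<alpha> |\<theta>| stays in {0..pi} and \<open>arccos\<close> recovers it. Its
  limit pi - |Arg b| is at most \<alpha> pi/2, while \<open>bound\<close> gives the reverse
  inequality once \<alpha> >= 1.\<close>

lemma backward_angle:
  fixes \<theta> :: "real \<Rightarrow> real"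
  assumes lim: "((\<lambda>t. cis (\<alpha> * \<theta> t)) \<longlongrightarrow> - sgn b) at_bot"
    and \<theta>: "\<And>t. \<bar>\<theta> t\<bar> < pi / 2" and "\<alpha> > 0" "b \<noteq> 0"
    and bound: "\<bar>Arg b\<bar> + \<bar>1 - \<alpha>\<bar> * (pi / 2) \<le> pi / 2"
  shows "1 \<le> \<alpha>" "\<alpha> \<le> 2" "\<bar>Arg b\<bar> = pi / 2 * (2 - \<alpha>)"
    and "((\<lambda>t. \<bar>\<theta> t\<bar>) \<longlongrightarrow> pi / 2) at_bot"
proof -
  have "\<bar>1 - \<alpha>\<bar> * (pi / 2) \<le> 1 * (pi / 2)" using bound by linarith
  then have "\<bar>1 - \<alpha>\<bar> \<le> 1" using pi_gt_zero by simp
  then show \<alpha>2: "\<alpha> \<le> 2" by simp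
  have range: "0 \<le> \<alpha> * \<bar>\<theta> t\<bar>" "\<alpha> * \<bar>\<theta> t\<bar> \<le> \<alpha> * (pi / 2)" for t
    using \<theta>[of t] \<open>\<alpha> > 0\<close> by (simp_all add: mult_left_mono less_imp_le)
  have "\<alpha> * (pi / 2) \<le> 2 * (pi / 2)"
    using \<alpha>2 by (intro mult_right_mono) auto
  have "((\<lambda>t. Re (cis (\<alpha> * \<theta> t))) \<longlongrightarrow> Re (- sgn b)) at_bot"
    by (rule tendsto_Re[OF lim])
  moreover have "Re (- sgn b) = - cos \<bar>Arg b\<bar>"
    using \<open>b \<noteq> 0\<close> by (simp flip: cis_Arg)
  moreover have "Re (cis (\<alpha> * \<theta> t)) = cos (\<alpha> * \<bar>\<theta> t\<bar>)" for t
    by (cases "\<theta> t \<ge> 0") auto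
  ultimately have "((\<lambda>t. cos (\<alpha> * \<bar>\<theta> t\<bar>)) \<longlongrightarrow> cos (pi - \<bar>Arg b\<bar>)) at_bot"
    by simp
  then have "((\<lambda>t. arccos (cos (\<alpha> * \<bar>\<theta> t\<bar>))) \<longlongrightarrow> arccos (cos (pi - \<bar>Arg b\<bar>))) at_bot"
    by (rule continuous_on_tendsto_compose[OF continuous_on_arccos']) auto
  moreover have "arccos (cos (\<alpha> * \<bar>\<theta> t\<bar>)) = \<alpha> * \<bar>\<theta> t\<bar>" for t
    using range[of t] \<open>\<alpha> * (pi / 2) \<le> 2 * (pi / 2)\<close> by (intro arccos_cos) linarith+
  moreover have "arccos (cos (pi - \<bar>Arg b\<bar>)) = pi - \<bar>Arg b\<bar>"
    using Arg_bounded[of b] by (intro arccos_cos) auto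
  ultimately have lim': "((\<lambda>t. \<alpha> * \<bar>\<theta> t\<bar>) \<longlongrightarrow> pi - \<bar>Arg b\<bar>) at_bot"
    by simp
  have le: "pi - \<bar>Arg b\<bar> \<le> \<alpha> * (pi / 2)"
    by (rule tendsto_upperbound[OF lim']) (use range in auto)
  show \<alpha>1: "1 \<le> \<alpha>"
  proof (rule ccontr)
    \<comment> \<open>For \<alpha> < 1 the bound reads |Arg b| <= \<alpha> pi/2; together with
      \<open>le\<close> this gives pi <= \<alpha> pi.\<close>
    assume "\<not> 1 \<le> \<alpha>"
    then have "\<bar>1 - \<alpha>\<bar> * (pi / 2) = pi / 2 - \<alpha> * (pi / 2)" by (simp add: left_diff_distrib)
    then have "\<bar>Arg b\<bar> \<le> \<alpha> * (pi / 2)" using bound by linarith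
    then have "pi \<le> \<alpha> * (pi / 2) + \<alpha> * (pi / 2)" using le by linarith
    then show False using \<open>\<not> 1 \<le> \<alpha>\<close> pi_gt_zero by simp
  qed
  show eq: "\<bar>Arg b\<bar> = pi / 2 * (2 - \<alpha>)"
  proof -
    define m where "m = \<alpha> * (pi / 2)"
    have "\<bar>1 - \<alpha>\<bar> * (pi / 2) = m - pi / 2" using \<alpha>1 by (simp add: m_def left_diff_distrib)
    then have "\<bar>Arg b\<bar> + (m - pi / 2) \<le> pi / 2" using bound by metis
    moreover have "pi - \<bar>Arg b\<bar> \<le> m" using le by (simp add: m_def)
    moreover have "pi / 2 * (2 - \<alpha>) = pi - m" by (simp add: m_def right_diff_distrib)
    ultimately show ?thesis by linarith
  qed
  have "((\<lambda>t. inverse \<alpha> * (\<alpha> * \<bar>\<theta> t\<bar>)) \<longlongrightarrow> inverse \<alpha> * (pi - \<bar>Arg b\<bar>)) at_bot"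
    by (intro tendsto_intros lim')
  moreover have "inverse \<alpha> * (pi - \<bar>Arg b\<bar>) = pi / 2"
    unfolding eq using \<open>\<alpha> > 0\<close> by (simp add: field_simps)
  moreover have "inverse \<alpha> * (\<alpha> * \<bar>\<theta> t\<bar>) = \<bar>\<theta> t\<bar>" for t
    using \<open>\<alpha> > 0\<close> by (simp flip: mult.assoc)
  ultimately show "((\<lambda>t. \<bar>\<theta> t\<bar>) \<longlongrightarrow> pi / 2) at_bot"
    by (simp only:)
qed

text \<open>Near -infinity \<theta> has no zeros, hence a constant sign by the intermediate value
  theorem. The minus sign makes \<sigma> the sign of the argument of 1 / \<gamma>, which is 1 -
  u.\<close>

lemma tendsto_signed:
  fixes \<theta> :: "real \<Rightarrow> real"
  assumes cont: "continuous_on UNIV \<theta>" and lim: "((\<lambda>t. \<bar>\<theta> t\<bar>) \<longlongrightarrow> L) at_bot" and "L > 0"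
  obtains \<sigma> :: real where "\<bar>\<sigma>\<bar> = 1" "(\<theta> \<longlongrightarrow> - \<sigma> * L) at_bot"
proof -
  from order_tendstoD(1)[OF lim \<open>L > 0\<close>] obtain T where T: "\<And>t. t \<le> T \<Longrightarrow> \<theta> t \<noteq> 0"
    unfolding eventually_at_bot_linorder by force
  define s where "s = sgn (\<theta> T)"
  have s: "\<bar>s\<bar> = 1" using T[of T] by (simp add: s_def abs_sgn_eq)
  have "\<theta> t = s * \<bar>\<theta> t\<bar>" if "t \<le> T" for t
  proof (rule ccontr)
    assume "\<theta> t \<noteq> s * \<bar>\<theta> t\<bar>"
    then have opp: "\<theta> t > 0 \<and> \<theta> T < 0 \<or> \<theta> t < 0 \<and> \<theta> T > 0"
      using T[of t] T[of T] that by (auto simp: s_def sgn_if split: if_splits)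
    have cont': "continuous_on {t..T} \<theta>" using cont by (rule continuous_on_subset) simp
    have "\<exists>x\<ge>t. x \<le> T \<and> \<theta> x = 0"
      using opp IVT'[of \<theta> t 0 T, OF _ _ that cont'] IVT2'[of \<theta> T 0 t, OF _ _ that cont'] by force
    then show False using T by blast
  qed
  then have "\<forall>\<^sub>F t in at_bot. s * \<bar>\<theta> t\<bar> = \<theta> t"
    unfolding eventually_at_bot_linorder by (intro exI[of _ T]) auto
  with tendsto_mult_left[OF lim, of s] have "(\<theta> \<longlongrightarrow> s * L) at_bot"
    by (rule Lim_transform_eventually)
  then show thesis using that[of "-s"] s by simp
qed

text \<open>Uniqueness of limits, with the minus sign absorbed as cis (\<sigma> pi) = -1. This
  refines the value of |Arg b| by its sign.\<close>

lemma sgn_leading_coeff: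
  fixes \<theta> :: "real \<Rightarrow> real"
  assumes lim: "((\<lambda>t. cis (\<alpha> * \<theta> t)) \<longlongrightarrow> - sgn b) at_bot"
    and \<theta>: "(\<theta> \<longlongrightarrow> - \<sigma> * (pi / 2)) at_bot" and \<sigma>: "\<bar>\<sigma>\<bar> = 1"
  shows "sgn b = cis (\<sigma> * (pi / 2 * (2 - \<alpha>)))"
proof -
  have "((\<lambda>t. cis (\<alpha> * \<theta> t)) \<longlongrightarrow> cis (\<alpha> * (- \<sigma> * (pi / 2)))) at_bot"
    by (intro tendsto_intros \<theta>)
  then have "- sgn b = cis (\<alpha> * (- \<sigma> * (pi / 2)))"
    using lim tendsto_unique trivial_limit_at_bot_linorder by blast
  then have "sgn b = cis (\<sigma> * pi) * cis (\<alpha> * (- \<sigma> * (pi / 2)))"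
  proof -
    have "cis (\<sigma> * pi) = - 1" using \<sigma> by (auto simp: abs_if complex_eq_iff split: if_splits)
    then show ?thesis unfolding \<open>- sgn b = _\<close>[symmetric] by simp
  qed
  also have "\<dots> = cis (\<sigma> * (pi / 2 * (2 - \<alpha>)))"
    unfolding cis_mult by (rule arg_cong[of _ _ cis]) (simp add: algebra_simps)
  finally show ?thesis .
qed

text \<open>Here |\<alpha> \<theta>| < pi, so \<open>Arg\<close> inverts \<open>cis\<close>, and
  \<open>Arg\<close> is continuous at sgn b because b is nonzero with Re b >= 0.\<close>

lemma forward_angle:
  fixes \<theta> :: "real \<Rightarrow> real"
  assumes lim: "((\<lambda>t. cis (\<alpha> * \<theta> t)) \<longlongrightarrow> sgn b) at_top"
    and \<theta>: "\<And>t. \<bar>\<theta> t\<bar> < pi / 2" and "0 < \<alpha>" "\<alpha> \<le> 2" "b \<noteq> 0" "\<bar>Arg b\<bar> \<le> pi / 2"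
  shows "(\<theta> \<longlongrightarrow> Arg b / \<alpha>) at_top"
proof -
  have "Re b \<ge> 0" using Arg_Re_nonneg[of b] assms by simp
  then have "sgn b \<notin> \<real>\<^sub>\<le>\<^sub>0"
    using \<open>b \<noteq> 0\<close> by (auto simp: complex_nonpos_Reals_iff complex_eq_iff sgn_eq divide_le_0_iff)
  then have "((\<lambda>t. Arg (cis (\<alpha> * \<theta> t))) \<longlongrightarrow> Arg (sgn b)) at_top"
    by (intro tendsto_Arg lim)
  moreover have "Arg (cis (\<alpha> * \<theta> t)) = \<alpha> * \<theta> t" for t
  proof -
    have "\<bar>\<alpha> * \<theta> t\<bar> < 2 * (pi / 2)"
      unfolding abs_mult using \<theta>[of t] assms pi_gt_zero
      by (intro mult_le_less_imp_less) auto
    then show ?thesis by (intro Arg_cis) auto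
  qed
  moreover have "Arg (sgn b) = Arg b"
    using \<open>b \<noteq> 0\<close> by (simp add: sgn_eq Arg_divide_of_real)
  ultimately have "((\<lambda>t. \<alpha> * \<theta> t / \<alpha>) \<longlongrightarrow> Arg b / \<alpha>) at_top"
    using \<open>0 < \<alpha>\<close> by (intro tendsto_intros) auto
  then show ?thesis using \<open>0 < \<alpha>\<close> by simp
qed

text \<open>With q = 1 / (1 - z), the quotient (1 - |z|) / |1 - z| is at most (1 - |z|^2) |q| = (2
  Re q - 1) / |q|, hence at most 2 cos (Arg q).\<close>

lemma tangential_of_angle:
  fixes \<gamma> :: "real \<Rightarrow> complex"
  assumes \<gamma>: "\<And>t. \<gamma> t \<in> hp" and lim: "((\<lambda>t. \<bar>Arg (\<gamma> t)\<bar>) \<longlongrightarrow> pi / 2) at_bot"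
  shows "((\<lambda>t. (1 - norm (1 - 1 / \<gamma> t)) / norm (1 - (1 - 1 / \<gamma> t))) \<longlongrightarrow> 0) at_bot"
proof (rule tendsto_sandwich[OF _ _ tendsto_const])
  have "((\<lambda>t. 2 * cos \<bar>Arg (\<gamma> t)\<bar>) \<longlongrightarrow> 2 * cos (pi / 2)) at_bot"
    by (intro tendsto_mult tendsto_const tendsto_cos[OF lim])
  then show "((\<lambda>t. 2 * cos \<bar>Arg (\<gamma> t)\<bar>) \<longlongrightarrow> 0) at_bot" by simp
  have *: "0 \<le> (1 - cmod (1 - 1/q)) / cmod (1 - (1 - 1/q))"
    "(1 - cmod (1 - 1/q)) / cmod (1 - (1 - 1/q)) \<le> 2 * cos \<bar>Arg q\<bar>" if "q \<in> hp" for q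
  proof -
    let ?z = "1 - 1/q"
    have z: "cmod ?z < 1" using hp_to_disc[OF that] by simp
    have q: "cmod q > 0" "q \<noteq> 0" using hp_nonzero[OF that] by auto
    show "0 \<le> (1 - cmod ?z) / cmod (1 - ?z)" using z by simp
    have "1 - cmod ?z \<le> 1 - (cmod ?z)\<^sup>2"
      using z by (simp add: power_le_one_iff power2_eq_square mult_left_le)
    also have "\<dots> = (2 * Re q - 1) / (cmod q)\<^sup>2"
    proof -
      have "2 * Re q - 1 = (1 - (cmod ?z)\<^sup>2) * (cmod q)\<^sup>2"
        using Re_inverse_one_minus[of ?z] q(2) by (simp add: norm_divide power_divide)
      then show ?thesis using q by simp
    qed
    also have "\<dots> \<le> (2 * Re q) / (cmod q)\<^sup>2"
      by (simp add: divide_right_mono)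
    also have "Re q = cmod q * cos \<bar>Arg q\<bar>"
    proof -
      have "Re q = Re (rcis (cmod q) (Arg q))" by (simp only: rcis_cmod_Arg)
      then show ?thesis by simp
    qed
    finally have "1 - cmod ?z \<le> 2 * cos \<bar>Arg q\<bar> / cmod q"
      using q by (simp add: power2_eq_square)
    then show "(1 - cmod ?z) / cmod (1 - ?z) \<le> 2 * cos \<bar>Arg q\<bar>"
      using q by (simp add: norm_divide field_simps)
  qed
  show "\<forall>\<^sub>F t in at_bot. 0 \<le> (1 - cmod (1 - 1 / \<gamma> t)) / cmod (1 - (1 - 1 / \<gamma> t))"
    by (intro always_eventually allI *(1) \<gamma>)
  show "\<forall>\<^sub>F t in at_bot. (1 - cmod (1 - 1 / \<gamma> t)) / cmod (1 - (1 - 1 / \<gamma> t)) \<le> 2 * cos \<bar>Arg (\<gamma> t)\<bar>"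
    by (intro always_eventually allI *(2) \<gamma>)
qed

section \<open>The region beyond a rising curve\<close>

lemma strict_mono_IVT:
  fixes x :: "real \<Rightarrow> real"
  assumes "continuous_on UNIV x" "strict_mono x" "x t1 < r" "r < x t2"
  obtains t where "x t = r" "t1 < t" "t < t2"
proof -
  have "t1 < t2" using assms strict_mono_less[of x t1 t2] by linarith
  then obtain t where t: "t1 \<le> t" "t \<le> t2" "x t = r"
    using IVT'[of x t1 r t2] assms continuous_on_subset[OF assms(1), of "{t1..t2}"] by auto
  moreover have "t \<noteq> t1" "t \<noteq> t2" using t(3) assms by auto
  ultimately show thesis using that by force
qed

lemma open_Re_Im_box:
  "open {w. a < Re w \<and> Re w < b \<and> \<sigma> * Im w < c}" "open {w. a < Re w \<and> Re w < b \<and> c < \<sigma> * Im w}"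
  "open {w. a < Re w \<and> \<sigma> * Im w < c}" "open {w. Re w < b \<and> c < \<sigma> * Im w}"
  by (intro open_Collect_conj open_Collect_less continuous_intros)+

text \<open>For \<open>\<sigma> = 1\<close> this is the part of the plane to the right of and below the graph-like curve
  \<open>\<gamma>\<close>; for \<open>\<sigma> = -1\<close> it is the part above it.\<close>

definition beyond :: "real \<Rightarrow> (real \<Rightarrow> complex) \<Rightarrow> complex set" where
  "beyond \<sigma> \<gamma> = {w. (\<exists>t. Re (\<gamma> t) < Re w) \<and> (\<forall>t. Re (\<gamma> t) = Re w \<longrightarrow> \<sigma> * Im w < \<sigma> * Im (\<gamma> t))}"

text \<open>The conditions at the two ends concern vertical lines that miss the curve because
  \<open>Re (\<gamma> t)\<close> has a finite infimum or supremum. \<open>bot\<close> handles lines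
  on the left; \<open>top_infinity\<close> and \<open>top_side\<close> handle those on the right,
  and \<open>top_side\<close> also keeps the curve on one side of a diagonal.\<close>

locale rising_curve =
  fixes \<sigma> :: real and \<gamma> :: "real \<Rightarrow> complex"
  assumes \<sigma>: "\<bar>\<sigma>\<bar> = 1"
    and cont: "continuous_on UNIV \<gamma>"
    and mono: "strict_mono (\<lambda>t. Re (\<gamma> t))"
    and bot: "filterlim (\<lambda>t. \<sigma> * Im (\<gamma> t)) at_bot at_bot"
    and top_infinity: "filterlim \<gamma> at_infinity at_top"
    and top_side: "\<forall>\<^sub>F t in at_top. - Re (\<gamma> t) < \<sigma> * Im (\<gamma> t)"
begin

lemma sigma_sq: "\<sigma> * (\<sigma> * r) = r"
  using \<sigma> by (auto simp: abs_if split: if_splits)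

lemma abs_sigma_Im: "\<bar>\<sigma> * r\<bar> = \<bar>r\<bar>"
  using \<sigma> by (simp add: abs_mult)

lemma Re_less: "Re (\<gamma> s) < Re (\<gamma> t) \<longleftrightarrow> s < t"
  using strict_mono_less[OF mono] by simp

lemma Re_eq: "Re (\<gamma> s) = Re (\<gamma> t) \<longleftrightarrow> s = t"
  using strict_mono_eq[OF mono] by simp

lemma cont_Re: "continuous_on UNIV (\<lambda>t. Re (\<gamma> t))"
  by (intro continuous_intros cont)

lemmas IVT_Re = strict_mono_IVT[OF cont_Re mono]

lemma Im_near:
  assumes "open V" "\<sigma> * Im (\<gamma> t) \<in> V"
  obtains \<eta> where "\<eta> > 0" "\<And>s. t - \<eta> < s \<Longrightarrow> s < t + \<eta> \<Longrightarrow> \<sigma> * Im (\<gamma> s) \<in> V"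
proof -
  have "continuous_on UNIV (\<lambda>t. \<sigma> * Im (\<gamma> t))" by (intro continuous_intros cont)
  then have "open ((\<lambda>t. \<sigma> * Im (\<gamma> t)) -` V)" using \<open>open V\<close> by (simp add: continuous_on_open_vimage)
  then obtain \<eta> where "\<eta> > 0" "\<And>s. \<bar>s - t\<bar> < \<eta> \<Longrightarrow> \<sigma> * Im (\<gamma> s) \<in> V"
    unfolding open_dist using assms(2) by (auto simp: dist_real_def)
  then show thesis using that[of \<eta>] by auto
qed

text \<open>If the real part stays bounded, |\<gamma>| can tend to infinity only through the
  imaginary part, and \<open>top_side\<close> excludes the wrong sign.\<close>

lemma eventually_high:
  assumes "\<And>t. Re (\<gamma> t) < r"
  shows "\<exists>T. \<forall>t\<ge>T. c < \<sigma> * Im (\<gamma> t)"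
proof -
  \<comment> \<open>|Re (\<gamma> 0)| and one |r| pay for the real part, so the imaginary part
    exceeds |r| + |c| in modulus; the second |r| contradicts a negative sign, since -Re (\<gamma> t)
    > -r.\<close>
  have "\<forall>\<^sub>F t in at_top. \<bar>Re (\<gamma> 0)\<bar> + \<bar>r\<bar> + \<bar>r\<bar> + \<bar>c\<bar> < cmod (\<gamma> t)"
    using filterlim_at_infinity_imp_norm_at_top[OF top_infinity]
    by (simp add: filterlim_at_top_dense)
  with top_side eventually_ge_at_top[of 0]
  have "\<forall>\<^sub>F t in at_top. c < \<sigma> * Im (\<gamma> t)"
  proof eventually_elim
    case (elim t)
    have "Re (\<gamma> 0) \<le> Re (\<gamma> t)" using elim(2) Re_less[of t 0] by force
    then show ?case
      using elim assms[of t] cmod_le[of "\<gamma> t"] abs_sigma_Im[of "Im (\<gamma> t)"] by linarith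
  qed
  then show ?thesis by (simp add: eventually_at_top_linorder)
qed

text \<open>If the vertical line through l meets the curve, a level c between l and the curve bounds
  a box. Otherwise the whole curve lies to the left, and \<open>eventually_high\<close> keeps its
  end away from l.\<close>

lemma open_beyond: "open (beyond \<sigma> \<gamma>)"
proof (subst open_subopen, intro ballI)
  fix l assume l: "l \<in> beyond \<sigma> \<gamma>"
  show "\<exists>S. open S \<and> l \<in> S \<and> S \<subseteq> beyond \<sigma> \<gamma>"
  proof (cases "\<exists>t. Re (\<gamma> t) = Re l")
    case True
    then obtain t where t: "Re (\<gamma> t) = Re l" "\<sigma> * Im l < \<sigma> * Im (\<gamma> t)"
      using l by (auto simp: beyond_def)
    then obtain c where c: "\<sigma> * Im l < c" "c < \<sigma> * Im (\<gamma> t)" using dense by blast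
    obtain \<eta> where \<eta>: "\<eta> > 0" "\<And>s. t - \<eta> < s \<Longrightarrow> s < t + \<eta> \<Longrightarrow> \<sigma> * Im (\<gamma> s) \<in> {c<..}"
      using Im_near[of "{c<..}" t] c(2) by auto
    let ?S = "{w. Re (\<gamma> (t - \<eta>)) < Re w \<and> Re w < Re (\<gamma> (t + \<eta>)) \<and> \<sigma> * Im w < c}"
    have l_S: "l \<in> ?S" using c \<eta>(1) by (simp add: t(1)[symmetric] Re_less)
    have sub: "?S \<subseteq> beyond \<sigma> \<gamma>"
    proof
      fix w assume w: "w \<in> ?S"
      have "\<sigma> * Im w < \<sigma> * Im (\<gamma> s)" if "Re (\<gamma> s) = Re w" for s
        using \<eta>(2)[of s] w Re_less[of "t - \<eta>" s] Re_less[of s "t + \<eta>"] that by auto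
      with w show "w \<in> beyond \<sigma> \<gamma>" by (auto simp: beyond_def)
    qed
    show ?thesis by (intro exI[of _ ?S] conjI open_Re_Im_box l_S sub)
  next
    case False
    have "Re (\<gamma> t) < Re l" for t
    proof (rule ccontr)
      assume "\<not> ?thesis"
      then have "Re l < Re (\<gamma> t)" using False by (metis not_less_iff_gr_or_eq)
      moreover obtain s where "Re (\<gamma> s) < Re l" using l unfolding beyond_def by blast
      ultimately show False using IVT_Re[of s "Re l" t] False by blast
    qed
    from eventually_high[OF this] obtain T where T: "\<And>t. t \<ge> T \<Longrightarrow> \<sigma> * Im l + 1 < \<sigma> * Im (\<gamma> t)"
      by blast
    let ?S = "{w. Re (\<gamma> T) < Re w \<and> \<sigma> * Im w < \<sigma> * Im l + 1}"
    have l_S: "l \<in> ?S" using \<open>\<And>t. Re (\<gamma> t) < Re l\<close> by simp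
    have sub: "?S \<subseteq> beyond \<sigma> \<gamma>"
    proof
      fix w assume w: "w \<in> ?S"
      have "\<sigma> * Im w < \<sigma> * Im (\<gamma> s)" if "Re (\<gamma> s) = Re w" for s
        using T[of s] w Re_less[of T s] that by auto
      with w show "w \<in> beyond \<sigma> \<gamma>" by (auto simp: beyond_def)
    qed
    show ?thesis by (intro exI[of _ ?S] conjI open_Re_Im_box l_S sub)
  qed
qed

text \<open>The complement is open: boxes on the other side of the curve work as before, and for l
  to the left of the whole curve \<open>bot\<close> sends the beginning of the curve past l.\<close>

lemma closed_beyond: "closed (beyond \<sigma> \<gamma> \<union> range \<gamma>)"
  unfolding closed_def
proof (subst open_subopen, intro ballI)
  fix l assume l: "l \<in> - (beyond \<sigma> \<gamma> \<union> range \<gamma>)"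
  show "\<exists>S. open S \<and> l \<in> S \<and> S \<subseteq> - (beyond \<sigma> \<gamma> \<union> range \<gamma>)"
  proof (cases "\<exists>t. Re (\<gamma> t) = Re l")
    case True
    then obtain t where t: "Re (\<gamma> t) = Re l" by blast
    have "\<sigma> * Im (\<gamma> t) \<le> \<sigma> * Im l"
    proof (rule ccontr)
      assume "\<not> ?thesis"
      then have "\<forall>s. Re (\<gamma> s) = Re l \<longrightarrow> \<sigma> * Im l < \<sigma> * Im (\<gamma> s)"
        unfolding t[symmetric] Re_eq by simp
      moreover have "Re (\<gamma> (t - 1)) < Re l" unfolding t[symmetric] Re_less by simp
      ultimately show False using l by (auto simp: beyond_def)
    qed
    moreover have "\<sigma> * Im (\<gamma> t) \<noteq> \<sigma> * Im l"
    proof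
      assume "\<sigma> * Im (\<gamma> t) = \<sigma> * Im l"
      then have "\<gamma> t = l" using \<sigma> t by (auto intro: complex_eqI)
      with l show False by blast
    qed
    ultimately have "\<sigma> * Im (\<gamma> t) < \<sigma> * Im l" by linarith
    then obtain c where c: "\<sigma> * Im (\<gamma> t) < c" "c < \<sigma> * Im l" using dense by blast
    obtain \<eta> where \<eta>: "\<eta> > 0" "\<And>s. t - \<eta> < s \<Longrightarrow> s < t + \<eta> \<Longrightarrow> \<sigma> * Im (\<gamma> s) \<in> {..<c}"
      using Im_near[of "{..<c}" t] c(1) by auto
    let ?S = "{w. Re (\<gamma> (t - \<eta>)) < Re w \<and> Re w < Re (\<gamma> (t + \<eta>)) \<and> c < \<sigma> * Im w}"
    have l_S: "l \<in> ?S" using c \<eta>(1) by (simp add: t[symmetric] Re_less)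
    have sub: "?S \<subseteq> - (beyond \<sigma> \<gamma> \<union> range \<gamma>)"
    proof
      fix w assume w: "w \<in> ?S"
      then obtain s where s: "Re (\<gamma> s) = Re w" "t - \<eta> < s" "s < t + \<eta>"
        using IVT_Re[of "t - \<eta>" "Re w" "t + \<eta>"] by auto
      then have "\<sigma> * Im (\<gamma> s) < \<sigma> * Im w" using \<eta>(2)[of s] w by auto
      moreover have "w \<notin> range \<gamma>"
      proof
        assume "w \<in> range \<gamma>"
        then obtain s' where "w = \<gamma> s'" by blast
        then show False using s(1) Re_eq[of s s'] \<open>\<sigma> * Im (\<gamma> s) < \<sigma> * Im w\<close> by simp
      qed
      moreover have "w \<notin> beyond \<sigma> \<gamma>"
        unfolding beyond_def using s(1) \<open>\<sigma> * Im (\<gamma> s) < \<sigma> * Im w\<close> by (blast dest: less_asym)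
      ultimately show "w \<in> - (beyond \<sigma> \<gamma> \<union> range \<gamma>)" by blast
    qed
    show ?thesis by (intro exI[of _ ?S] conjI open_Re_Im_box l_S sub)
  next
    case False
    have lt: "Re l < Re (\<gamma> t)" for t
    proof (rule ccontr)
      assume "\<not> ?thesis"
      then have "Re (\<gamma> t) < Re l" using False by (metis not_less_iff_gr_or_eq)
      then have "l \<in> beyond \<sigma> \<gamma>" using False unfolding beyond_def by blast
      with l show False by blast
    qed
    obtain T where T: "\<And>t. t \<le> T \<Longrightarrow> \<sigma> * Im (\<gamma> t) < \<sigma> * Im l - 1"
      using bot unfolding filterlim_at_bot_dense eventually_at_bot_linorder by meson
    let ?S = "{w. Re w < Re (\<gamma> T) \<and> \<sigma> * Im l - 1 < \<sigma> * Im w}"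
    have l_S: "l \<in> ?S" using lt by simp
    have sub: "?S \<subseteq> - (beyond \<sigma> \<gamma> \<union> range \<gamma>)"
    proof
      fix w assume w: "w \<in> ?S"
      have low: "\<sigma> * Im (\<gamma> s) < \<sigma> * Im w" if "Re (\<gamma> s) = Re w" for s
        using T[of s] w Re_less[of s T] that by auto
      have "\<exists>s. Re (\<gamma> s) = Re w" if "Re (\<gamma> s) < Re w" for s
        using IVT_Re[of s "Re w" T] that w by blast
      then have "w \<notin> beyond \<sigma> \<gamma>" unfolding beyond_def using low by (blast dest: less_asym)
      moreover have "w \<notin> range \<gamma>" using low by blast
      ultimately show "w \<in> - (beyond \<sigma> \<gamma> \<union> range \<gamma>)" by blast
    qed
    show ?thesis by (intro exI[of _ ?S] conjI open_Re_Im_box l_S sub)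
  qed
qed

text \<open>In the connected set \<open>hp\<close>, the open sets \<open>E\<close>
  ?U\<open>and\<close>- E \<open>?C\<close> are disjoint and exhaustive, since \<open>E\<close>
  sends the curve to the line Re = 1/2. The first one meets \<open>hp\<close>, so the second does
  not.\<close>

lemma half_plane_subset_image:
  assumes \<gamma>: "\<And>t. \<gamma> t \<in> hp"
    and holE: "E holomorphic_on hp" and injE: "inj_on E hp"
    and E\<gamma>: "\<And>t. E (\<gamma> t) = Complex (1/2) (\<sigma> * t)"
    and Einf: "\<And>B. \<exists>R. \<forall>q\<in>hp. R < cmod q \<longrightarrow> B < cmod (E q)"
    and pt: "\<forall>\<^sub>F r in at_top. E (Complex r (- \<sigma> * r)) \<in> hp"
  shows "beyond \<sigma> \<gamma> \<union> range \<gamma> \<subseteq> hp" "{X. 1/2 \<le> Re X} \<subseteq> E ` (beyond \<sigma> \<gamma> \<union> range \<gamma>)"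
proof -
  let ?U = "beyond \<sigma> \<gamma>" and ?C = "beyond \<sigma> \<gamma> \<union> range \<gamma>"
  have U: "?U \<subseteq> hp"
  proof
    fix w assume "w \<in> ?U"
    then obtain t where "Re (\<gamma> t) < Re w" by (auto simp: beyond_def)
    with \<gamma>[of t] show "w \<in> hp" by auto
  qed
  then show C: "?C \<subseteq> hp" using \<gamma> by blast
  have contE: "continuous_on hp E" using holE by (rule holomorphic_on_imp_continuous_on)
  \<comment> \<open>\<open>E\<close> is large far out, so preimages of a convergent sequence stay in
    a ball, and the bounded parts of \<open>?C\<close> are compact inside \<open>hp\<close>.\<close>
  have "closed (E ` ?C)"
  proof (subst closed_sequential_limits, intro allI impI, elim conjE)
    fix X l assume X: "\<forall>n. X n \<in> E ` ?C" and "X \<longlonglongrightarrow> l"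
    obtain R where R: "\<And>q. q \<in> hp \<Longrightarrow> R < cmod q \<Longrightarrow> cmod l + 1 < cmod (E q)"
      using Einf by blast
    have "compact (E ` (?C \<inter> cball 0 R))"
      by (intro compact_continuous_image continuous_on_subset[OF contE] closed_Int_compact closed_beyond)
        (use C in auto)
    then have "closed (E ` (?C \<inter> cball 0 R))" by (rule compact_imp_closed)
    moreover have "\<forall>\<^sub>F n in sequentially. X n \<in> E ` (?C \<inter> cball 0 R)"
      using tendstoD[OF tendsto_norm[OF \<open>X \<longlonglongrightarrow> l\<close>] zero_less_one]
    proof eventually_elim
      case (elim n)
      obtain q where q: "q \<in> ?C" "X n = E q" using X by blast
      have "\<not> R < cmod q" using R[of q] q C elim by (auto simp: dist_real_def)
      with q show ?case by force
    qed
    ultimately have "l \<in> E ` (?C \<inter> cball 0 R)"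
      using \<open>X \<longlonglongrightarrow> l\<close> by (intro Lim_in_closed_set[of _ X sequentially]) auto
    then show "l \<in> E ` ?C" by blast
  qed
  then have "open (- E ` ?C)" by (simp add: open_Compl)
  moreover have "open (E ` ?U)"
    using open_mapping_thm3[of E ?U] holomorphic_on_subset[OF holE U] inj_on_subset[OF injE U] open_beyond
    by blast
  moreover have "hp \<inter> E ` range \<gamma> = {}" using E\<gamma> by auto
  moreover have "connected hp" using convex_hp by (rule convex_connected)
  \<comment> \<open>A far point of the diagonal of slope -\<sigma> lies beyond the curve by
    \<open>top_side\<close>, and its image lies in \<open>hp\<close> by \<open>pt\<close>.\<close>
  moreover have "E ` ?U \<inter> hp \<noteq> {}"
  proof -
    obtain T where T: "\<And>t. t \<ge> T \<Longrightarrow> - Re (\<gamma> t) < \<sigma> * Im (\<gamma> t)"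
      using top_side by (auto simp: eventually_at_top_linorder)
    obtain r where r: "r > Re (\<gamma> T)" "E (Complex r (- \<sigma> * r)) \<in> hp"
      using eventually_happens[OF eventually_conj[OF eventually_gt_at_top[of "Re (\<gamma> T)"] pt]] by auto
    have "Complex r (- \<sigma> * r) \<in> ?U"
      unfolding beyond_def
    proof (intro CollectI conjI exI[of _ T] allI impI)
      fix t assume t: "Re (\<gamma> t) = Re (Complex r (- \<sigma> * r))"
      then have "T < t" using r(1) Re_less[of T t] by simp
      then have "- r < \<sigma> * Im (\<gamma> t)" using T[of t] t by simp
      then show "\<sigma> * Im (Complex r (- \<sigma> * r)) < \<sigma> * Im (\<gamma> t)" by (simp add: sigma_sq)
    qed (use r(1) in simp)
    with r(2) show ?thesis by blast
  qed
  ultimately have "- E ` ?C \<inter> hp = {}"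
    using connectedD[of hp "E ` ?U" "- E ` ?C"] by blast
  moreover have "X \<in> E ` ?C" if "Re X = 1/2" for X
  proof -
    have "X = E (\<gamma> (\<sigma> * Im X))" using that by (simp add: E\<gamma> sigma_sq complex_eq_iff)
    then show ?thesis by blast
  qed
  ultimately show "{X. 1/2 \<le> Re X} \<subseteq> E ` ?C"
    by (force simp: le_less)
qed

end

section \<open>Univalence and asymptotics of the linearizing map\<close>

text \<open>A nonconstant P has open image, which cannot touch the boundary of the
  half-plane.\<close>

lemma Re_nonneg_holomorphic_cases:
  assumes holP: "P holomorphic_on S" and S: "open S" "connected S"
    and Re: "\<And>q. q \<in> S \<Longrightarrow> Re (P q) \<ge> 0"
  obtains "\<And>q. q \<in> S \<Longrightarrow> Re (P q) > 0" | c where "Re c = 0" "\<And>q. q \<in> S \<Longrightarrow> P q = c"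
proof (cases "P constant_on S")
  case True
  then obtain c where c: "\<And>q. q \<in> S \<Longrightarrow> P q = c" by (auto simp: constant_on_def)
  show thesis
  proof (cases "Re c = 0")
    case True then show thesis using that(2) c by blast
  next
    case False
    have "Re (P q) > 0" if "q \<in> S" for q using Re[OF that] False c[OF that] by simp
    then show thesis by (rule that(1))
  qed
next
  case False
  have "open (P ` S)" by (rule open_mapping_thm[OF holP S S(1) subset_refl False])
  moreover have "P ` S \<subseteq> {w. 1 \<bullet> w \<ge> 0}" using Re by (auto simp: inner_complex_def)
  ultimately have "P ` S \<subseteq> {w. 1 \<bullet> w > 0}"
    using interior_maximal interior_halfspace_ge[of "1::complex" 0] by (metis zero_neq_one)
  then have "Re (P q) > 0" if "q \<in> S" for q using that by (auto simp: inner_complex_def)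
  then show thesis by (rule that(1))
qed

text \<open>On the segment from z to w the real part of c f / (w - z) is strictly increasing. The
  multiplier c allows f' to lie in a rotated half-plane.\<close>

lemma Noshiro_Warschawski:
  assumes S: "convex S"
    and f: "\<And>z. z \<in> S \<Longrightarrow> (f has_field_derivative f' z) (at z)"
    and Re: "\<And>z. z \<in> S \<Longrightarrow> Re (c * f' z) > 0"
  shows "inj_on f S"
proof (rule inj_onI, rule ccontr)
  fix z w assume zw: "z \<in> S" "w \<in> S" "f z = f w" "z \<noteq> w"
  define p where "p = (\<lambda>t::real. z + of_real t * (w - z))"
  have "Re (c * f (p 0) / (w - z)) < Re (c * f (p 1) / (w - z))"
  proof (rule DERIV_pos_imp_increasing[of 0 1 "\<lambda>t. Re (c * f (p t) / (w - z))"])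
    fix t :: real assume t: "0 \<le> t" "t \<le> 1"
    have "p t = (1 - t) *\<^sub>R z + t *\<^sub>R w" by (simp add: p_def scaleR_conv_of_real algebra_simps)
    then have pS: "p t \<in> S" using convexD[OF S zw(1,2), of "1 - t" t] t by simp
    have "(p has_vector_derivative (w - z)) (at t)"
      unfolding p_def by (auto intro!: derivative_eq_intros)
    from field_vector_diff_chain_at[OF this f[OF pS]]
    have "((\<lambda>t. f (p t)) has_vector_derivative (w - z) * f' (p t)) (at t)" by (simp add: o_def)
    then have "((\<lambda>t. (c / (w - z)) * f (p t)) has_vector_derivative (c / (w - z)) * ((w - z) * f' (p t))) (at t)"
      by (rule has_vector_derivative_mult_right)
    then have "((\<lambda>t. c * f (p t) / (w - z)) has_vector_derivative c * f' (p t)) (at t)"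
      using zw(4) by simp
    then have "((\<lambda>t. Re (c * f (p t) / (w - z))) has_real_derivative Re (c * f' (p t))) (at t)"
      by (rule has_field_derivative_Re)
    then show "\<exists>y. ((\<lambda>t. Re (c * f (p t) / (w - z))) has_real_derivative y) (at t) \<and> 0 < y"
      using Re[OF pS] by blast
  qed simp
  then show False using zw(3) by (simp add: p_def)
qed

section \<open>Growth of a primitive of 1 / P\<close>

lemma norm_powr_of_real:
  assumes "(q::complex) \<noteq> 0"
  shows "cmod (q powr of_real c) = cmod q powr c"
  using assms by (simp add: powr_of_real_polar norm_mult)

text \<open>The segment makes an angle of at most pi/2 at the origin, so |p|^2 >= ((1 - s) 2M)^2 +
  (s |q|)^2. This keeps the integration path in the region where the asymptotics hold.\<close>

lemma segment_from_positive_real: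
  assumes M: "M > 0" and q: "Re q \<ge> 0" "2 * M \<le> cmod q" and p: "p \<in> closed_segment (of_real (2 * M)) q"
  shows "M \<le> cmod p" "cmod p \<le> cmod q"
proof -
  obtain s where s: "0 \<le> s" "s \<le> 1" "p = (1 - s) *\<^sub>R of_real (2 * M) + s *\<^sub>R q"
    using p by (auto simp: closed_segment_def)
  have "cmod p \<le> (1 - s) * (2 * M) + s * cmod q"
    unfolding s(3) using s(1,2) M by (intro norm_triangle_le) (simp add: abs_mult)
  also have "\<dots> \<le> (1 - s) * cmod q + s * cmod q"
    using s q by (intro add_right_mono mult_left_mono) auto
  finally show "cmod p \<le> cmod q" by (simp add: algebra_simps)
  have "M\<^sup>2 \<le> (4 * M\<^sup>2) * ((1 - s)\<^sup>2 + s\<^sup>2)"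
  proof -
    have "1 \<le> 4 * ((1 - s)\<^sup>2 + s\<^sup>2)"
      using zero_le_power2[of "2 * s - 1"] by (simp add: power2_eq_square algebra_simps)
    from mult_left_mono[OF this, of "M\<^sup>2"] show ?thesis by (simp add: algebra_simps)
  qed
  also have "\<dots> \<le> ((1 - s) * (2 * M))\<^sup>2 + s\<^sup>2 * (cmod q)\<^sup>2"
  proof -
    have "s\<^sup>2 * (2 * M)\<^sup>2 \<le> s\<^sup>2 * (cmod q)\<^sup>2"
      using q M by (intro mult_left_mono power_mono) auto
    then show ?thesis by (simp add: power2_eq_square algebra_simps)
  qed
  also have "\<dots> \<le> (cmod p)\<^sup>2"
  proof -
    have "0 \<le> (1 - s) * (2 * M) * (s * Re q)" using s M q by simp
    moreover have "(cmod p)\<^sup>2 = ((1 - s) * (2 * M) + s * Re q)\<^sup>2 + (s * Im q)\<^sup>2"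
      unfolding s(3) cmod_power2 by simp
    ultimately show ?thesis unfolding cmod_power2[of q] by (simp add: power2_eq_square algebra_simps)
  qed
  finally show "M \<le> cmod p" by (rule power2_le_imp_le) simp
qed

text \<open>The remainder R after subtracting the expected power has derivative o(|q|^(\<alpha>-1)).
  This is integrated along the segment from a fixed anchor 2M; \<alpha> >= 1 lets |x|^(\<alpha>-1)
  be bounded by its value at the end q.\<close>

lemma primitive_asymptotics:
  assumes lim: "((\<lambda>q. P q / q powr of_real (1 - \<alpha>)) \<longlongrightarrow> b) at_hp_infinity" and "b \<noteq> 0" "1 \<le> \<alpha>"
    and H: "\<And>q. q \<in> hp \<Longrightarrow> (H has_field_derivative 1 / P q) (at q)"
  shows "((\<lambda>q. H q / q powr of_real \<alpha>) \<longlongrightarrow> 1 / (of_real \<alpha> * b)) at_hp_infinity"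
proof -
  define k where "k = 1 / (of_real \<alpha> * b)"
  define R where "R = (\<lambda>q. H q - k * q powr of_real \<alpha>)"
  have np: "q \<noteq> 0" "q \<notin> \<real>\<^sub>\<le>\<^sub>0" if "q \<in> hp" for q using that by (auto simp: complex_nonpos_Reals_iff)
  have R': "(R has_field_derivative 1 / P q - q powr of_real (\<alpha> - 1) / b) (at q)" if "q \<in> hp" for q
  proof -
    have "(R has_field_derivative 1 / P q - k * (of_real \<alpha> * q powr (of_real \<alpha> - 1))) (at q)"
      unfolding R_def by (intro DERIV_diff H[OF that] DERIV_cmult has_field_derivative_powr np[OF that])
    then show ?thesis using \<open>1 \<le> \<alpha>\<close> by (simp add: k_def)
  qed
  have "((\<lambda>q. inverse (P q / q powr of_real (1 - \<alpha>)) - 1 / b) \<longlongrightarrow> inverse b - 1 / b) at_hp_infinity"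
    using \<open>b \<noteq> 0\<close> by (intro tendsto_intros lim)
  then have small: "((\<lambda>q. inverse (P q / q powr of_real (1 - \<alpha>)) - 1 / b) \<longlongrightarrow> 0) at_hp_infinity"
    by (simp add: inverse_eq_divide)
  have "((\<lambda>q. R q / q powr of_real \<alpha>) \<longlongrightarrow> 0) at_hp_infinity"
  proof (rule tendstoI)
    fix e :: real assume "e > 0"
    \<comment> \<open>The segment has length at most 2 |q| and costs 2d |q|^\<alpha>, the anchor
      value another d |q|^\<alpha>; the total 3d is below e.\<close>
    define d where "d = e / 4"
    have "d > 0" using \<open>e > 0\<close> by (simp add: d_def)
    obtain M0 where M0: "\<And>q. q \<in> hp \<Longrightarrow> M0 \<le> cmod q \<Longrightarrow> cmod (inverse (P q / q powr of_real (1 - \<alpha>)) - 1 / b) < d"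
      using tendstoD[OF small \<open>d > 0\<close>] unfolding eventually_at_hp_infinity dist_norm diff_0_right by blast
    define M where "M = max M0 1"
    have "M > 0" "1 \<le> M" by (auto simp: M_def)
    have R'_le: "cmod (1 / P q - q powr of_real (\<alpha> - 1) / b) \<le> d * cmod q powr (\<alpha> - 1)"
      if "q \<in> hp" "M \<le> cmod q" for q
    proof -
      let ?x = "q powr of_real (1 - \<alpha>)" and ?y = "q powr of_real (\<alpha> - 1)"
      have "?x * ?y = 1" using np[OF that(1)] by (simp flip: powr_add)
      then have "inverse (P q / ?x) * ?y = 1 / P q" by (simp add: divide_inverse mult.assoc mult.left_commute)
      then have "1 / P q - ?y / b = (inverse (P q / ?x) - 1 / b) * ?y"
        unfolding left_diff_distrib by simp
      then show ?thesis
        using M0[OF that(1)] that(2) norm_powr_of_real[OF np(1)[OF that(1)], of "\<alpha> - 1"]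
        by (simp add: norm_mult M_def mult_right_mono)
    qed
    let ?p = "complex_of_real (2 * M)"
    have p: "?p \<in> hp" using \<open>1 \<le> M\<close> by simp
    have bound: "cmod (R q) \<le> cmod (R ?p) + 2 * d * cmod q powr \<alpha>" if q: "q \<in> hp" "2 * M \<le> cmod q" for q
    proof -
      have seg: "closed_segment ?p q \<subseteq> hp" using convex_hp p q(1) by (simp add: closed_segment_subset)
      have "cmod (R q - R ?p) \<le> d * cmod q powr (\<alpha> - 1) * cmod (q - ?p)"
      proof (rule field_differentiable_bound[of "closed_segment ?p q"])
        fix x assume x: "x \<in> closed_segment ?p q"
        then have xh: "x \<in> hp" using seg by blast
        show "(R has_field_derivative 1 / P x - x powr of_real (\<alpha> - 1) / b) (at x within closed_segment ?p q)"
          using R'[OF xh] by (rule has_field_derivative_at_within)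
        have le: "M \<le> cmod x" "cmod x \<le> cmod q"
          using segment_from_positive_real[OF \<open>M > 0\<close> _ q(2) x] q(1) by auto
        have "cmod x powr (\<alpha> - 1) \<le> cmod q powr (\<alpha> - 1)"
          using le \<open>1 \<le> \<alpha>\<close> by (intro powr_mono2) auto
        then have "d * cmod x powr (\<alpha> - 1) \<le> d * cmod q powr (\<alpha> - 1)"
          using \<open>d > 0\<close> by (intro mult_left_mono) auto
        with R'_le[OF xh le(1)] show "cmod (1 / P x - x powr of_real (\<alpha> - 1) / b) \<le> d * cmod q powr (\<alpha> - 1)"
          by linarith
      qed auto
      also have "cmod (q - ?p) \<le> 2 * cmod q"
        using norm_triangle_ineq4[of q ?p] q(2) \<open>1 \<le> M\<close> by simp
      then have "d * cmod q powr (\<alpha> - 1) * cmod (q - ?p) \<le> d * cmod q powr (\<alpha> - 1) * (2 * cmod q)"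
        using \<open>d > 0\<close> by (intro mult_left_mono) auto
      also have "\<dots> = 2 * d * cmod q powr \<alpha>"
        using np[OF q(1)] powr_add[of "cmod q" "\<alpha> - 1" 1] by simp
      finally show ?thesis using norm_triangle_sub[of "R q" "R ?p"] by linarith
    qed
    have "cmod (R q / q powr of_real \<alpha>) < e" if q: "q \<in> hp" "max (2 * M) (cmod (R ?p) / d) \<le> cmod q" for q
    proof -
      have q1: "1 \<le> cmod q" using q(2) \<open>1 \<le> M\<close> by simp
      then have "cmod q powr 1 \<le> cmod q powr \<alpha>" using \<open>1 \<le> \<alpha>\<close> by (intro powr_mono) auto
      then have "cmod q \<le> cmod q powr \<alpha>" using q1 by simp
      moreover have "cmod (R ?p) \<le> d * cmod q" using q(2) \<open>d > 0\<close> by (simp add: field_simps)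
      ultimately have "cmod (R ?p) \<le> d * cmod q powr \<alpha>"
        using \<open>d > 0\<close> by (meson mult_left_mono less_imp_le order_trans)
      moreover have pos: "cmod q powr \<alpha> > 0" using np(1)[OF q(1)] by simp
      ultimately have "cmod (R q) < e * cmod q powr \<alpha>"
        using bound[OF q(1)] q(2) mult_pos_pos[OF \<open>d > 0\<close> pos] unfolding d_def by simp
      then show ?thesis
        using pos norm_powr_of_real[OF np(1)[OF q(1)], of \<alpha>] by (simp add: norm_divide divide_less_eq)
    qed
    then show "\<forall>\<^sub>F q in at_hp_infinity. dist (R q / q powr of_real \<alpha>) 0 < e"
      unfolding eventually_at_hp_infinity by (intro exI[of _ "max (2 * M) (cmod (R ?p) / d)"]) auto
  qed
  then have main: "((\<lambda>q. R q / q powr of_real \<alpha> + k) \<longlongrightarrow> 0 + k) at_hp_infinity"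
    by (intro tendsto_intros)
  have "\<forall>\<^sub>F q in at_hp_infinity. R q / q powr of_real \<alpha> + k = H q / q powr of_real \<alpha>"
    unfolding eventually_at_hp_infinity
  proof (intro exI[of _ 0] ballI impI)
    fix q assume "q \<in> hp"
    then show "R q / q powr of_real \<alpha> + k = H q / q powr of_real \<alpha>"
      using np by (simp add: R_def diff_divide_distrib)
  qed
  from Lim_transform_eventually[OF main this] show ?thesis by (simp add: k_def)
qed

section \<open>The linearized flow\<close>

lemma filterlim_norm_powr_at_hp_infinity:
  assumes "1 \<le> \<alpha>"
  shows "filterlim (\<lambda>q. cmod q powr \<alpha>) at_top at_hp_infinity"
proof (rule filterlim_at_top_mono)
  show "filterlim norm at_top at_hp_infinity"
    using filterlim_mono[OF filterlim_norm_at_top order_refl inf_le1] .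
  show "\<forall>\<^sub>F q in at_hp_infinity. cmod q \<le> cmod q powr \<alpha>"
    unfolding eventually_at_hp_infinity
  proof (intro exI[of _ 1] ballI impI)
    fix q :: complex assume "1 \<le> cmod q"
    then have "cmod q powr 1 \<le> cmod q powr \<alpha>" using assms by (intro powr_mono) auto
    then show "cmod q \<le> cmod q powr \<alpha>" by simp
  qed
qed

lemma primitive_along_trajectory:
  assumes P_nz: "\<And>q. q \<in> hp \<Longrightarrow> P q \<noteq> 0"
    and H: "\<And>q. q \<in> hp \<Longrightarrow> (H has_field_derivative 1 / P q) (at q)" and H0: "H (\<gamma> 0) = 0"
    and \<gamma>: "\<And>t. \<gamma> t \<in> hp" "\<And>t. (\<gamma> has_vector_derivative P (\<gamma> t)) (at t)"
  shows "H (\<gamma> t) = of_real t"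
proof -
  have "((\<lambda>t. H (\<gamma> t) - of_real t) has_vector_derivative 0) (at s within UNIV)" for s
  proof -
    have "((\<lambda>t. H (\<gamma> t)) has_vector_derivative 1) (at s)"
      using field_vector_diff_chain_at[OF \<gamma>(2) H[OF \<gamma>(1)]] P_nz[OF \<gamma>(1)] by (simp add: o_def)
    then show ?thesis by (auto intro!: derivative_eq_intros)
  qed
  then obtain c where "\<And>s. H (\<gamma> s) - of_real s = c"
    using has_vector_derivative_zero_constant[of UNIV "\<lambda>t. H (\<gamma> t) - of_real t"] by auto
  from this[of 0] this[of t] H0 show ?thesis by simp
qed

text \<open>If Re P > 0, then 1 / P also has positive real part; if P is a constant c, the
  multiplier c makes the derivative 1.\<close>

lemma inj_primitive:
  assumes holP: "P holomorphic_on hp" and Re_P: "\<And>q. q \<in> hp \<Longrightarrow> Re (P q) \<ge> 0"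
    and P_nz: "\<And>q. q \<in> hp \<Longrightarrow> P q \<noteq> 0"
    and H: "\<And>q. q \<in> hp \<Longrightarrow> (H has_field_derivative 1 / P q) (at q)"
  shows "inj_on H hp"
proof -
  obtain c where c: "\<And>q. q \<in> hp \<Longrightarrow> Re (c * (1 / P q)) > 0"
  proof (rule Re_nonneg_holomorphic_cases[OF holP open_hp convex_connected[OF convex_hp] Re_P])
    assume pos: "\<And>q. q \<in> hp \<Longrightarrow> Re (P q) > 0"
    show thesis
    proof (rule that[of 1])
      fix q assume "q \<in> hp"
      from pos[OF this] P_nz[OF this] show "Re (1 * (1 / P q)) > 0"
        by (simp add: Re_divide complex_neq_0)
    qed
  next
    fix c assume "\<And>q. q \<in> hp \<Longrightarrow> P q = c"
    with that[of c] P_nz show thesis by simp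
  qed
  show ?thesis by (rule Noshiro_Warschawski[OF convex_hp H c])
qed

text \<open>The data once the angles are known. The limit in \<open>Arg_top\<close> is Arg b /
  \<alpha>, and H is normalized to be time along \<gamma>.\<close>

locale backward_flow =
  fixes P H :: "complex \<Rightarrow> complex" and \<gamma> :: "real \<Rightarrow> complex" and \<sigma> \<alpha> :: real and b :: complex
  assumes alpha: "1 \<le> \<alpha>" "\<alpha> \<le> 2" and sigma: "\<bar>\<sigma>\<bar> = 1" and b: "b \<noteq> 0"
    and sgn_b: "sgn b = cis (\<sigma> * (pi / 2 * (2 - \<alpha>)))"
    and holP: "P holomorphic_on hp" and Re_P: "\<And>q. q \<in> hp \<Longrightarrow> Re (P q) \<ge> 0"
    and P_nz: "\<And>q. q \<in> hp \<Longrightarrow> P q \<noteq> 0"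
    and P_lim: "((\<lambda>q. P q / q powr of_real (1 - \<alpha>)) \<longlongrightarrow> b) at_hp_infinity"
    and H: "\<And>q. q \<in> hp \<Longrightarrow> (H has_field_derivative 1 / P q) (at q)" and H0: "H (\<gamma> 0) = 0"
    and \<gamma>_hp: "\<And>t. \<gamma> t \<in> hp" and \<gamma>_deriv: "\<And>t. (\<gamma> has_vector_derivative P (\<gamma> t)) (at t)"
    and \<gamma>_bot: "filterlim \<gamma> at_infinity at_bot" and \<gamma>_top: "filterlim \<gamma> at_infinity at_top"
    and Arg_bot: "((\<lambda>t. Arg (\<gamma> t)) \<longlongrightarrow> - \<sigma> * (pi / 2)) at_bot"
    and Arg_top: "((\<lambda>t. Arg (\<gamma> t)) \<longlongrightarrow> \<sigma> * (pi / \<alpha> - pi / 2)) at_top"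
begin

text \<open>Multiplication by \<i> \<sigma> turns the real axis \<open>H \<circ> \<gamma>\<close>
  upright and the half-plane in question to its right; adding 1/2 makes it \<open>hp\<close>.
  Translation of H by t becomes translation of E by \<i> \<sigma> t.\<close>

definition E :: "complex \<Rightarrow> complex" where
  "E q = 1/2 + \<i> * of_real \<sigma> * H q"

lemma sigma_cases: "\<sigma> = 1 \<or> \<sigma> = -1"
  using sigma by (auto simp: abs_if split: if_splits)

lemma H_\<gamma>: "H (\<gamma> t) = of_real t"
  by (rule primitive_along_trajectory[OF P_nz H H0 \<gamma>_hp \<gamma>_deriv])

lemma E_\<gamma>: "E (\<gamma> t) = Complex (1/2) (\<sigma> * t)"
  by (simp add: E_def H_\<gamma> complex_eq_iff)

lemma E_deriv: "q \<in> hp \<Longrightarrow> (E has_field_derivative \<i> * of_real \<sigma> / P q) (at q)"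
  unfolding E_def by (auto intro!: derivative_eq_intros H)

lemma E_holomorphic: "E holomorphic_on hp"
  using E_deriv by (meson has_field_derivative_at_within holomorphic_onI field_differentiable_def)

text \<open>E is a primitive of the reciprocal of P / (\<i> \<sigma>), so the asymptotics of
  primitives apply with b / (\<i> \<sigma>).\<close>

lemma E_asymptotics: "((\<lambda>q. E q / q powr of_real \<alpha>) \<longlongrightarrow> \<i> * of_real \<sigma> / (of_real \<alpha> * b)) at_hp_infinity"
proof -
  have "((\<lambda>q. E q / q powr of_real \<alpha>) \<longlongrightarrow> 1 / (of_real \<alpha> * (b / (\<i> * of_real \<sigma>)))) at_hp_infinity"
  proof (rule primitive_asymptotics)
    have "((\<lambda>q. P q / q powr of_real (1 - \<alpha>) / (\<i> * of_real \<sigma>)) \<longlongrightarrow> b / (\<i> * of_real \<sigma>)) at_hp_infinity"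
      using sigma_cases by (intro tendsto_intros P_lim) auto
    then show "((\<lambda>q. (P q / (\<i> * of_real \<sigma>)) / q powr of_real (1 - \<alpha>)) \<longlongrightarrow> b / (\<i> * of_real \<sigma>)) at_hp_infinity"
      by (simp add: field_simps)
    show "(E has_field_derivative 1 / (P q / (\<i> * of_real \<sigma>))) (at q)" if "q \<in> hp" for q
      using E_deriv[OF that] by simp
  qed (use alpha b sigma_cases in auto)
  then show ?thesis by simp
qed

lemma i_sigma: "\<i> * of_real \<sigma> = cis (\<sigma> * (pi / 2))"
  using sigma_cases by (auto simp: complex_eq_iff)

lemma E_limit_nonzero: "\<i> * of_real \<sigma> / (of_real \<alpha> * b) \<noteq> 0"
  using alpha b sigma_cases by auto

lemma norm_E_split:
  assumes "q \<in> hp"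
  shows "cmod (E q / q powr of_real \<alpha>) * cmod q powr \<alpha> = cmod (E q)"
  using hp_nonzero[OF assms] by (simp add: norm_divide norm_powr_of_real)

lemma norm_E_unbounded: "\<exists>R. \<forall>q\<in>hp. R < cmod q \<longrightarrow> B < cmod (E q)"
proof -
  have "filterlim (\<lambda>q. cmod (E q / q powr of_real \<alpha>) * cmod q powr \<alpha>) at_top at_hp_infinity"
    using E_limit_nonzero alpha
    by (intro filterlim_tendsto_pos_mult_at_top[OF tendsto_norm[OF E_asymptotics]]
        filterlim_norm_powr_at_hp_infinity) auto
  then have "\<forall>\<^sub>F q in at_hp_infinity. B < cmod (E q / q powr of_real \<alpha>) * cmod q powr \<alpha>"
    by (simp add: filterlim_at_top_dense)
  then show ?thesis
    unfolding eventually_at_hp_infinity using norm_E_split by (metis less_imp_le)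
qed

text \<open>The ray of angle -\<sigma> pi/4 lies strictly between the limit angles of the two ends
  of \<gamma>, whatever \<alpha> is. On it E / |w|^\<alpha> has limit direction \<sigma> (\<alpha>
  pi/4 - pi/2), whose cosine sin (\<alpha> pi/4) is positive.\<close>

lemma E_diagonal: "\<forall>\<^sub>F r in at_top. E (Complex r (- \<sigma> * r)) \<in> hp"
proof -
  let ?w = "\<lambda>r. Complex r (- \<sigma> * r)" and ?K = "\<i> * of_real \<sigma> / (of_real \<alpha> * b)"
  have w: "?w r = rcis (sqrt 2 * r) (- \<sigma> * (pi / 4))" for r
    using sigma_cases by (auto simp: complex_eq_iff cos_45 sin_45)
  have w_hp: "\<forall>\<^sub>F r in at_top. ?w r \<in> hp"
    using eventually_gt_at_top[of "1/2::real"] by eventually_elim simp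
  have "filterlim (\<lambda>r. cmod (?w r)) at_top at_top"
  proof (rule filterlim_at_top_mono[OF filterlim_ident])
    show "\<forall>\<^sub>F r in at_top. r \<le> cmod (?w r)"
      by (intro always_eventually allI) (metis complex_Re_le_cmod complex.sel(1))
  qed
  then have w_lim: "filterlim ?w at_hp_infinity at_top"
    unfolding filterlim_at_hp_infinity filterlim_at_infinity_conv_norm_at_top using w_hp by blast
  have "((\<lambda>r. Re (E (?w r) / ?w r powr of_real \<alpha> * cis (\<alpha> * (- \<sigma> * (pi / 4)))))
      \<longlongrightarrow> Re (?K * cis (\<alpha> * (- \<sigma> * (pi / 4))))) at_top"
    by (intro tendsto_intros filterlim_compose[OF E_asymptotics w_lim])
  moreover have "Re (?K * cis (\<alpha> * (- \<sigma> * (pi / 4)))) > 0"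
  proof -
    define d where "d = inverse (\<alpha> * cmod b)"
    have "b = of_real (cmod b) * cis (\<sigma> * (pi / 2 * (2 - \<alpha>)))"
      unfolding sgn_b[symmetric] sgn_eq using b by simp
    then have "?K = cis (\<sigma> * (pi / 2)) / (of_real (\<alpha> * cmod b) * cis (\<sigma> * (pi / 2 * (2 - \<alpha>))))"
      unfolding i_sigma[symmetric] by (metis mult.assoc of_real_mult)
    also have "\<dots> = of_real d * (cis (\<sigma> * (pi / 2)) / cis (\<sigma> * (pi / 2 * (2 - \<alpha>))))"
      by (simp only: d_def divide_inverse of_real_inverse of_real_mult inverse_mult_distrib mult_ac)
    also have "\<dots> = of_real d * cis (\<sigma> * (pi / 2) - \<sigma> * (pi / 2 * (2 - \<alpha>)))"
      by (simp only: cis_divide)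
    finally have K: "?K = of_real d * cis (\<sigma> * (pi / 2) - \<sigma> * (pi / 2 * (2 - \<alpha>)))" .
    let ?A = "\<sigma> * (pi / 2) - \<sigma> * (pi / 2 * (2 - \<alpha>))" and ?B = "\<alpha> * (- \<sigma> * (pi / 4))"
    have "?K * cis ?B = of_real d * (cis ?A * cis ?B)"
      unfolding K by (rule mult.assoc)
    also have "\<dots> = of_real d * cis (?A + ?B)"
      by (subst cis_mult) (rule refl)
    also have "\<sigma> * (pi / 2) - \<sigma> * (pi / 2 * (2 - \<alpha>)) + \<alpha> * (- \<sigma> * (pi / 4)) = \<sigma> * (\<alpha> * pi / 4 - pi / 2)"
      by (simp add: field_simps)
    finally have "?K * cis ?B = of_real d * cis (\<sigma> * (\<alpha> * pi / 4 - pi / 2))" .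
    then have "Re (?K * cis (\<alpha> * (- \<sigma> * (pi / 4)))) = d * cos (\<sigma> * (\<alpha> * pi / 4 - pi / 2))"
      by (simp only: Re_complex_of_real times_complex.sel of_real_def scaleR_complex.sel one_complex.sel cis.sel)
    also have "cos (\<sigma> * (\<alpha> * pi / 4 - pi / 2)) = sin (\<alpha> * pi / 4)"
    proof -
      have "cos (\<sigma> * (\<alpha> * pi / 4 - pi / 2)) = cos (\<alpha> * pi / 4 - pi / 2)"
        using sigma_cases cos_minus[of "\<alpha> * pi / 4 - pi / 2"] by auto
      also have "\<dots> = sin (\<alpha> * pi / 4)" by (simp add: cos_diff)
      finally show ?thesis .
    qed
    also have "d * sin (\<alpha> * pi / 4) > 0"
    proof (rule mult_pos_pos)
      have "0 < \<alpha> * pi" "\<alpha> * pi < 4 * pi" using alpha pi_gt_zero by auto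
      then show "0 < sin (\<alpha> * pi / 4)" by (intro sin_gt_zero) auto
    qed (use alpha b in \<open>simp add: d_def\<close>)
    finally show ?thesis .
  qed
  moreover have "filterlim (\<lambda>r. cmod (?w r) powr \<alpha>) at_top at_top"
    using filterlim_compose[OF filterlim_norm_powr_at_hp_infinity[OF alpha(1)] w_lim] .
  ultimately have "filterlim (\<lambda>r. Re (E (?w r) / ?w r powr of_real \<alpha> * cis (\<alpha> * (- \<sigma> * (pi / 4))))
      * cmod (?w r) powr \<alpha>) at_top at_top"
    by (rule filterlim_tendsto_pos_mult_at_top)
  then have "\<forall>\<^sub>F r in at_top. 1/2 < Re (E (?w r) / ?w r powr of_real \<alpha> * cis (\<alpha> * (- \<sigma> * (pi / 4))))
      * cmod (?w r) powr \<alpha>"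
    by (simp only: filterlim_at_top_dense)
  with eventually_gt_at_top[of 0] show ?thesis
  proof eventually_elim
    case (elim r)
    have "Arg (?w r) = - \<sigma> * (pi / 4)"
    proof -
      have "\<bar>- \<sigma> * (pi / 4)\<bar> = pi / 4" using sigma by (simp add: abs_mult)
      then have "- \<sigma> * (pi / 4) \<in> {- pi<..pi}" using pi_gt_zero by (simp only: greaterThanAtMost_iff) linarith
      then show ?thesis unfolding w using elim(1) by (intro Arg_rcis) auto
    qed
    moreover have w0: "?w r \<noteq> 0" using elim(1) by (simp add: complex_eq_iff)
    ultimately have "?w r powr of_real \<alpha> = of_real (cmod (?w r) powr \<alpha>) * cis (\<alpha> * (- \<sigma> * (pi / 4)))"
      using powr_of_real_polar[OF w0, of \<alpha>] by simp
    then have "E (?w r) / ?w r powr of_real \<alpha> * cis (\<alpha> * (- \<sigma> * (pi / 4))) = E (?w r) / of_real (cmod (?w r) powr \<alpha>)"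
      by simp
    moreover have "cmod (?w r) powr \<alpha> > 0" using w0 by simp
    ultimately show ?case using elim(2) by simp
  qed
qed

lemma inj_E: "inj_on E hp"
proof (rule inj_onI)
  fix x y assume xy: "x \<in> hp" "y \<in> hp" "E x = E y"
  then have "H x = H y" using sigma_cases by (auto simp: E_def)
  moreover have "inj_on H hp" by (rule inj_primitive[OF holP Re_P P_nz H])
  ultimately show "x = y" using xy(1,2) by (meson inj_onD)
qed

lemma sigma_Im_bot: "filterlim (\<lambda>t. \<sigma> * Im (\<gamma> t)) at_bot at_bot"
proof -
  have "((\<lambda>t. \<sigma> * sin (Arg (\<gamma> t))) \<longlongrightarrow> \<sigma> * sin (- \<sigma> * (pi / 2))) at_bot"
    by (intro tendsto_intros Arg_bot)
  moreover have "\<sigma> * sin (- \<sigma> * (pi / 2)) < 0" using sigma_cases by auto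
  ultimately have "filterlim (\<lambda>t. \<sigma> * sin (Arg (\<gamma> t)) * cmod (\<gamma> t)) at_bot at_bot"
    by (rule filterlim_tendsto_neg_mult_at_bot) (use \<gamma>_bot in \<open>simp add: filterlim_at_infinity_conv_norm_at_top\<close>)
  moreover have "\<sigma> * sin (Arg (\<gamma> t)) * cmod (\<gamma> t) = \<sigma> * Im (\<gamma> t)" for t
    by (metis Im_rcis rcis_cmod_Arg mult.assoc mult.commute)
  ultimately show ?thesis by simp
qed

text \<open>\<sigma> Arg \<gamma> tends to pi/\<alpha> - pi/2, nonnegative as \<alpha> <= 2, hence
  it eventually exceeds the angle -pi/4 of the diagonal.\<close>

lemma top_side: "\<forall>\<^sub>F t in at_top. - Re (\<gamma> t) < \<sigma> * Im (\<gamma> t)"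
proof -
  have "((\<lambda>t. \<sigma> * Arg (\<gamma> t)) \<longlongrightarrow> \<sigma> * (\<sigma> * (pi / \<alpha> - pi / 2))) at_top"
    by (intro tendsto_intros Arg_top)
  moreover have "\<sigma> * (\<sigma> * (pi / \<alpha> - pi / 2)) > - (pi / 4)"
  proof -
    have "pi / \<alpha> \<ge> pi / 2" using alpha pi_gt_zero by (intro divide_left_mono) auto
    moreover have "\<sigma> * (\<sigma> * (pi / \<alpha> - pi / 2)) = pi / \<alpha> - pi / 2" using sigma_cases by auto
    ultimately show ?thesis using pi_gt_zero by linarith
  qed
  ultimately have "\<forall>\<^sub>F t in at_top. - (pi / 4) < \<sigma> * Arg (\<gamma> t)"
    by (rule order_tendstoD(1))
  then show ?thesis
  proof eventually_elim
    case (elim t)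
    let ?x = "\<sigma> * Arg (\<gamma> t)"
    have "\<bar>?x\<bar> < pi / 2" using Arg_in_hp[OF \<gamma>_hp, of t] sigma by (simp add: abs_mult)
    then have "0 < sin (?x + pi / 4)" using elim by (intro sin_gt_zero) auto
    then have "- cos ?x < sin ?x"
      by (simp add: sin_add cos_45 sin_45 zero_less_mult_iff flip: distrib_right add_divide_distrib)
    moreover have "cmod (\<gamma> t) > 0" using hp_nonzero[OF \<gamma>_hp] by simp
    ultimately have "cmod (\<gamma> t) * - cos ?x < cmod (\<gamma> t) * sin ?x"
      by (intro mult_strict_left_mono)
    moreover have "cmod (\<gamma> t) * cos ?x = Re (\<gamma> t)" "cmod (\<gamma> t) * sin ?x = \<sigma> * Im (\<gamma> t)"
      using Re_rcis[of "cmod (\<gamma> t)" "Arg (\<gamma> t)"] Im_rcis[of "cmod (\<gamma> t)" "Arg (\<gamma> t)"] sigma_cases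
      unfolding rcis_cmod_Arg by auto
    ultimately show ?case by simp
  qed
qed

text \<open>If \<open>Re P\<close> vanishes somewhere, then \<open>P\<close> is constant, \<open>\<gamma>\<close> is a vertical line and \<open>E\<close> is affine.\<close>

lemma half_plane_in_image:
  obtains C where "closed C" "C \<subseteq> hp" "{X. 1/2 \<le> Re X} \<subseteq> E ` C"
proof (rule Re_nonneg_holomorphic_cases[OF holP open_hp convex_connected[OF convex_hp] Re_P])
  assume pos: "\<And>q. q \<in> hp \<Longrightarrow> Re (P q) > 0"
  interpret rising_curve \<sigma> \<gamma>
  proof
    show "strict_mono (\<lambda>t. Re (\<gamma> t))"
    proof (rule strict_monoI)
      fix s t :: real assume "s < t"
      then show "Re (\<gamma> s) < Re (\<gamma> t)"
        by (rule DERIV_pos_imp_increasing) (use has_field_derivative_Re[OF \<gamma>_deriv] pos[OF \<gamma>_hp] in blast)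
    qed
    show "continuous_on UNIV \<gamma>"
      using \<gamma>_deriv by (meson continuous_at_imp_continuous_on has_vector_derivative_continuous)
  qed (rule sigma sigma_Im_bot \<gamma>_top top_side)+
  show thesis
    by (rule that[OF closed_beyond half_plane_subset_image[OF \<gamma>_hp E_holomorphic inj_E E_\<gamma> norm_E_unbounded E_diagonal]])
next
  fix c assume c: "Re c = 0" "\<And>q. q \<in> hp \<Longrightarrow> P q = c"
  have c0: "c \<noteq> 0" using c(2)[OF \<gamma>_hp] P_nz[OF \<gamma>_hp] by auto
  have d: "((\<lambda>q. E q - \<i> * of_real \<sigma> / c * q) has_field_derivative 0) (at q within hp)" if "q \<in> hp" for q
    using E_deriv[OF that] c(2)[OF that] c0
    by (auto intro!: derivative_eq_intros intro: has_field_derivative_at_within)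
  then obtain k where "\<And>q. q \<in> hp \<Longrightarrow> E q - \<i> * of_real \<sigma> / c * q = k"
    using has_field_derivative_zero_constant[OF convex_hp d] by blast
  note k = this
  have E_affine: "E q = 1/2 + \<i> * of_real \<sigma> / c * (q - \<gamma> 0)" if "q \<in> hp" for q
  proof -
    have "E (\<gamma> 0) = 1/2" by (simp add: E_\<gamma> complex_eq_iff)
    then have "E q - \<i> * of_real \<sigma> / c * q = 1/2 - \<i> * of_real \<sigma> / c * \<gamma> 0"
      using k[OF that] k[OF \<gamma>_hp, of 0] by metis
    then have "E q = 1/2 - \<i> * of_real \<sigma> / c * \<gamma> 0 + \<i> * of_real \<sigma> / c * q"
      by (simp only: diff_eq_eq)
    then show ?thesis by (simp add: right_diff_distrib)
  qed
  have \<gamma>_affine: "\<gamma> t = \<gamma> 0 + c * of_real t" for t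
  proof -
    have "\<i> * of_real \<sigma> / c * (\<gamma> t - \<gamma> 0) = \<i> * of_real \<sigma> * of_real t"
      using E_affine[OF \<gamma>_hp, of t] E_\<gamma>[of t] by (simp add: complex_eq_iff)
    then have "\<i> * of_real \<sigma> * ((\<gamma> t - \<gamma> 0) / c) = \<i> * of_real \<sigma> * of_real t" by simp
    moreover have "\<i> * of_real \<sigma> \<noteq> 0" using sigma_cases by auto
    ultimately have "(\<gamma> t - \<gamma> 0) / c = of_real t" by (metis mult_left_cancel)
    then have "\<gamma> t - \<gamma> 0 = of_real t * c" using c0 by (simp add: divide_eq_eq)
    then show ?thesis by (simp add: diff_eq_eq add.commute mult.commute)
  qed
  \<comment> \<open>The direction of travel on the vertical line is forced by its backward end,
    where \<sigma> Im \<gamma> tends to -infinity.\<close>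
  have pos: "\<sigma> * Im c > 0"
  proof (rule ccontr)
    assume neg: "\<not> ?thesis"
    obtain t where t: "t \<le> 0" "\<sigma> * Im (\<gamma> t) < \<sigma> * Im (\<gamma> 0)"
      using eventually_happens[OF eventually_conj[OF eventually_le_at_bot[of 0]
            sigma_Im_bot[unfolded filterlim_at_bot_dense, rule_format, of "\<sigma> * Im (\<gamma> 0)"]]] by auto
    moreover have "0 \<le> \<sigma> * Im c * t" using neg t(1) by (simp add: mult_nonpos_nonpos)
    ultimately show False unfolding \<gamma>_affine[of t] by (simp add: algebra_simps)
  qed
  define C where "C = {q. Re (\<gamma> 0) \<le> Re q}"
  have "closed C" unfolding C_def by (rule closed_halfspace_Re_ge)
  moreover have C: "C \<subseteq> hp" using \<gamma>_hp[of 0] by (auto simp: C_def)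
  moreover have "{X. 1/2 \<le> Re X} \<subseteq> E ` C"
  proof
    fix X :: complex assume X: "X \<in> {X. 1/2 \<le> Re X}"
    \<comment> \<open>The solution of \<open>E q = X\<close>: for imaginary c the slope \<i>
      \<sigma> / c equals 1 / (\<sigma> Im c).\<close>
    define q where "q = \<gamma> 0 + of_real (\<sigma> * Im c) * (X - 1/2)"
    have "Re q \<ge> Re (\<gamma> 0)" using pos X by (simp add: q_def)
    then have "q \<in> C" by (simp add: C_def)
    moreover have "\<i> * of_real \<sigma> / c * of_real (\<sigma> * Im c) = 1"
    proof -
      have "c = \<i> * of_real (Im c)" using c(1) by (simp add: complex_eq_iff)
      moreover have "Im c \<noteq> 0" using pos by auto
      then have "\<i> * of_real \<sigma> / (\<i> * of_real (Im c)) * of_real (\<sigma> * Im c) = of_real (\<sigma> * \<sigma>)" by simp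
      moreover have "\<sigma> * \<sigma> = 1" using sigma_cases by auto
      ultimately show ?thesis by (metis of_real_1)
    qed
    then have "E q = X" using E_affine[of q] C \<open>q \<in> C\<close> unfolding q_def
      by (auto simp flip: mult.assoc)
    ultimately show "X \<in> E ` C" by blast
  qed
  ultimately show thesis by (rule that)
qed

end

section \<open>Conjugates of parabolic groups\<close>

text \<open>In the coordinate \<open>1 / (1 - \<zeta>)\<close> this is the translation by \<open>\<i> s\<close>.\<close>

definition parabolic_shift :: "real \<Rightarrow> complex \<Rightarrow> complex" where
  "parabolic_shift s \<zeta> = 1 - (1 - \<zeta>) / (1 + \<i> * of_real s * (1 - \<zeta>))"

text \<open>The closed disc is covered because the fixed points are counted for the continuous
  extension.\<close>

lemma parabolic_shift_denom:
  assumes "\<zeta> \<in> cball 0 1"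
  shows "1 + \<i> * of_real s * (1 - \<zeta>) \<noteq> 0"
proof
  assume "1 + \<i> * of_real s * (1 - \<zeta>) = 0"
  then have eqs: "1 + s * Im \<zeta> = 0" "s * (1 - Re \<zeta>) = 0"
    by (simp_all add: complex_eq_iff)
  then have "Re \<zeta> = 1" by auto
  moreover have "(Re \<zeta>)\<^sup>2 + (Im \<zeta>)\<^sup>2 \<le> 1"
    using assms by (simp add: cmod_power2[symmetric] power_le_one)
  ultimately have "Im \<zeta> = 0" by simp
  with eqs show False by simp
qed

lemma parabolic_shift_coordinate:
  assumes "\<zeta> \<in> unit_disc"
  shows "1 / (1 - parabolic_shift s \<zeta>) = 1 / (1 - \<zeta>) + \<i> * of_real s"
proof -
  have "1 - \<zeta> \<noteq> 0" using assms by auto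
  moreover have "1 + \<i> * of_real s * (1 - \<zeta>) \<noteq> 0" using assms by (intro parabolic_shift_denom) auto
  ultimately show ?thesis by (simp add: parabolic_shift_def field_simps)
qed

lemma parabolic_shift_disc:
  assumes "\<zeta> \<in> unit_disc"
  shows "parabolic_shift s \<zeta> \<in> unit_disc"
proof -
  have "1 / (1 - \<zeta>) + \<i> * of_real s \<in> hp" using disc_to_hp[OF assms] by simp
  from hp_to_disc[OF this] show ?thesis
    unfolding parabolic_shift_coordinate[OF assms, symmetric] by simp
qed

lemma disc_coordinate_eqI:
  fixes z w :: complex
  assumes "z \<in> unit_disc" "w \<in> unit_disc" "1 / (1 - z) = 1 / (1 - w)"
  shows "z = w"
proof -
  have "1 - z \<noteq> 0" "1 - w \<noteq> 0" using assms(1,2) by auto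
  with assms(3) show ?thesis by simp
qed

lemma parabolic_shift_add:
  assumes "\<zeta> \<in> unit_disc"
  shows "parabolic_shift (s + t) \<zeta> = parabolic_shift s (parabolic_shift t \<zeta>)"
proof (rule disc_coordinate_eqI)
  note disc = parabolic_shift_disc[OF assms]
  show "parabolic_shift (s + t) \<zeta> \<in> unit_disc" by (rule disc)
  show "parabolic_shift s (parabolic_shift t \<zeta>) \<in> unit_disc" by (rule parabolic_shift_disc[OF disc])
  show "1 / (1 - parabolic_shift (s + t) \<zeta>) = 1 / (1 - parabolic_shift s (parabolic_shift t \<zeta>))"
    unfolding parabolic_shift_coordinate[OF disc] parabolic_shift_coordinate[OF assms]
    by (simp add: distrib_left)
qed

lemma parabolic_shift_0: "parabolic_shift 0 \<zeta> = \<zeta>"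
  by (simp add: parabolic_shift_def)

lemma parabolic_shift_inverse:
  assumes "\<zeta> \<in> unit_disc"
  shows "parabolic_shift (- s) (parabolic_shift s \<zeta>) = \<zeta>" "parabolic_shift s (parabolic_shift (- s) \<zeta>) = \<zeta>"
  using parabolic_shift_add[OF assms, of "- s" s] parabolic_shift_add[OF assms, of s "- s"]
  by (simp_all add: parabolic_shift_0)

lemma conformal_parabolic_shift: "conformal_onto (parabolic_shift s) unit_disc unit_disc"
  unfolding conformal_onto_def
proof
  show "parabolic_shift s holomorphic_on unit_disc"
    unfolding parabolic_shift_def by (intro holomorphic_intros parabolic_shift_denom) auto
  show "bij_betw (parabolic_shift s) unit_disc unit_disc"
    by (rule bij_betwI[of _ _ _ "parabolic_shift (- s)"])
      (use parabolic_shift_disc parabolic_shift_inverse in auto)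
qed

lemma conformal_onto_cong:
  assumes "conformal_onto g S T" "\<And>z. z \<in> S \<Longrightarrow> h z = g z"
  shows "conformal_onto h S T"
  using assms unfolding conformal_onto_def
  by (metis (no_types, lifting) bij_betw_cong holomorphic_transform)

text \<open>The fixed point equation reduces to s (1 - \<zeta>)^2 = 0.\<close>

lemma parabolic_automorphism_shift:
  assumes "s \<noteq> 0" and g: "\<And>\<zeta>. \<zeta> \<in> unit_disc \<Longrightarrow> g \<zeta> = parabolic_shift s \<zeta>"
  shows "parabolic_automorphism g"
  unfolding parabolic_automorphism_def
proof (intro conjI exI[of _ "parabolic_shift s"] exI[of _ 1])
  show "conformal_onto g unit_disc unit_disc"
    using conformal_parabolic_shift g by (rule conformal_onto_cong)
  show "continuous_on (cball 0 1) (parabolic_shift s)"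
    unfolding parabolic_shift_def by (intro continuous_intros ballI parabolic_shift_denom)
  have "\<zeta> = 1" if "\<zeta> \<in> cball 0 1" "parabolic_shift s \<zeta> = \<zeta>" for \<zeta>
  proof -
    have "(1 - \<zeta>) / (1 + \<i> * of_real s * (1 - \<zeta>)) = 1 - \<zeta>"
      using that(2) by (simp add: parabolic_shift_def algebra_simps)
    then have "(1 - \<zeta>) * (\<i> * of_real s * (1 - \<zeta>)) = 0"
      using parabolic_shift_denom[OF that(1), of s] by (simp add: divide_eq_eq distrib_left)
    then show ?thesis using \<open>s \<noteq> 0\<close> by simp
  qed
  moreover have "parabolic_shift s 1 = 1" by (simp add: parabolic_shift_def)
  ultimately show "{\<zeta> \<in> cball 0 1. parabolic_shift s \<zeta> = \<zeta>} = {1}" by auto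
qed (use g in auto)

text \<open>The conjugacy is supplied for t >= 0. Since the shifts are invertible, it makes F
  injective on \<Omega>, and \<open>inv_into\<close> becomes the conjugate of the inverse shift; the
  group law is then that of the shifts.\<close>

lemma BFID_of_conjugacy:
  assumes gen: "generates f F"
    and \<phi>: "conformal_onto \<phi> unit_disc \<Omega>" and \<Omega>: "\<Omega> \<subseteq> unit_disc" and "s \<noteq> 0"
    and conj: "\<And>t \<zeta>. t \<ge> 0 \<Longrightarrow> \<zeta> \<in> unit_disc \<Longrightarrow> F t (\<phi> \<zeta>) = \<phi> (parabolic_shift (s * t) \<zeta>)"
  shows "BFID F \<Omega>" "p_type F \<Omega>"
proof -
  have hol\<phi>: "\<phi> holomorphic_on unit_disc" and inj\<phi>: "inj_on \<phi> unit_disc" and im\<phi>: "\<phi> ` unit_disc = \<Omega>"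
    using \<phi> by (auto simp: conformal_onto_def bij_betw_def)
  obtain \<psi> where \<psi>: "\<psi> holomorphic_on \<phi> ` unit_disc" "\<And>\<zeta>. \<zeta> \<in> unit_disc \<Longrightarrow> \<psi> (\<phi> \<zeta>) = \<zeta>"
    using holomorphic_has_inverse[OF hol\<phi> open_ball inj\<phi>] by metis
  have \<psi>_disc: "\<psi> w \<in> unit_disc" "\<phi> (\<psi> w) = w" if "w \<in> \<Omega>" for w
    using that \<psi>(2) unfolding im\<phi>[symmetric] by auto
  have ext: "group_extension F \<Omega> t (\<phi> \<zeta>) = \<phi> (parabolic_shift (s * t) \<zeta>)" if \<zeta>: "\<zeta> \<in> unit_disc" for t \<zeta>
  proof (cases "t \<ge> 0")
    case True then show ?thesis using conj \<zeta> by (simp add: group_extension_def)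
  next
    case False
    then have t: "- t \<ge> 0" by simp
    have "inv_into \<Omega> (F (- t)) (\<phi> \<zeta>) = \<phi> (parabolic_shift (s * t) \<zeta>)"
    proof (rule inv_into_f_eq)
      show "inj_on (F (- t)) \<Omega>"
      proof (rule inj_onI)
        fix x y assume xy: "x \<in> \<Omega>" "y \<in> \<Omega>" "F (- t) x = F (- t) y"
        obtain x' y' where x': "x' \<in> unit_disc" "x = \<phi> x'" and y': "y' \<in> unit_disc" "y = \<phi> y'"
          using xy im\<phi> by blast
        have "\<phi> (parabolic_shift (s * - t) x') = \<phi> (parabolic_shift (s * - t) y')"
          using xy(3) conj[OF t] x' y' by simp
        then have "parabolic_shift (s * - t) x' = parabolic_shift (s * - t) y'"
          using inj\<phi> parabolic_shift_disc x'(1) y'(1) by (meson inj_onD)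
        then have "x' = y'"
          using parabolic_shift_inverse(1)[OF x'(1)] parabolic_shift_inverse(1)[OF y'(1)] by metis
        then show "x = y" using x' y' by simp
      qed
      show "\<phi> (parabolic_shift (s * t) \<zeta>) \<in> \<Omega>"
        using parabolic_shift_disc[OF \<zeta>] im\<phi> by blast
      show "F (- t) (\<phi> (parabolic_shift (s * t) \<zeta>)) = \<phi> \<zeta>"
        using conj[OF t parabolic_shift_disc[OF \<zeta>]] parabolic_shift_inverse(1)[OF \<zeta>, of "s * t"] by simp
    qed
    then show ?thesis using False by (simp add: group_extension_def)
  qed
  have conf: "conformal_onto (group_extension F \<Omega> t) \<Omega> \<Omega>" for t
  proof (rule conformal_onto_cong)
    show "conformal_onto (\<phi> \<circ> (parabolic_shift (s * t) \<circ> \<psi>)) \<Omega> \<Omega>"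
      unfolding conformal_onto_def
    proof
      have "bij_betw \<psi> \<Omega> unit_disc"
        by (rule bij_betwI[of _ _ _ \<phi>]) (use \<psi>_disc \<psi>(2) im\<phi> in auto)
      then show "bij_betw (\<phi> \<circ> (parabolic_shift (s * t) \<circ> \<psi>)) \<Omega> \<Omega>"
        using conformal_parabolic_shift[of "s * t"] \<phi>
        by (intro bij_betw_trans[of _ \<Omega> unit_disc] bij_betw_trans[of \<psi> \<Omega> unit_disc])
          (auto simp: conformal_onto_def)
      have "(parabolic_shift (s * t) \<circ> \<psi>) holomorphic_on \<Omega>"
        using conformal_parabolic_shift[of "s * t"] \<psi>(1) \<psi>_disc unfolding im\<phi> conformal_onto_def
        by (intro holomorphic_on_compose_gen[of \<psi> \<Omega> _ unit_disc]) auto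
      then show "(\<phi> \<circ> (parabolic_shift (s * t) \<circ> \<psi>)) holomorphic_on \<Omega>"
        by (rule holomorphic_on_compose_gen[OF _ hol\<phi>])
          (use \<psi>_disc parabolic_shift_disc in auto)
    qed
    show "group_extension F \<Omega> t w = (\<phi> \<circ> (parabolic_shift (s * t) \<circ> \<psi>)) w" if "w \<in> \<Omega>" for w
      using ext[OF \<psi>_disc(1)[OF that]] \<psi>_disc(2)[OF that] by simp
  qed
  have hom: "unit_disc homeomorphic \<Omega>"
  proof (rule homeomorphicI)
    show "\<psi> ` \<Omega> = unit_disc" using \<psi>(2) \<psi>_disc im\<phi> by force
    show "continuous_on unit_disc \<phi>" "continuous_on \<Omega> \<psi>"
      using hol\<phi> \<psi>(1) im\<phi> holomorphic_on_imp_continuous_on by auto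
  qed (use \<psi>(2) \<psi>_disc im\<phi> in auto)
  show "BFID F \<Omega>"
    unfolding BFID_def
  proof (intro conjI allI conf \<Omega>)
    show "open \<Omega>" using open_mapping_thm3[OF hol\<phi> open_ball inj\<phi>] im\<phi> by simp
    show "connected \<Omega>" using homeomorphic_connectedness[OF hom] by simp
    show "simply_connected \<Omega>"
      using homeomorphic_simply_connected_eq[OF hom] convex_imp_simply_connected[OF convex_ball] by blast
    show "\<Omega> \<noteq> {}" using im\<phi> by auto
  qed
  have inv: "(inv_into unit_disc \<phi> \<circ> group_extension F \<Omega> t \<circ> \<phi>) \<zeta> = parabolic_shift (s * t) \<zeta>"
    if "\<zeta> \<in> unit_disc" for t \<zeta>
    using ext[OF that] inv_into_f_f[OF inj\<phi> parabolic_shift_disc[OF that]] by simp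
  show "p_type F \<Omega>"
    unfolding p_type_def parabolic_group_def
  proof (intro exI[of _ \<phi>] conjI allI ballI impI \<phi>)
    fix t show "conformal_onto (inv_into unit_disc \<phi> \<circ> group_extension F \<Omega> t \<circ> \<phi>) unit_disc unit_disc"
      using conformal_parabolic_shift inv by (rule conformal_onto_cong)
  next
    fix \<zeta> assume "\<zeta> \<in> unit_disc"
    then show "(inv_into unit_disc \<phi> \<circ> group_extension F \<Omega> 0 \<circ> \<phi>) \<zeta> = \<zeta>"
      using inv[of \<zeta> 0] by (simp add: parabolic_shift_0)
  next
    fix t r \<zeta> assume \<zeta>: "\<zeta> \<in> unit_disc"
    show "(inv_into unit_disc \<phi> \<circ> group_extension F \<Omega> (t + r) \<circ> \<phi>) \<zeta>
      = (inv_into unit_disc \<phi> \<circ> group_extension F \<Omega> t \<circ> \<phi>) ((inv_into unit_disc \<phi> \<circ> group_extension F \<Omega> r \<circ> \<phi>) \<zeta>)"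
      unfolding inv[OF \<zeta>] inv[OF parabolic_shift_disc[OF \<zeta>]]
      using parabolic_shift_add[OF \<zeta>] by (simp add: distrib_left)
  next
    fix t :: real assume "t \<noteq> 0"
    with \<open>s \<noteq> 0\<close> have "s * t \<noteq> 0" by simp
    then show "parabolic_automorphism (inv_into unit_disc \<phi> \<circ> group_extension F \<Omega> t \<circ> \<phi>)"
      using inv by (rule parabolic_automorphism_shift)
  qed
qed

text \<open>By the half-angle formulas, cot (\<theta>/2) / 2 is the height at which the circle point
  of angle \<theta> appears on the line Re = 1/2.\<close>

lemma inverse_one_minus_cis:
  assumes "sin (\<theta> / 2) \<noteq> 0"
  shows "1 / (1 - cis \<theta>) = Complex (1/2) (cot (\<theta> / 2) / 2)" "cis \<theta> \<noteq> 1"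
proof -
  let ?s = "sin (\<theta> / 2)" and ?c = "cos (\<theta> / 2)"
  have "cos \<theta> = 1 - 2 * ?s\<^sup>2" "sin \<theta> = 2 * ?s * ?c"
    using cos_double_sin[of "\<theta> / 2"] sin_double[of "\<theta> / 2"] by simp_all
  then have "cis \<theta> = Complex (1 - 2 * ?s\<^sup>2) (2 * ?s * ?c)" by (simp add: complex_eq_iff)
  moreover have "Complex (1/2) (c / s / 2) * (1 - Complex (1 - 2 * s\<^sup>2) (2 * s * c)) = 1"
    if "s \<noteq> 0" "c\<^sup>2 = 1 - s\<^sup>2" for s c :: real
    using that by (simp add: complex_eq_iff power2_eq_square)
  moreover have "?c\<^sup>2 = 1 - ?s\<^sup>2" by (simp add: cos_squared_eq)
  ultimately have prod: "Complex (1/2) (cot (\<theta> / 2) / 2) * (1 - cis \<theta>) = 1"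
    using assms unfolding cot_def by simp
  then show "cis \<theta> \<noteq> 1" by auto
  with prod show "1 / (1 - cis \<theta>) = Complex (1/2) (cot (\<theta> / 2) / 2)"
    by (simp add: divide_eq_eq)
qed

lemma cot_half_limits:
  "filterlim (\<lambda>\<theta>::real. cot (\<theta> / 2) / 2) at_top (at_right 0)"
  "filterlim (\<lambda>\<theta>::real. cot (\<theta> / 2) / 2) at_bot (at_left 0)"
  unfolding cot_def by real_asymp+

section \<open>The corner\<close>

lemma filterlim_inverse_one_minus:
  fixes v :: "'a \<Rightarrow> complex"
  assumes "(v \<longlongrightarrow> 1) F" "\<forall>\<^sub>F t in F. v t \<noteq> 1"
  shows "filterlim (\<lambda>t. 1 / (1 - v t)) at_infinity F"
proof -
  have "filterlim (\<lambda>\<zeta>::complex. 1 / (1 - \<zeta>)) at_infinity (at 1)"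
    by (rule filterlim_divide_at_infinity[OF tendsto_const])
      (auto simp: filterlim_at eventually_at_filter intro!: tendsto_eq_intros)
  moreover have "filterlim v (at 1) F" using assms by (simp add: filterlim_at)
  ultimately show ?thesis by (rule filterlim_compose)
qed

context backward_flow
begin

lemma inverse_map:
  obtains G where "G holomorphic_on hp" "continuous_on {X. 1/2 \<le> Re X} G"
    and "\<And>X. 1/2 \<le> Re X \<Longrightarrow> G X \<in> hp" "\<And>X. 1/2 \<le> Re X \<Longrightarrow> E (G X) = X"
    and "\<And>q. q \<in> hp \<Longrightarrow> G (E q) = q"
    and "filterlim G at_infinity (inf at_infinity (principal {X. 1/2 \<le> Re X}))"
proof -
  obtain C where C: "closed C" "C \<subseteq> hp" "{X. 1/2 \<le> Re X} \<subseteq> E ` C"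
    by (rule half_plane_in_image)
  obtain G where G: "G holomorphic_on E ` hp" "\<And>q. q \<in> hp \<Longrightarrow> G (E q) = q"
    using holomorphic_has_inverse[OF E_holomorphic open_hp inj_E] by metis
  have sub: "{X. 1/2 \<le> Re X} \<subseteq> E ` hp" using C by blast
  have GC: "G X \<in> C \<and> E (G X) = X" if "1/2 \<le> Re X" for X
  proof -
    obtain q where "q \<in> C" "X = E q" using C(3) \<open>1/2 \<le> Re X\<close> by blast
    with G(2)[of q] C(2) show ?thesis by auto
  qed
  show thesis
  proof (rule that)
    show "G holomorphic_on hp"
      by (rule holomorphic_on_subset[OF G(1)]) (use sub in auto)
    show "continuous_on {X. 1/2 \<le> Re X} G"
      using holomorphic_on_imp_continuous_on[OF G(1)] sub by (rule continuous_on_subset)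
    show "G X \<in> hp" "E (G X) = X" if "1/2 \<le> Re X" for X
      using GC[OF that] C(2) by auto
    show "filterlim G at_infinity (inf at_infinity (principal {X. 1/2 \<le> Re X}))"
      unfolding filterlim_at_infinity[OF order_refl]
    proof (intro allI impI)
      fix R :: real assume "R > 0"
      have "compact (E ` (C \<inter> cball 0 R))"
        using holomorphic_on_imp_continuous_on[OF E_holomorphic] C(1,2)
        by (intro compact_continuous_image closed_Int_compact) (auto intro: continuous_on_subset)
      then obtain B where B: "\<And>X. X \<in> E ` (C \<inter> cball 0 R) \<Longrightarrow> cmod X \<le> B"
        using compact_imp_bounded bounded_iff by meson
      have "R \<le> cmod (G X)" if X: "B + 1 \<le> cmod X" "1/2 \<le> Re X" for X
      proof (rule ccontr)
        assume "\<not> R \<le> cmod (G X)"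
        then have "G X \<in> C \<inter> cball 0 R" using GC[OF X(2)] by auto
        then have "E (G X) \<in> E ` (C \<inter> cball 0 R)" by (rule imageI)
        then have "cmod X \<le> B" using B GC[OF X(2)] by simp
        with X(1) show False by simp
      qed
      then show "\<forall>\<^sub>F X in inf at_infinity (principal {X. 1/2 \<le> Re X}). R \<le> cmod (G X)"
        unfolding eventually_inf_principal eventually_at_infinity by blast
    qed
  qed (rule G(2))
qed

text \<open>The Riemann map is G read in the coordinate 1 / (1 - \<zeta>) on both sides. The circle
  without 1 then runs through the trajectory, and the point 1 closes it up.\<close>

lemma BFID_with_corner:
  assumes gen: "generates f F"
    and trans: "\<And>t z. t \<ge> 0 \<Longrightarrow> z \<in> unit_disc \<Longrightarrow> H (1 / (1 - F t z)) = H (1 / (1 - z)) + of_real t"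
  shows "\<exists>\<Omega>. BFID F \<Omega> \<and> p_type F \<Omega> \<and> has_corner \<Omega> 1 (1 / \<alpha>)"
proof -
  obtain G where holG: "G holomorphic_on hp" and contG: "continuous_on {X. 1/2 \<le> Re X} G"
    and G_hp: "\<And>X. 1/2 \<le> Re X \<Longrightarrow> G X \<in> hp" and EG: "\<And>X. 1/2 \<le> Re X \<Longrightarrow> E (G X) = X"
    and GE: "\<And>q. q \<in> hp \<Longrightarrow> G (E q) = q"
    and G_inf: "filterlim G at_infinity (inf at_infinity (principal {X. 1/2 \<le> Re X}))"
    by (rule inverse_map) (rule that, assumption+)
  define \<phi> where "\<phi> = (\<lambda>\<zeta>. if \<zeta> = 1 then 1 else 1 - 1 / G (1 / (1 - \<zeta>)))"
  define \<Omega> where "\<Omega> = \<phi> ` unit_disc"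
  have coord: "1/2 \<le> Re (1 / (1 - \<zeta>))" if "\<zeta> \<in> cball 0 1" "\<zeta> \<noteq> 1" for \<zeta>
  proof -
    have "(1 - (cmod \<zeta>)\<^sup>2) / (cmod (1 - \<zeta>))\<^sup>2 \<ge> 0"
      using that by (intro divide_nonneg_nonneg) (auto simp: power_le_one)
    then show ?thesis using Re_inverse_one_minus[OF that(2)] by simp
  qed
  have disc: "\<zeta> \<in> cball 0 1" "\<zeta> \<noteq> 1" if "\<zeta> \<in> unit_disc" for \<zeta> :: complex using that by auto
  have \<phi>_eq: "\<phi> \<zeta> = 1 - 1 / G (1 / (1 - \<zeta>))" if "\<zeta> \<noteq> 1" for \<zeta> using that by (simp add: \<phi>_def)
  have \<phi>_disc: "\<phi> \<zeta> \<in> unit_disc" "1 / (1 - \<phi> \<zeta>) = G (1 / (1 - \<zeta>))" if "\<zeta> \<in> cball 0 1" "\<zeta> \<noteq> 1" for \<zeta>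
    unfolding \<phi>_eq[OF that(2)] using hp_to_disc[OF G_hp[OF coord[OF that]]] by simp_all
  have \<Omega>_disc: "\<Omega> \<subseteq> unit_disc" using \<phi>_disc(1) disc unfolding \<Omega>_def by blast
  have hol\<phi>: "\<phi> holomorphic_on unit_disc"
  proof (rule holomorphic_transform)
    have "(G \<circ> (\<lambda>\<zeta>. 1 / (1 - \<zeta>))) holomorphic_on unit_disc"
      using disc_to_hp disc(2) by (intro holomorphic_on_compose_gen[OF _ holG] holomorphic_intros) auto
    then show "(\<lambda>\<zeta>. 1 - 1 / G (1 / (1 - \<zeta>))) holomorphic_on unit_disc"
      using hp_nonzero[OF G_hp[OF coord[OF disc]]] by (intro holomorphic_intros) (auto simp: o_def)
  qed (use \<phi>_eq disc(2) in metis)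
  have inj\<phi>: "inj_on \<phi> unit_disc"
  proof (rule inj_onI)
    fix x y assume xy: "x \<in> unit_disc" "y \<in> unit_disc" "\<phi> x = \<phi> y"
    have "G (1 / (1 - x)) = G (1 / (1 - y))"
      using \<phi>_disc(2)[OF disc[OF xy(1)]] \<phi>_disc(2)[OF disc[OF xy(2)]] xy(3) by simp
    then have "1 / (1 - x) = 1 / (1 - y)"
      using EG[OF coord[OF disc[OF xy(1)]]] EG[OF coord[OF disc[OF xy(2)]]] by metis
    then show "x = y" using xy(1,2) disc_coordinate_eqI by blast
  qed
  have conf\<phi>: "conformal_onto \<phi> unit_disc \<Omega>"
    unfolding conformal_onto_def \<Omega>_def using hol\<phi> inj\<phi> by (simp add: inj_on_imp_bij_betw)
  have "\<sigma> \<noteq> 0" using sigma by auto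
  have conj: "F t (\<phi> \<zeta>) = \<phi> (parabolic_shift (\<sigma> * t) \<zeta>)" if t: "t \<ge> 0" and \<zeta>: "\<zeta> \<in> unit_disc" for t \<zeta>
  proof -
    let ?M = "parabolic_shift (\<sigma> * t) \<zeta>"
    have M: "?M \<in> unit_disc" by (rule parabolic_shift_disc[OF \<zeta>])
    have \<phi>\<zeta>: "\<phi> \<zeta> \<in> unit_disc" by (rule \<phi>_disc(1)[OF disc[OF \<zeta>]])
    have Fdisc: "F t (\<phi> \<zeta>) \<in> unit_disc" by (rule generates_props(3)[OF gen t \<phi>\<zeta>])
    have "E (1 / (1 - F t (\<phi> \<zeta>))) = E (1 / (1 - \<phi> \<zeta>)) + \<i> * of_real \<sigma> * of_real t"
      unfolding E_def trans[OF t \<phi>\<zeta>] by (simp add: distrib_left)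
    also have "\<dots> = 1 / (1 - ?M)"
      unfolding \<phi>_disc(2)[OF disc[OF \<zeta>]] EG[OF coord[OF disc[OF \<zeta>]]] parabolic_shift_coordinate[OF \<zeta>]
      by simp
    \<comment> \<open>Since \<open>G (E q) = q\<close> holds on all of \<open>hp\<close>, the
      E-value alone identifies the image point.\<close>
    finally have "1 / (1 - F t (\<phi> \<zeta>)) = G (1 / (1 - ?M))"
      using GE[OF disc_to_hp[OF Fdisc]] by simp
    also have "\<dots> = 1 / (1 - \<phi> ?M)" by (rule \<phi>_disc(2)[OF disc[OF M], symmetric])
    finally show ?thesis
      using Fdisc \<phi>_disc(1)[OF disc[OF M]] disc_coordinate_eqI by blast
  qed
  have lim1: "(\<phi> \<longlongrightarrow> \<phi> 1) (at 1 within cball 0 1)"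
  proof -
    have "filterlim (\<lambda>\<zeta>::complex. 1 / (1 - \<zeta>)) at_infinity (at 1 within cball 0 1)"
      by (rule filterlim_inverse_one_minus) (auto simp: eventually_at_filter)
    moreover have "\<forall>\<^sub>F \<zeta> in at 1 within cball 0 1. 1 / (1 - \<zeta>) \<in> {X. 1/2 \<le> Re X}"
      unfolding eventually_at_filter using coord by (intro always_eventually) blast
    ultimately have "filterlim (\<lambda>\<zeta>. 1 / (1 - \<zeta>)) (inf at_infinity (principal {X. 1/2 \<le> Re X})) (at 1 within cball 0 1)"
      unfolding filterlim_inf filterlim_principal by blast
    from filterlim_compose[OF G_inf this]
    have "((\<lambda>\<zeta>. 1 - 1 / G (1 / (1 - \<zeta>))) \<longlongrightarrow> 1 - 0) (at 1 within cball 0 1)"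
      by (intro tendsto_diff tendsto_const tendsto_divide_0[OF tendsto_const])
    then have "(\<phi> \<longlongrightarrow> 1 - 0) (at 1 within cball 0 1)"
      by (rule Lim_transform_eventually) (auto simp: \<phi>_def eventually_at_filter)
    then show ?thesis by (simp add: \<phi>_def)
  qed
  have cont_off: "continuous_on (cball 0 1 - {1}) \<phi>"
  proof (rule continuous_on_eq)
    have "continuous_on (cball 0 1 - {1}) (\<lambda>\<zeta>. G (1 / (1 - \<zeta>)))"
      by (rule continuous_on_compose2[OF contG]) (use coord in \<open>auto intro!: continuous_intros\<close>)
    then show "continuous_on (cball 0 1 - {1}) (\<lambda>\<zeta>. 1 - 1 / G (1 / (1 - \<zeta>)))"
      using hp_nonzero[OF G_hp[OF coord]] by (intro continuous_intros) auto
  qed (simp add: \<phi>_def)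
  have cont\<phi>: "continuous_on (cball 0 1) \<phi>"
    unfolding continuous_on_def
  proof
    fix x :: complex assume x: "x \<in> cball 0 1"
    show "(\<phi> \<longlongrightarrow> \<phi> x) (at x within cball 0 1)"
    proof (cases "x = 1")
      case True then show ?thesis using lim1 by simp
    next
      case False
      have "at x within cball 0 1 = at x within (cball 0 1 - {1})"
        by (rule at_within_nhd[of x "- {1}"]) (use False in auto)
      then show ?thesis using cont_off x False by (simp add: continuous_on_def)
    qed
  qed
  \<comment> \<open>The time at which E on \<gamma> has height cot (\<theta>/2) / 2, as \<sigma>^2 =
    1.\<close>
  define \<Gamma> where "\<Gamma> = (\<lambda>\<theta>. \<gamma> (\<sigma> * (cot (\<theta> / 2) / 2)))"
  \<comment> \<open>On the circle \<open>\<phi> - 1\<close> equals -1 / \<Gamma>, and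
    \<open>Arg\<close> is continuous along \<Gamma> in the right half-plane.\<close>
  define A where "A = (\<lambda>\<theta>. pi - Arg (\<Gamma> \<theta>))"
  let ?I = "{0 - pi<..<0 + pi} - {0::real}"
  have sin_half: "sin (\<theta> / 2) \<noteq> 0" if "\<theta> \<in> ?I" for \<theta>
    using that sin_gt_zero[of "\<theta> / 2"] sin_gt_zero[of "- \<theta> / 2"] by (cases "\<theta> > 0") auto
  have \<phi>_cis: "\<phi> (cis \<theta>) = 1 - 1 / \<Gamma> \<theta>" if "\<theta> \<in> ?I" for \<theta>
  proof -
    have "1 / (1 - cis \<theta>) = E (\<Gamma> \<theta>)"
      unfolding \<Gamma>_def E_\<gamma> inverse_one_minus_cis(1)[OF sin_half[OF that]] using sigma_cases by auto
    then show ?thesis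
      using \<phi>_eq[OF inverse_one_minus_cis(2)[OF sin_half[OF that]]] GE[OF \<gamma>_hp] by (simp add: \<Gamma>_def)
  qed
  have \<Gamma>_nz: "\<Gamma> \<theta> \<noteq> 0" for \<theta> unfolding \<Gamma>_def by (rule hp_nonzero[OF \<gamma>_hp])
  have cont\<gamma>: "continuous_on UNIV \<gamma>"
    using \<gamma>_deriv by (meson continuous_at_imp_continuous_on has_vector_derivative_continuous)
  have contA: "continuous_on ?I A"
  proof -
    have "continuous_on ?I (\<lambda>\<theta>. \<sigma> * (cot (\<theta> / 2) / 2))"
      unfolding cot_def using sin_half by (intro continuous_intros) auto
    then have "continuous_on ?I \<Gamma>"
      unfolding \<Gamma>_def by (rule continuous_on_compose2[OF cont\<gamma>]) auto
    moreover have "\<Gamma> \<theta> \<notin> \<real>\<^sub>\<le>\<^sub>0" for \<theta>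
      using \<gamma>_hp[of "\<sigma> * (cot (\<theta> / 2) / 2)"] by (auto simp: \<Gamma>_def complex_nonpos_Reals_iff)
    ultimately show ?thesis unfolding A_def by (intro continuous_intros) auto
  qed
  have is_Arg: "is_Arg (\<phi> (cis \<theta>) - 1) (A \<theta>)" if "\<theta> \<in> ?I" for \<theta>
  proof -
    have "is_Arg (- 1 / \<Gamma> \<theta>) (Arg (- 1) - Arg (\<Gamma> \<theta>))"
      using Arg_divide[of "\<Gamma> \<theta>" "- 1"] \<Gamma>_nz by simp
    moreover have "Arg (- 1) = pi" using Arg_of_real[of "-1"] by simp
    ultimately show ?thesis using \<phi>_cis[OF that] by (simp add: A_def)
  qed
  \<comment> \<open>As \<theta> decreases to 0, time tends to \<sigma> * infinity: the right-hand
    limit belongs to the forward end for \<sigma> = 1 and to the backward end for \<sigma> =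
    -1.\<close>
  define \<beta> where "\<beta> = (if \<sigma> = 1 then pi - (pi / \<alpha> - pi / 2) else pi / 2)"
  have A_lim: "(A \<longlongrightarrow> \<beta>) (at_right 0) \<and> (A \<longlongrightarrow> \<beta> + pi * (1 / \<alpha>)) (at_left 0)"
  proof (cases "\<sigma> = 1")
    case True
    have "(A \<longlongrightarrow> pi - \<sigma> * (pi / \<alpha> - pi / 2)) (at_right 0)"
      unfolding A_def \<Gamma>_def using True cot_half_limits(1)
      by (intro tendsto_intros filterlim_compose[OF Arg_top]) simp
    moreover have "(A \<longlongrightarrow> pi - (- \<sigma> * (pi / 2))) (at_left 0)"
      unfolding A_def \<Gamma>_def using True cot_half_limits(2)
      by (intro tendsto_intros filterlim_compose[OF Arg_bot]) simp
    ultimately show ?thesis using True by (simp add: \<beta>_def)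
  next
    case False
    then have \<sigma>: "\<sigma> = -1" using sigma_cases by auto
    have "(A \<longlongrightarrow> pi - (- \<sigma> * (pi / 2))) (at_right 0)"
      unfolding A_def \<Gamma>_def using \<sigma> cot_half_limits(1)
      by (intro tendsto_intros filterlim_compose[OF Arg_bot]) (simp add: filterlim_uminus_at_bot)
    moreover have "(A \<longlongrightarrow> pi - \<sigma> * (pi / \<alpha> - pi / 2)) (at_left 0)"
      unfolding A_def \<Gamma>_def using \<sigma> cot_half_limits(2)
      by (intro tendsto_intros filterlim_compose[OF Arg_top]) (simp add: filterlim_uminus_at_top)
    ultimately show ?thesis using \<sigma> by (simp add: \<beta>_def)
  qed
  have frontier: "1 \<in> frontier \<Omega>"
  proof -
    have "\<phi> ` closure unit_disc \<subseteq> closure \<Omega>"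
    proof (rule image_closure_subset)
      show "continuous_on (closure unit_disc) \<phi>" using cont\<phi> by simp
      show "\<phi> ` unit_disc \<subseteq> closure \<Omega>" unfolding \<Omega>_def by (rule closure_subset)
    qed simp
    moreover have "\<phi> 1 = 1" by (simp add: \<phi>_def)
    moreover have "(1::complex) \<in> closure unit_disc" by simp
    ultimately have "1 \<in> closure \<Omega>" by (metis image_eqI subsetD)
    moreover have "1 \<notin> interior \<Omega>" using \<Omega>_disc interior_subset by fastforce
    ultimately show ?thesis by (simp add: frontier_def)
  qed
  have "has_corner \<Omega> 1 (1 / \<alpha>)"
    unfolding has_corner_def
  proof (rule conjI[OF frontier], rule exI[of _ \<phi>], rule exI[of _ 0], rule exI[of _ \<beta>], rule exI[of _ A],
      rule exI[of _ pi], intro conjI conf\<phi> cont\<phi> ballI)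
    show "\<phi> (cis 0) = 1" by (simp add: \<phi>_def)
    show "\<phi> (cis \<theta>) \<noteq> 1" if "\<theta> \<in> ?I" for \<theta> using \<phi>_cis[OF that] \<Gamma>_nz by simp
  qed (use contA is_Arg A_lim in auto)
  moreover have "BFID F \<Omega>" "p_type F \<Omega>"
    using BFID_of_conjugacy[OF gen conf\<phi> \<Omega>_disc \<open>\<sigma> \<noteq> 0\<close> conj] by auto
  ultimately show ?thesis by blast
qed

end

theorem proposition36:
  fixes \<alpha> :: real and a z :: complex
    and f :: "complex \<Rightarrow> complex"
    and F :: "real \<Rightarrow> complex \<Rightarrow> complex"
    and u :: "real \<Rightarrow> complex"
  assumes "\<alpha> > 0"
    and "f \<in> generators_DW1_order \<alpha>"
    and "a \<noteq> 0"
    and "((\<lambda>z. f z / (1 - z) powr of_real (1 + \<alpha>)) \<longlongrightarrow> a) (at 1 within unit_disc)"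
    and "generates f F"
    and "z \<in> unit_disc"
    and "full_trajectory f z u"
    and "(u \<longlongrightarrow> 1) at_bot"
  shows "\<alpha> \<in> {1..2} \<and>
    \<bar>Arg (- a)\<bar> = pi / 2 * (2 - \<alpha>) \<and>
    (converges_tangentially_1_at_bot u \<and>
     (Arg (- a) \<noteq> 0 \<longrightarrow>
        ((\<lambda>t. Arg (1 - u t)) \<longlongrightarrow> sgn (Arg (- a)) * (pi / 2)) at_bot)) \<and>
    (\<exists>\<Omega>. BFID F \<Omega> \<and> p_type F \<Omega> \<and> has_corner \<Omega> 1 (1 / \<alpha>))"
proof -
  define b where "b = - a"
  have b: "b \<noteq> 0" using assms(3) by (simp add: b_def)
  \<comment> \<open>Membership in the class supplies some semigroup with Denjoy--Wolff point 1. It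
    yields the properties of P, which depend on f only.\<close>
  obtain F' where gen': "generates f F'" and DW: "\<And>z. z \<in> unit_disc \<Longrightarrow> ((\<lambda>t. F' t z) \<longlongrightarrow> 1) at_top"
    using assms(2) unfolding generators_DW1_order_def generators_DW1_def by blast
  define P where "P = hp_field f"
  have holP: "P holomorphic_on hp" and Re_P: "\<And>q. q \<in> hp \<Longrightarrow> Re (P q) \<ge> 0"
    unfolding P_def by (rule hp_field_holomorphic[OF gen' DW]; assumption?)+
  have P_lim: "((\<lambda>q. P q / q powr of_real (1 - \<alpha>)) \<longlongrightarrow> b) at_hp_infinity"
    unfolding P_def b_def by (rule hp_field_asymptotics[OF assms(4)])
  have u: "u t \<in> unit_disc" "(u has_vector_derivative - f (u t)) (at t)" "u 0 = z" for t
    using assms(7) by (auto simp: full_trajectory_def)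
  define \<gamma> where "\<gamma> = (\<lambda>t. 1 / (1 - u t))"
  have u_nz: "1 - u t \<noteq> 0" for t using u(1)[of t] by auto
  have u_\<gamma>: "u t = 1 - 1 / \<gamma> t" for t by (simp add: \<gamma>_def)
  have \<gamma>_hp: "\<gamma> t \<in> hp" for t unfolding \<gamma>_def by (rule disc_to_hp[OF u(1)])
  have \<gamma>_deriv: "(\<gamma> has_vector_derivative P (\<gamma> t)) (at t)" for t
  proof -
    have "((\<lambda>w. 1 / (1 - w)) has_field_derivative 1 / (1 - u t)\<^sup>2) (at (u t))"
      using u_nz[of t] by (auto intro!: derivative_eq_intros simp: power2_eq_square)
    from field_vector_diff_chain_at[OF u(2) this]
    show ?thesis unfolding \<gamma>_def P_def hp_field_disc[OF u(1)] by (simp add: o_def)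
  qed
  have \<gamma>_bot: "filterlim \<gamma> at_infinity at_bot"
    unfolding \<gamma>_def using u_nz by (intro filterlim_inverse_one_minus[OF assms(8)] always_eventually) auto
  define \<theta> where "\<theta> = (\<lambda>t. Arg (\<gamma> t))"
  have \<theta>: "\<bar>\<theta> t\<bar> < pi / 2" for t unfolding \<theta>_def by (rule Arg_in_hp[OF \<gamma>_hp])
  have bound: "\<bar>Arg b\<bar> + \<bar>1 - \<alpha>\<bar> * (pi / 2) \<le> pi / 2"
    by (rule Arg_leading_coeff_bound[OF P_lim b Re_P])
  have \<gamma>_nz: "\<gamma> t \<noteq> 0" for t by (rule hp_nonzero[OF \<gamma>_hp])
  have cis_bot: "((\<lambda>t. cis (\<alpha> * \<theta> t)) \<longlongrightarrow> - sgn b) at_bot"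
  proof -
    have "((\<lambda>t::real. sgn t) \<longlongrightarrow> - 1) at_bot"
      by (rule tendsto_eventually) (auto intro: eventually_mono[OF eventually_le_at_bot[of "-1"]])
    moreover have "\<forall>\<^sub>F t::real in at_bot. t \<noteq> 0"
      by (rule eventually_mono[OF eventually_le_at_bot[of "-1"]]) auto
    ultimately show ?thesis
      using cis_Arg_limit[OF trajectory_growth[OF P_lim \<gamma>_hp \<gamma>_deriv \<gamma>_bot] assms(1) b \<gamma>_nz, of sgn "- 1"]
      by (simp add: \<theta>_def)
  qed
  note angle = backward_angle[OF cis_bot \<theta> assms(1) b bound]
  have cont_arg: "continuous_on UNIV \<theta>"
  proof -
    have "continuous_on UNIV \<gamma>"
      using \<gamma>_deriv by (meson continuous_at_imp_continuous_on has_vector_derivative_continuous)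
    moreover have "\<gamma> t \<notin> \<real>\<^sub>\<le>\<^sub>0" for t using \<gamma>_hp[of t] by (auto simp: complex_nonpos_Reals_iff)
    ultimately show ?thesis unfolding \<theta>_def by (intro continuous_intros) auto
  qed
  \<comment> \<open>The side is taken from the trajectory; for \<alpha> = 2 both sides are
    compatible with Arg b = 0.\<close>
  obtain \<sigma> where \<sigma>: "\<bar>\<sigma>\<bar> = 1" "(\<theta> \<longlongrightarrow> - \<sigma> * (pi / 2)) at_bot"
    using tendsto_signed[OF cont_arg angle(4)] by auto
  have sgn_b: "sgn b = cis (\<sigma> * (pi / 2 * (2 - \<alpha>)))"
    by (rule sgn_leading_coeff[OF cis_bot \<sigma>(2,1)])
  have \<sigma>_cases: "\<sigma> = 1 \<or> \<sigma> = -1" using \<sigma>(1) by (auto simp: abs_if split: if_splits)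
  have Arg_b: "Arg b = \<sigma> * (pi / 2 * (2 - \<alpha>))"
  proof (rule Arg_unique')
    show "cmod b > 0" using b by simp
    show "b = rcis (cmod b) (\<sigma> * (pi / 2 * (2 - \<alpha>)))"
      unfolding rcis_def sgn_b[symmetric] sgn_eq using b by simp
    have "0 \<le> pi / 2 * (2 - \<alpha>)" using angle(2) pi_gt_zero by simp
    moreover have "pi / 2 * (2 - \<alpha>) \<le> pi / 2 * 1" using angle(1) pi_gt_zero by (intro mult_left_mono) auto
    ultimately have "\<bar>\<sigma> * (pi / 2 * (2 - \<alpha>))\<bar> < pi" using \<sigma>(1) pi_gt_zero by (simp only: abs_mult)
    then show "\<sigma> * (pi / 2 * (2 - \<alpha>)) \<in> {- pi<..pi}" by (simp only: greaterThanAtMost_iff) linarith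
  qed
  \<comment> \<open>A zero would force P to be constantly 0, contradicting the limit b along
    \<gamma>.\<close>
  have P_nz: "P q \<noteq> 0" if "q \<in> hp" for q
  proof (rule Re_nonneg_holomorphic_cases[OF holP open_hp convex_connected[OF convex_hp] Re_P])
    assume "\<And>q. q \<in> hp \<Longrightarrow> Re (P q) > 0"
    from this[OF that] show ?thesis by auto
  next
    fix c assume c: "\<And>q. q \<in> hp \<Longrightarrow> P q = c"
    have "c \<noteq> 0"
    proof
      assume "c = 0"
      have "filterlim \<gamma> at_hp_infinity at_bot"
        unfolding filterlim_at_hp_infinity using \<gamma>_bot \<gamma>_hp by (auto intro: always_eventually)
      from filterlim_compose[OF P_lim this] have "((\<lambda>t. P (\<gamma> t) / \<gamma> t powr of_real (1 - \<alpha>)) \<longlongrightarrow> b) at_bot" .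
      then have "((\<lambda>t::real. 0) \<longlongrightarrow> b) at_bot" using c[OF \<gamma>_hp] \<open>c = 0\<close> by simp
      then show False using b tendsto_const_iff[of "at_bot :: real filter" 0 b] by simp
    qed
    with c[OF that] show ?thesis by simp
  qed
  have "(\<lambda>q. 1 / P q) holomorphic_on hp" using P_nz by (intro holomorphic_intros holP)
  then obtain H0 where "\<And>q. q \<in> hp \<Longrightarrow> (H0 has_field_derivative 1 / P q) (at q within hp)"
    by (rule holomorphic_convex_primitive'[OF convex_hp open_hp]) (rule that)
  then have H0: "(H0 has_field_derivative 1 / P q) (at q)" if "q \<in> hp" for q
    using at_within_open[OF that open_hp] that by metis
  define H where "H = (\<lambda>q. H0 q - H0 (\<gamma> 0))"
  have H: "(H has_field_derivative 1 / P q) (at q)" if "q \<in> hp" for q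
    unfolding H_def using H0[OF that] by (auto intro!: derivative_eq_intros)
  have trans: "H (1 / (1 - F2 t z)) = H (1 / (1 - z)) + of_real t"
    if "generates f F2" "t \<ge> 0" "z \<in> unit_disc" for F2 t z
    using semigroup_translation[OF that(1,3,2)] P_nz H unfolding P_def by blast
  have H\<gamma>: "H (\<gamma> t) = of_real t" for t
    by (rule primitive_along_trajectory[OF P_nz H _ \<gamma>_hp \<gamma>_deriv]) (simp_all add: H_def)
  \<comment> \<open>The trajectory is given only as a solution of the differential equation.
    Injectivity of H identifies it for t >= 0 with the orbit under F', which tends to 1.\<close>
  have \<gamma>_top: "filterlim \<gamma> at_infinity at_top"
  proof -
    have F'_disc: "F' t z \<in> unit_disc" if "t \<ge> 0" for t
      by (rule generates_props(3)[OF gen' that assms(6)])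
    have "\<forall>\<^sub>F t in at_top. F' t z \<noteq> 1"
      by (rule eventually_mono[OF eventually_ge_at_top[of 0]]) (use F'_disc in force)
    then have "filterlim (\<lambda>t. 1 / (1 - F' t z)) at_infinity at_top"
      by (rule filterlim_inverse_one_minus[OF DW[OF assms(6)]])
    note F'_top = this
    have eq: "1 / (1 - F' t z) = \<gamma> t" if "t \<ge> 0" for t
    proof -
      have "H (1 / (1 - F' t z)) = H (\<gamma> t)"
        unfolding H\<gamma> trans[OF gen' that assms(6)] using H\<gamma>[of 0] u(3) by (simp add: \<gamma>_def)
      moreover have "inj_on H hp" by (rule inj_primitive[OF holP Re_P P_nz H])
      ultimately show ?thesis
        using disc_to_hp[OF F'_disc[OF that]] \<gamma>_hp by (meson inj_onD)
    qed
    have "\<forall>\<^sub>F t in at_top. 1 / (1 - F' t z) = \<gamma> t"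
      by (rule eventually_mono[OF eventually_ge_at_top[of 0]]) (rule eq)
    from filterlim_cong[OF refl refl this] show ?thesis using F'_top by simp
  qed
  have cis_top: "((\<lambda>t. cis (\<alpha> * \<theta> t)) \<longlongrightarrow> sgn b) at_top"
  proof -
    have "((\<lambda>t::real. sgn t) \<longlongrightarrow> 1) at_top"
      by (rule tendsto_eventually) (auto intro: eventually_mono[OF eventually_gt_at_top[of 0]])
    moreover have "\<forall>\<^sub>F t::real in at_top. t \<noteq> 0"
      by (rule eventually_mono[OF eventually_gt_at_top[of 0]]) auto
    ultimately show ?thesis
      using cis_Arg_limit[OF trajectory_growth[OF P_lim \<gamma>_hp \<gamma>_deriv \<gamma>_top] assms(1) b \<gamma>_nz, of sgn 1]
      by (simp add: \<theta>_def)
  qed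
  have "\<bar>Arg b\<bar> \<le> pi / 2"
  proof -
    have "0 \<le> \<bar>1 - \<alpha>\<bar> * (pi / 2)" by simp
    with bound show ?thesis by linarith
  qed
  from forward_angle[OF cis_top \<theta> assms(1) angle(2) b this]
  have \<theta>_top: "(\<theta> \<longlongrightarrow> \<sigma> * (pi / \<alpha> - pi / 2)) at_top"
    unfolding Arg_b using assms(1) by (simp add: field_simps)
  interpret backward_flow P H \<gamma> \<sigma> \<alpha> b
    using angle(1,2) \<sigma>(1) b sgn_b holP Re_P P_nz P_lim H \<gamma>_hp \<gamma>_deriv \<gamma>_bot \<gamma>_top \<sigma>(2) \<theta>_top
    by unfold_locales (simp_all add: \<theta>_def H_def)
  have "\<exists>\<Omega>. BFID F \<Omega> \<and> p_type F \<Omega> \<and> has_corner \<Omega> 1 (1 / \<alpha>)"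
    by (rule BFID_with_corner[OF assms(5) trans[OF assms(5)]])
  moreover have "converges_tangentially_1_at_bot u"
    unfolding converges_tangentially_1_at_bot_def
    using assms(8) tangential_of_angle[OF \<gamma>_hp angle(4)[unfolded \<theta>_def]] unfolding u_\<gamma>[symmetric] by blast
  moreover have "((\<lambda>t. Arg (1 - u t)) \<longlongrightarrow> sgn (Arg b) * (pi / 2)) at_bot" if "Arg b \<noteq> 0"
  proof -
    have "0 < pi / 2 * (2 - \<alpha>)" using that angle(2) pi_gt_zero unfolding Arg_b by (auto simp: less_le)
    then have "sgn (Arg b) = \<sigma>" unfolding Arg_b sgn_mult using \<sigma>_cases by (auto simp: zero_less_mult_iff)
    \<comment> \<open>Inversion negates the argument off the real axis; on it \<gamma> is positive
      and both arguments are 0.\<close>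
    moreover have "Arg (1 - u t) = - \<theta> t" for t
    proof -
      have "1 - u t = inverse (\<gamma> t)" by (simp add: \<gamma>_def)
      moreover have "Arg (\<gamma> t) = 0" if "\<gamma> t \<in> \<real>"
        using that \<gamma>_hp[of t] by (simp add: Arg_eq_0)
      ultimately show ?thesis by (simp add: Arg_inverse \<theta>_def)
    qed
    ultimately show ?thesis using tendsto_minus[OF \<sigma>(2)] by simp
  qed
  ultimately show ?thesis using angle(1-3) unfolding b_def by auto
qed

end
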